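(* For a banded-plus-semiseparable matrix $A\in\mathbb{R}^{n\times n}$ with constant-bounded ranks and bandwidths (that is, $A\in \mathrm{BPS}_{(r,p),(\ell,m)}^{n\times n}$ with $r,p,\ell,m$ bounded independently of $n$), the linear system $A\mathbf{x}=\mathbf{b}$ can be solved in $O(n)$ operations using the QR-based approach.
   Context: Notation: $\operatorname{tril}(M,-1)$ is the strictly lower triangular part of $M$ and $\operatorname{triu}(M,1)$ its strictly upper triangular part (other entries set to zero). Banded matrices: $\mathrm{BM}_{(\ell,m)}^{n\times n}$ is the set of $B=(b_{kj})\in\mathbb{R}^{n\times n}$ with $b_{kj}=0$ whenever $k-j>\ell$ or $j-k>m$. Banded-plus-semiseparable (BPS) matrices: $A\in \mathrm{BPS}_{(r,p),(\ell,m)}^{n\times n}$ if $A=B+\operatorname{tril}(UV^\top,-1)+\operatorname{triu}(WS^\top,1)$ for some $U,V\in\mathbb{R}^{n\times r}$, $W,S\in\mathbb{R}^{n\times p}$ and $B\in \mathrm{BM}_{(\ell,m)}^{n\times n}$; the matrix is assumed given through $B,U,V,W,S$. The QR-based approach: compute $A=QR$ with $Q$ a product of Householder reflections and $R$ upper triangular, the factors being stored in banded-plus-semiseparable form; then compute $\mathbf{c}=Q^\top\mathbf{b}$ by applying the structured reflections; then solve $R\mathbf{x}=\mathbf{c}$ by backward substitution exploiting the structure of $R$.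
   Formalization: The matrix A is additionally assumed to be nonsingular; for singular A the system may have no solution (e.g. A = 0, b ≠ 0) and backward substitution with R would divide by zero. *)

theory Defs
  imports "Jordan_Normal_Form.Matrix" Complex_Main
begin

section \<open>Banded-plus-semiseparable matrices\<close>

definition tril_strict :: "real mat \<Rightarrow> real mat" where
  "tril_strict M = mat (dim_row M) (dim_col M) (\<lambda>(i, j). if j < i then M $$ (i, j) else 0)"

definition triu_strict :: "real mat \<Rightarrow> real mat" where
  "triu_strict M = mat (dim_row M) (dim_col M) (\<lambda>(i, j). if i < j then M $$ (i, j) else 0)"

definition BM :: "nat \<Rightarrow> nat \<Rightarrow> nat \<Rightarrow> real mat set" where
  "BM n l m = {B \<in> carrier_mat n n.
     \<forall>k<n. \<forall>j<n. k > j + l \<or> j > k + m \<longrightarrow> B $$ (k, j) = 0}"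

definition bps_mat ::
  "real mat \<Rightarrow> real mat \<Rightarrow> real mat \<Rightarrow> real mat \<Rightarrow> real mat \<Rightarrow> real mat" where
  "bps_mat B U V W S =
     B + tril_strict (U * transpose_mat V) + triu_strict (W * transpose_mat S)"

definition BPS :: "nat \<Rightarrow> nat \<Rightarrow> nat \<Rightarrow> nat \<Rightarrow> nat \<Rightarrow> real mat set" where
  "BPS n r p l m = {A. \<exists>B U V W S.
     B \<in> BM n l m \<and> U \<in> carrier_mat n r \<and> V \<in> carrier_mat n r \<and>
     W \<in> carrier_mat n p \<and> S \<in> carrier_mat n p \<and> A = bps_mat B U V W S}"


section \<open>Householder reflections\<close>

text \<open>A reflection only for nonzero \<open>y\<close>.\<close>

definition householder :: "real vec \<Rightarrow> real mat" where
  "householder y = 1\<^sub>m (dim_vec y) -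
     (2 / (y \<bullet> y)) \<cdot>\<^sub>m mat (dim_vec y) (dim_vec y) (\<lambda>(i, j). y $ i * y $ j)"

text \<open>The product \<open>H\<^sub>0 H\<^sub>1 \<dots>\<close> of the reflections in the columns of \<open>Y\<close>, from left to right.\<close>

definition householder_prod :: "real mat \<Rightarrow> real mat" where
  "householder_prod Y =
     foldr (\<lambda>k Q. householder (col Y k) * Q) [0..<dim_col Y] (1\<^sub>m (dim_row Y))"


section \<open>Programs over the reals and their operation count\<close>

text \<open>
  A random access model with real arithmetic. The memory consists of named two-dimensional
  arrays of reals. Index expressions involve only the sizes and the enclosing loop variables,
  so real data can influence a run only through arithmetic and through the sign test. The only
  iteration is the bounded loop, whose variable ranges over \<open>0, \<dots>, N - 1\<close> and is local.
  Programs are syntactic objects that do not depend on the sizes of the input.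
\<close>

datatype iexp =
    INum nat
  | IVar string
  | IAdd iexp iexp
  | ISub iexp iexp
  | IMul iexp iexp

datatype rexp =
    RNum nat
  | RCell string iexp iexp
  | RAdd rexp rexp
  | RSub rexp rexp
  | RMul rexp rexp
  | RDiv rexp rexp
  | RSqrt rexp

datatype prog =
    Skip
  | Assign string iexp iexp rexp
  | Seq prog prog  (infixr ";;" 60)
  | IfLess iexp iexp prog prog
  | IfPos rexp prog prog
  | For string iexp prog

type_synonym env = "string \<Rightarrow> nat"
type_synonym memory = "string \<Rightarrow> nat \<Rightarrow> nat \<Rightarrow> real"

primrec ival :: "iexp \<Rightarrow> env \<Rightarrow> nat" where
  "ival (INum k) \<epsilon> = k"
| "ival (IVar x) \<epsilon> = \<epsilon> x"
| "ival (IAdd a b) \<epsilon> = ival a \<epsilon> + ival b \<epsilon>"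
| "ival (ISub a b) \<epsilon> = ival a \<epsilon> - ival b \<epsilon>"
| "ival (IMul a b) \<epsilon> = ival a \<epsilon> * ival b \<epsilon>"

primrec rval :: "rexp \<Rightarrow> env \<Rightarrow> memory \<Rightarrow> real" where
  "rval (RNum k) \<epsilon> \<mu> = real k"
| "rval (RCell X a b) \<epsilon> \<mu> = \<mu> X (ival a \<epsilon>) (ival b \<epsilon>)"
| "rval (RAdd e f) \<epsilon> \<mu> = rval e \<epsilon> \<mu> + rval f \<epsilon> \<mu>"
| "rval (RSub e f) \<epsilon> \<mu> = rval e \<epsilon> \<mu> - rval f \<epsilon> \<mu>"
| "rval (RMul e f) \<epsilon> \<mu> = rval e \<epsilon> \<mu> * rval f \<epsilon> \<mu>"
| "rval (RDiv e f) \<epsilon> \<mu> = rval e \<epsilon> \<mu> / rval f \<epsilon> \<mu>"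
| "rval (RSqrt e) \<epsilon> \<mu> = sqrt (rval e \<epsilon> \<mu>)"

definition upd_cell :: "string \<Rightarrow> nat \<Rightarrow> nat \<Rightarrow> real \<Rightarrow> memory \<Rightarrow> memory" where
  "upd_cell X i j a \<mu> = \<mu>(X := (\<mu> X)(i := (\<mu> X i)(j := a)))"

primrec run :: "prog \<Rightarrow> env \<Rightarrow> memory \<Rightarrow> memory" where
  "run Skip \<epsilon> \<mu> = \<mu>"
| "run (Assign X a b e) \<epsilon> \<mu> = upd_cell X (ival a \<epsilon>) (ival b \<epsilon>) (rval e \<epsilon> \<mu>) \<mu>"
| "run (P ;; P') \<epsilon> \<mu> = run P' \<epsilon> (run P \<epsilon> \<mu>)"
| "run (IfLess a b P P') \<epsilon> \<mu> = (if ival a \<epsilon> < ival b \<epsilon> then run P \<epsilon> \<mu> else run P' \<epsilon> \<mu>)"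
| "run (IfPos e P P') \<epsilon> \<mu> = (if 0 < rval e \<epsilon> \<mu> then run P \<epsilon> \<mu> else run P' \<epsilon> \<mu>)"
| "run (For x a P) \<epsilon> \<mu> = fold (\<lambda>i. run P (\<epsilon>(x := i))) [0..<ival a \<epsilon>] \<mu>"

text \<open>
  Every arithmetic operation, square root, comparison, memory access, index computation,
  assignment and loop iteration has unit cost; in particular the cost bounds the number of
  floating-point operations from above.
\<close>

primrec icost :: "iexp \<Rightarrow> nat" where
  "icost (INum k) = 1"
| "icost (IVar x) = 1"
| "icost (IAdd a b) = 1 + icost a + icost b"
| "icost (ISub a b) = 1 + icost a + icost b"
| "icost (IMul a b) = 1 + icost a + icost b"

primrec rcost :: "rexp \<Rightarrow> nat" where
  "rcost (RNum k) = 1"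
| "rcost (RCell X a b) = 1 + icost a + icost b"
| "rcost (RAdd e f) = 1 + rcost e + rcost f"
| "rcost (RSub e f) = 1 + rcost e + rcost f"
| "rcost (RMul e f) = 1 + rcost e + rcost f"
| "rcost (RDiv e f) = 1 + rcost e + rcost f"
| "rcost (RSqrt e) = 1 + rcost e"

primrec cost :: "prog \<Rightarrow> env \<Rightarrow> memory \<Rightarrow> nat" where
  "cost Skip \<epsilon> \<mu> = 0"
| "cost (Assign X a b e) \<epsilon> \<mu> = 1 + icost a + icost b + rcost e"
| "cost (P ;; P') \<epsilon> \<mu> = cost P \<epsilon> \<mu> + cost P' \<epsilon> (run P \<epsilon> \<mu>)"
| "cost (IfLess a b P P') \<epsilon> \<mu> = 1 + icost a + icost b +
     (if ival a \<epsilon> < ival b \<epsilon> then cost P \<epsilon> \<mu> else cost P' \<epsilon> \<mu>)"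
| "cost (IfPos e P P') \<epsilon> \<mu> = 1 + rcost e +
     (if 0 < rval e \<epsilon> \<mu> then cost P \<epsilon> \<mu> else cost P' \<epsilon> \<mu>)"
| "cost (For x a P) \<epsilon> \<mu> = 1 + icost a +
     (\<Sum>i<ival a \<epsilon>. 1 + cost P (\<epsilon>(x := i)) (fold (\<lambda>i. run P (\<epsilon>(x := i))) [0..<i] \<mu>))"


section \<open>Storage of vectors and structured matrices\<close>

definition size_env :: "nat \<Rightarrow> nat \<Rightarrow> nat \<Rightarrow> nat \<Rightarrow> nat \<Rightarrow> env" where
  "size_env n r p l m =
     (\<lambda>_. 0)(''n'' := n, ''r'' := r, ''p'' := p, ''l'' := l, ''m'' := m)"

definition vec_at :: "memory \<Rightarrow> string \<Rightarrow> nat \<Rightarrow> real vec" where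
  "vec_at \<mu> X n = vec n (\<lambda>i. \<mu> X i 0)"

definition mat_at :: "memory \<Rightarrow> string \<Rightarrow> nat \<Rightarrow> nat \<Rightarrow> real mat" where
  "mat_at \<mu> X n k = mat n k (\<lambda>(i, j). \<mu> X i j)"

text \<open>Only cells inside the band are significant; the others may contain anything.\<close>

definition band_at :: "memory \<Rightarrow> string \<Rightarrow> nat \<Rightarrow> nat \<Rightarrow> nat \<Rightarrow> real mat" where
  "band_at \<mu> X n l m = mat n n (\<lambda>(i, j). if i \<le> j + l \<and> j \<le> i + m then \<mu> X i j else 0)"

definition stores_bps ::
  "memory \<Rightarrow> string \<Rightarrow> nat \<Rightarrow> nat \<Rightarrow> nat \<Rightarrow> nat \<Rightarrow> nat \<Rightarrow> real mat \<Rightarrow> bool" where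
  "stores_bps \<mu> X n r p l m A \<longleftrightarrow>
     A = bps_mat (band_at \<mu> (X @ ''.B'') n l m)
           (mat_at \<mu> (X @ ''.U'') n r) (mat_at \<mu> (X @ ''.V'') n r)
           (mat_at \<mu> (X @ ''.W'') n p) (mat_at \<mu> (X @ ''.S'') n p)"

lemma BPS_iff_stores: "A \<in> BPS n r p l m \<longleftrightarrow> (\<exists>\<mu>. stores_bps \<mu> X n r p l m A)"
proof
  assume "A \<in> BPS n r p l m"
  then obtain B U V W S where *: "B \<in> BM n l m" "U \<in> carrier_mat n r" "V \<in> carrier_mat n r"
    "W \<in> carrier_mat n p" "S \<in> carrier_mat n p" "A = bps_mat B U V W S"
    unfolding BPS_def by blast
  define \<mu> :: memory where "\<mu> = (\<lambda>_ _ _. 0)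
    (X @ ''.B'' := (\<lambda>i j. B $$ (i, j)), X @ ''.U'' := (\<lambda>i j. U $$ (i, j)),
     X @ ''.V'' := (\<lambda>i j. V $$ (i, j)), X @ ''.W'' := (\<lambda>i j. W $$ (i, j)),
     X @ ''.S'' := (\<lambda>i j. S $$ (i, j)))"
  have "band_at \<mu> (X @ ''.B'') n l m = B"
    using *(1) by (intro eq_matI) (auto simp: band_at_def \<mu>_def BM_def not_le)
  moreover have "mat_at \<mu> (X @ ''.U'') n r = U" "mat_at \<mu> (X @ ''.V'') n r = V"
    "mat_at \<mu> (X @ ''.W'') n p = W" "mat_at \<mu> (X @ ''.S'') n p = S"
    using *(2-5) by (auto intro!: eq_matI simp: mat_at_def \<mu>_def)
  ultimately have "stores_bps \<mu> X n r p l m A"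
    using *(6) by (simp add: stores_bps_def)
  then show "\<exists>\<mu>. stores_bps \<mu> X n r p l m A" by blast
next
  assume "\<exists>\<mu>. stores_bps \<mu> X n r p l m A"
  then obtain \<mu> where "stores_bps \<mu> X n r p l m A" by blast
  then show "A \<in> BPS n r p l m"
    unfolding BPS_def stores_bps_def mem_Collect_eq
    by (intro exI conjI; (assumption)?) (auto simp: BM_def band_at_def mat_at_def)
qed


section \<open>The QR-based approach\<close>

text \<open>
  From the generators of \<open>A\<close>, \<open>F\<close> computes those of \<open>Y\<close>, whose columns are the Householder vectors,
  and of \<open>R\<close>, where \<open>A = Q R\<close> and \<open>Q\<close> is the product of the reflections. The reflections keep the
  lower rank and lower bandwidth of \<open>A\<close>, hence \<open>Y\<close> has lower rank \<open>r\<close> and lower bandwidth \<open>l\<close>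
  (and is lower triangular), while fill-in gives \<open>R\<close> the upper rank \<open>p + r\<close> and the upper
  bandwidth \<open>l + m\<close>.
\<close>

definition qr_factorizes :: "prog \<Rightarrow> bool" where
  "qr_factorizes F \<longleftrightarrow> (\<forall>n r p l m A \<mu>. stores_bps \<mu> ''A'' n r p l m A \<longrightarrow>
     (let \<mu>' = run F (size_env n r p l m) \<mu> in
      vec_at \<mu>' ''b'' n = vec_at \<mu> ''b'' n \<and>
      (\<exists>Y R. stores_bps \<mu>' ''Y'' n r 0 l 0 Y \<and> (\<forall>k<n. col Y k \<noteq> 0\<^sub>v n) \<and>
             stores_bps \<mu>' ''R'' n 0 (p + r) 0 (l + m) R \<and> upper_triangular R \<and>
             A = householder_prod Y * R)))"

text \<open>
  The second and third programs have to work for whatever structured reflections, respectively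
  structured upper triangular matrix, are stored: they rely on nothing else about \<open>A\<close>.
\<close>

definition applies_reflections :: "prog \<Rightarrow> bool" where
  "applies_reflections T \<longleftrightarrow> (\<forall>n r p l m Y \<mu>.
     stores_bps \<mu> ''Y'' n r 0 l 0 Y \<and> (\<forall>k<n. col Y k \<noteq> 0\<^sub>v n) \<longrightarrow>
     (let \<mu>' = run T (size_env n r p l m) \<mu> in
      vec_at \<mu>' ''c'' n = transpose_mat (householder_prod Y) *\<^sub>v vec_at \<mu> ''b'' n \<and>
      (\<forall>R. stores_bps \<mu> ''R'' n 0 (p + r) 0 (l + m) R \<longrightarrow>
           stores_bps \<mu>' ''R'' n 0 (p + r) 0 (l + m) R)))"

definition solves_triangular :: "prog \<Rightarrow> bool" where
  "solves_triangular S \<longleftrightarrow> (\<forall>n r p l m R \<mu>.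
     stores_bps \<mu> ''R'' n 0 (p + r) 0 (l + m) R \<and> upper_triangular R \<and> invertible_mat R \<longrightarrow>
     (let \<mu>' = run S (size_env n r p l m) \<mu> in
      R *\<^sub>v vec_at \<mu>' ''x'' n = vec_at \<mu> ''c'' n))"

definition qr_based_approach :: "prog \<Rightarrow> bool" where
  "qr_based_approach P \<longleftrightarrow> (\<exists>F T S. P = F ;; T ;; S \<and>
     qr_factorizes F \<and> applies_reflections T \<and> solves_triangular S)"

end

theory Submission
  imports Defs "Jordan_Normal_Form.Determinant"
begin

text \<open>
  The \<open>k\<close>-th Householder vector agrees below row \<open>k + l\<close> with \<open>U\<close> times a vector of length \<open>r\<close>, because
  eliminating a column only adds multiples of such vectors to the later ones. A reflection can
  therefore be applied to a column by touching \<open>l + 1\<close> of its rows, provided that two vectors of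
  length \<open>r\<close> are updated: the accumulated multiple of \<open>U\<close> that has been subtracted from the lower
  rows, and the product of the transpose of \<open>U\<close> with the lower rows of the original column. This state
  depends linearly on the column. Columns more than \<open>l + m\<close> to the right of the diagonal only differ
  in \<open>p + r\<close> coefficients, so instead of all of them it is enough to reflect \<open>p + r\<close> formal columns;
  their final rows and the coefficients are the generators of the upper part of \<open>R\<close>. Each of the \<open>n\<close>
  steps thus treats a bounded number of columns at bounded cost.
\<close>

section \<open>Reasoning about programs\<close>

text \<open>The obstacle is a column far to the right: reflecting it involves the product of
  \<open>U\<close> with all its lower rows, and reading these would cost order \<open>n\<close> per
  column. \<open>far_coord_total\<close> and \<open>column_tail\<close> split that product into
  pieces available in bounded time: rows already passed, where the column is a combination of
  columns of \<open>W\<close> whose products the formal columns keep anyway;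
  \<open>l + m + 1\<close> rows evaluated directly; and the rows below, where the column is
  \<open>U\<close> times a row of \<open>V\<close> and a running Gram matrix applies. A formal
  column with a prescribed total need not be a vector of length \<open>n\<close>, so its reflection
  is not an inner product. The recursion \<open>state\<close> is therefore defined by the formula
  that the inner product takes on true columns; linearity then concerns only the rows read so far.
  Correctness is measured against \<open>dense\<close>, a specification that no program executes.
  The band part of \<open>R\<close> is stored as the true entry minus what the other generators
  contribute, so these matter only outside the band. The operation count is syntactic: loop bounds
  depend on the sizes alone, and loops over \<open>n\<close> are never nested.\<close>

lemma run_For_invariant:
  assumes "I 0 \<mu>"
    and "\<And>i \<nu>. i < ival N \<eta> \<Longrightarrow> I i \<nu> \<Longrightarrow> I (Suc i) (run P (\<eta>(x := i)) \<nu>)"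
  shows "I (ival N \<eta>) (run (For x N P) \<eta> \<mu>)"
proof -
  have "k \<le> ival N \<eta> \<Longrightarrow> I k (fold (\<lambda>i. run P (\<eta>(x := i))) [0..<k] \<mu>)" for k
    by (induction k) (auto simp: assms)
  then show ?thesis by simp
qed

primrec written :: "prog \<Rightarrow> string set" where
  "written Skip = {}"
| "written (Assign X a b e) = {X}"
| "written (P ;; P') = written P \<union> written P'"
| "written (IfLess a b P P') = written P \<union> written P'"
| "written (IfPos e P P') = written P \<union> written P'"
| "written (For x a P) = written P"

text \<open>Frame rule: the arrays a program may change are over-approximated by the names it
  assigns to, so everything that a phase leaves alone is settled by simplification.\<close>

lemma run_unwritten: "X \<notin> written P \<Longrightarrow> run P \<eta> \<mu> X = \<mu> X"
proof (induction P arbitrary: \<eta> \<mu>)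
  case (For x a P)
  show ?case
    by (rule run_For_invariant[where I = "\<lambda>_ \<nu>. \<nu> X = \<mu> X"]) (use For in auto)
qed (auto simp: upd_cell_def)

section \<open>Closed forms for the effect of loops\<close>

definition upd_region ::
  "string \<Rightarrow> (nat \<Rightarrow> nat \<Rightarrow> bool) \<Rightarrow> (nat \<Rightarrow> nat \<Rightarrow> real) \<Rightarrow> memory \<Rightarrow> memory" where
  "upd_region X D f \<mu> = \<mu>(X := (\<lambda>i j. if D i j then f i j else \<mu> X i j))"

lemma upd_region_apply:
  "upd_region X D f \<mu> Y i j = (if Y = X \<and> D i j then f i j else \<mu> Y i j)"
  by (simp add: upd_region_def)

lemma upd_region_other: "Y \<noteq> X \<Longrightarrow> upd_region X D f \<mu> Y = \<mu> Y"
  by (simp add: upd_region_def)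

lemma upd_cell_eq_upd_region:
  assumes "\<And>i' j'. D i' j' \<longleftrightarrow> i' = i \<and> j' = j" "f i j = a"
  shows "upd_cell X i j a \<mu> = upd_region X D f \<mu>"
  using assms by (auto simp: upd_region_def upd_cell_def fun_eq_iff)

lemma upd_cell_apply:
  "upd_cell X i j a \<mu> Y i' j' = (if Y = X \<and> i' = i \<and> j' = j then a else \<mu> Y i' j')"
  by (simp add: upd_cell_def)

lemma upd_cell_overwrite: "upd_cell X i j a (upd_cell X i j b \<mu>) = upd_cell X i j a \<mu>"
  by (simp add: upd_cell_def)

text \<open>Iterations may overlap because all of them write values of one function \<open>f\<close>
  of the cell, so a rewritten cell receives the same value. The body may rely on the original
  content of cells outside the earlier regions; this covers loops that read one part of an array
  while filling another.\<close>

lemma run_For_region_sequential: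
  assumes body: "\<And>t \<nu>. t < ival N \<eta> \<Longrightarrow> (\<And>Y. Y \<noteq> X \<Longrightarrow> \<nu> Y = \<mu> Y) \<Longrightarrow>
      (\<And>i j. \<forall>s<t. \<not> D s i j \<Longrightarrow> \<nu> X i j = \<mu> X i j) \<Longrightarrow>
      run P (\<eta>(x := t)) \<nu> = upd_region X (D t) f \<nu>"
    and E: "\<And>i j. E i j \<longleftrightarrow> (\<exists>t<ival N \<eta>. D t i j)"
  shows "run (For x N P) \<eta> \<mu> = upd_region X E f \<mu>"
  unfolding E[abs_def]
proof (rule run_For_invariant[where I = "\<lambda>k \<nu>. \<nu> = upd_region X (\<lambda>i j. \<exists>t<k. D t i j) f \<mu>"])
  show "\<mu> = upd_region X (\<lambda>i j. \<exists>t<0. D t i j) f \<mu>"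
    by (simp add: upd_region_def)
next
  fix k \<nu> assume k: "k < ival N \<eta>" and \<nu>: "\<nu> = upd_region X (\<lambda>i j. \<exists>t<k. D t i j) f \<mu>"
  have "run P (\<eta>(x := k)) \<nu> = upd_region X (D k) f \<nu>"
    by (rule body[OF k]) (auto simp: \<nu> upd_region_def)
  then show "run P (\<eta>(x := k)) \<nu> = upd_region X (\<lambda>i j. \<exists>t<Suc k. D t i j) f \<mu>"
    by (auto simp: \<nu> upd_region_def fun_eq_iff less_Suc_eq)
qed

text \<open>With disjoint regions the body may read the very cells that it overwrites, since no
  earlier iteration has touched them. This is the form for in-place updates.\<close>

lemma run_For_region:
  assumes body: "\<And>t \<nu>. t < ival N \<eta> \<Longrightarrow> (\<And>Y. Y \<noteq> X \<Longrightarrow> \<nu> Y = \<mu> Y) \<Longrightarrow>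
      (\<And>i j. D t i j \<Longrightarrow> \<nu> X i j = \<mu> X i j) \<Longrightarrow>
      run P (\<eta>(x := t)) \<nu> = upd_region X (D t) f \<nu>"
    and disj: "\<And>s t i j. s < t \<Longrightarrow> D s i j \<Longrightarrow> D t i j \<Longrightarrow> False"
    and E: "\<And>i j. E i j \<longleftrightarrow> (\<exists>t<ival N \<eta>. D t i j)"
  shows "run (For x N P) \<eta> \<mu> = upd_region X E f \<mu>"
  using disj by (intro run_For_region_sequential[OF body E]) blast+

text \<open>The value written must be determined by arrays other than \<open>X\<close>; the
  functions \<open>a\<close> and \<open>b\<close> allow for shifted target indices.\<close>

lemma run_For_For_cells:
  assumes N': "\<And>s. ival N' (\<eta>(x := s)) = M"
    and body: "\<And>s t \<nu>. s < ival N \<eta> \<Longrightarrow> t < M \<Longrightarrow> (\<And>Y. Y \<noteq> X \<Longrightarrow> \<nu> Y = \<mu> Y) \<Longrightarrow>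
      run P (\<eta>(x := s, x' := t)) \<nu> = upd_cell X (a s t) (b s t) (f (a s t) (b s t)) \<nu>"
    and E: "\<And>i j. E i j \<longleftrightarrow> (\<exists>s<ival N \<eta>. \<exists>t<M. i = a s t \<and> j = b s t)"
  shows "run (For x N (For x' N' P)) \<eta> \<mu> = upd_region X E f \<mu>"
proof (rule run_For_region_sequential[where D = "\<lambda>s i j. \<exists>t<M. i = a s t \<and> j = b s t"])
  fix s \<nu> assume s: "s < ival N \<eta>" and \<nu>: "\<And>Y. Y \<noteq> X \<Longrightarrow> \<nu> Y = \<mu> Y"
  show "run (For x' N' P) (\<eta>(x := s)) \<nu> = upd_region X (\<lambda>i j. \<exists>t<M. i = a s t \<and> j = b s t) f \<nu>"
  proof (rule run_For_region_sequential[where D = "\<lambda>t i j. i = a s t \<and> j = b s t"])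
    fix t \<xi> assume "t < ival N' (\<eta>(x := s))" and "\<And>Y. Y \<noteq> X \<Longrightarrow> \<xi> Y = \<nu> Y"
    then show "run P (\<eta>(x := s, x' := t)) \<xi> = upd_region X (\<lambda>i j. i = a s t \<and> j = b s t) f \<xi>"
      using s \<nu> by (subst body) (auto simp: N' intro!: upd_cell_eq_upd_region)
  qed (simp add: N')
qed (simp add: E)

definition sum_into :: "string \<Rightarrow> iexp \<Rightarrow> iexp \<Rightarrow> string \<Rightarrow> iexp \<Rightarrow> rexp \<Rightarrow> rexp \<Rightarrow> prog" where
  "sum_into X a b x N e0 e =
     Assign X a b e0 ;; For x N (Assign X a b (RAdd (RCell X a b) e))"

text \<open>The partial sums live in the target cell, so the summand must be insensitive to that one
  cell. Other cells of the same array may occur in it, as happens when one slot is combined from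
  others.\<close>

lemma run_sum_into:
  assumes "\<And>t. ival a (\<eta>(x := t)) = ival a \<eta>" "\<And>t. ival b (\<eta>(x := t)) = ival b \<eta>"
    and "\<And>t z. t < ival N \<eta> \<Longrightarrow>
      rval e (\<eta>(x := t)) (upd_cell X (ival a \<eta>) (ival b \<eta>) z \<mu>) = rval e (\<eta>(x := t)) \<mu>"
  shows "run (sum_into X a b x N e0 e) \<eta> \<mu> = upd_cell X (ival a \<eta>) (ival b \<eta>)
     (rval e0 \<eta> \<mu> + (\<Sum>t<ival N \<eta>. rval e (\<eta>(x := t)) \<mu>)) \<mu>"
proof -
  let ?u = "\<lambda>z. upd_cell X (ival a \<eta>) (ival b \<eta>) z \<mu>"
  have "run (For x N (Assign X a b (RAdd (RCell X a b) e))) \<eta> (?u (rval e0 \<eta> \<mu>)) =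
    ?u (rval e0 \<eta> \<mu> + (\<Sum>t<ival N \<eta>. rval e (\<eta>(x := t)) \<mu>))"
    by (rule run_For_invariant[where I = "\<lambda>k \<nu>. \<nu> = ?u (rval e0 \<eta> \<mu> + (\<Sum>t<k. rval e (\<eta>(x := t)) \<mu>))"])
      (simp_all add: assms upd_cell_overwrite, simp add: upd_cell_apply add.assoc)
  then show ?thesis by (simp add: sum_into_def)
qed


section \<open>Linear operation counts\<close>

definition size_vars :: "string set" where
  "size_vars = {''n'', ''r'', ''p'', ''l'', ''m''}"

text \<open>Only the minuend of a difference is constrained: subtraction is truncated, so the
  minuend bounds the result.\<close>

primrec size_exp :: "iexp \<Rightarrow> bool" where
  "size_exp (INum k) = True"
| "size_exp (IVar x) = (x \<in> size_vars)"
| "size_exp (IAdd a b) = (size_exp a \<and> size_exp b)"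
| "size_exp (ISub a b) = size_exp a"
| "size_exp (IMul a b) = (size_exp a \<and> size_exp b)"

text \<open>The degree in \<open>n\<close> alone; the other four sizes count as constants because
  they are bounded by \<open>K\<close>.\<close>

primrec exp_degree :: "iexp \<Rightarrow> nat" where
  "exp_degree (INum k) = 0"
| "exp_degree (IVar x) = (if x = ''n'' then 1 else 0)"
| "exp_degree (IAdd a b) = max (exp_degree a) (exp_degree b)"
| "exp_degree (ISub a b) = exp_degree a"
| "exp_degree (IMul a b) = exp_degree a + exp_degree b"

text \<open>A loop variable named like a size would shadow that size and invalidate the bounds of
  the loops inside.\<close>

primrec size_bounded :: "prog \<Rightarrow> bool" where
  "size_bounded Skip = True"
| "size_bounded (Assign X a b e) = True"
| "size_bounded (P ;; P') = (size_bounded P \<and> size_bounded P')"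
| "size_bounded (IfLess a b P P') = (size_bounded P \<and> size_bounded P')"
| "size_bounded (IfPos e P P') = (size_bounded P \<and> size_bounded P')"
| "size_bounded (For x a P) = (x \<notin> size_vars \<and> size_exp a \<and> size_bounded P)"

primrec loop_degree :: "prog \<Rightarrow> nat" where
  "loop_degree Skip = 0"
| "loop_degree (Assign X a b e) = 0"
| "loop_degree (P ;; P') = max (loop_degree P) (loop_degree P')"
| "loop_degree (IfLess a b P P') = max (loop_degree P) (loop_degree P')"
| "loop_degree (IfPos e P P') = max (loop_degree P) (loop_degree P')"
| "loop_degree (For x a P) = exp_degree a + loop_degree P"

definition small_params :: "nat \<Rightarrow> env \<Rightarrow> bool" where
  "small_params K \<eta> \<longleftrightarrow> \<eta> ''r'' \<le> K \<and> \<eta> ''p'' \<le> K \<and> \<eta> ''l'' \<le> K \<and> \<eta> ''m'' \<le> K"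

text \<open>Powers of \<open>Suc n\<close> are at least 1 even for \<open>n = 0\<close>, so
  constants and lower degrees are absorbed by higher ones.\<close>

lemma le_mult_Suc_power: "x \<le> x * Suc N ^ d"
proof -
  have "1 \<le> Suc N ^ d" by (rule one_le_power) simp
  then show ?thesis using mult_le_mono2[of 1 _ x] by simp
qed

lemma power_max_bound:
  fixes C D a b N :: nat
  assumes "x \<le> C * Suc N ^ a" "y \<le> D * Suc N ^ b"
  shows "x + y \<le> (C + D) * Suc N ^ max a b"
proof -
  have "x \<le> C * Suc N ^ max a b"
    by (rule order_trans[OF assms(1)]) (intro mult_le_mono2 power_increasing, auto)
  moreover have "y \<le> D * Suc N ^ max a b"
    by (rule order_trans[OF assms(2)]) (intro mult_le_mono2 power_increasing, auto)
  ultimately show ?thesis by (simp add: add_mult_distrib)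
qed

lemma ival_bound:
  "size_exp a \<Longrightarrow> \<exists>C. \<forall>\<eta>. small_params K \<eta> \<longrightarrow> ival a \<eta> \<le> C * Suc (\<eta> ''n'') ^ exp_degree a"
proof (induction a)
  case (INum k)
  then show ?case by auto
next
  case (IVar x)
  then show ?case
    by (intro exI[of _ "Suc K"]) (auto simp: size_vars_def small_params_def)
next
  case (IAdd a b)
  then show ?case using power_max_bound by (simp del: power_Suc) meson
next
  case (ISub a b)
  then show ?case by (auto intro: le_trans[OF diff_le_self])
next
  case (IMul a b)
  then obtain C D where
    C: "\<And>\<eta>. small_params K \<eta> \<Longrightarrow> ival a \<eta> \<le> C * Suc (\<eta> ''n'') ^ exp_degree a" and
    D: "\<And>\<eta>. small_params K \<eta> \<Longrightarrow> ival b \<eta> \<le> D * Suc (\<eta> ''n'') ^ exp_degree b"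
    by auto
  show ?case
    using mult_le_mono[OF C D] by (intro exI[of _ "C * D"]) (simp add: power_add ac_simps)
qed

text \<open>Both branches are charged, so the bound is independent of the outcome of the test and
  hence of the real data.\<close>

lemma branch_bound:
  assumes "u \<le> C * Suc N ^ a" "w \<le> D * Suc N ^ b"
  shows "c + (if Q then u else w) \<le> (c + (C + D)) * Suc N ^ max a b"
proof -
  have "(if Q then u else w) \<le> u + w" by simp
  with power_max_bound[OF assms] le_mult_Suc_power[of c N "max a b"] show ?thesis
    unfolding add_mult_distrib by linarith
qed

text \<open>The constant is chosen before the environment and the memory: in the loop case each
  iteration starts from a different pair of them, and one constant has to serve all
  iterations.\<close>

lemma cost_bound:
  "size_bounded P \<Longrightarrow>
    \<exists>C. \<forall>\<eta> \<mu>. small_params K \<eta> \<longrightarrow> cost P \<eta> \<mu> \<le> C * Suc (\<eta> ''n'') ^ loop_degree P"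
proof (induction P)
  case (Seq P P')
  then obtain C D where
    C: "\<And>\<eta> \<mu>. small_params K \<eta> \<Longrightarrow> cost P \<eta> \<mu> \<le> C * Suc (\<eta> ''n'') ^ loop_degree P" and
    D: "\<And>\<eta> \<mu>. small_params K \<eta> \<Longrightarrow> cost P' \<eta> \<mu> \<le> D * Suc (\<eta> ''n'') ^ loop_degree P'"
    by fastforce
  show ?case
    by (intro exI[of _ "C + D"] allI impI) (auto intro!: power_max_bound C D)
next
  case (IfLess a b P P')
  then obtain C D where
    C: "\<And>\<eta> \<mu>. small_params K \<eta> \<Longrightarrow> cost P \<eta> \<mu> \<le> C * Suc (\<eta> ''n'') ^ loop_degree P" and
    D: "\<And>\<eta> \<mu>. small_params K \<eta> \<Longrightarrow> cost P' \<eta> \<mu> \<le> D * Suc (\<eta> ''n'') ^ loop_degree P'"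
    by fastforce
  show ?case
    unfolding cost.simps loop_degree.simps
    by (intro exI[of _ "1 + icost a + icost b + (C + D)"] allI impI branch_bound C D)
next
  case (IfPos e P P')
  then obtain C D where
    C: "\<And>\<eta> \<mu>. small_params K \<eta> \<Longrightarrow> cost P \<eta> \<mu> \<le> C * Suc (\<eta> ''n'') ^ loop_degree P" and
    D: "\<And>\<eta> \<mu>. small_params K \<eta> \<Longrightarrow> cost P' \<eta> \<mu> \<le> D * Suc (\<eta> ''n'') ^ loop_degree P'"
    by fastforce
  show ?case
    unfolding cost.simps loop_degree.simps
    by (intro exI[of _ "1 + rcost e + (C + D)"] allI impI branch_bound C D)
next
  case (For x a P)
  then obtain C D where
    C: "\<And>\<eta> \<mu>. small_params K \<eta> \<Longrightarrow> cost P \<eta> \<mu> \<le> C * Suc (\<eta> ''n'') ^ loop_degree P" and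
    D: "\<And>\<eta>. small_params K \<eta> \<Longrightarrow> ival a \<eta> \<le> D * Suc (\<eta> ''n'') ^ exp_degree a"
    using ival_bound by fastforce
  have "cost (For x a P) \<eta> \<mu> \<le> (1 + icost a + D * Suc C) * Suc (\<eta> ''n'') ^ loop_degree (For x a P)"
    if \<eta>: "small_params K \<eta>" for \<eta> \<mu>
  proof -
    let ?N = "Suc (\<eta> ''n'')"
    have x: "x \<notin> size_vars" using For.prems by simp
    then have "small_params K (\<eta>(x := i))" "(\<eta>(x := i)) ''n'' = \<eta> ''n''" for i
      using \<eta> by (auto simp: small_params_def size_vars_def)
    then have "cost P (\<eta>(x := i)) \<nu> \<le> C * ?N ^ loop_degree P" for i \<nu>
      using C by metis
    then have "1 + cost P (\<eta>(x := i)) \<nu> \<le> Suc C * ?N ^ loop_degree P" for i \<nu>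
      using add_mono[OF le_mult_Suc_power[of 1 "\<eta> ''n''" "loop_degree P"]] by simp
    then have "(\<Sum>i<ival a \<eta>. 1 + cost P (\<eta>(x := i)) (fold (\<lambda>i. run P (\<eta>(x := i))) [0..<i] \<mu>))
        \<le> (\<Sum>i<ival a \<eta>. Suc C * ?N ^ loop_degree P)"
      by (intro sum_mono)
    also have "\<dots> = ival a \<eta> * (Suc C * ?N ^ loop_degree P)" by simp
    also have "\<dots> \<le> (D * ?N ^ exp_degree a) * (Suc C * ?N ^ loop_degree P)"
      by (intro mult_le_mono1 D \<eta>)
    also have "\<dots> = D * Suc C * ?N ^ loop_degree (For x a P)"
      by (simp add: power_add algebra_simps)
    finally have "(\<Sum>i<ival a \<eta>. 1 + cost P (\<eta>(x := i)) (fold (\<lambda>i. run P (\<eta>(x := i))) [0..<i] \<mu>))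
      \<le> D * Suc C * ?N ^ loop_degree (For x a P)" .
    moreover have "1 + icost a \<le> (1 + icost a) * ?N ^ loop_degree (For x a P)"
      by (rule le_mult_Suc_power)
    ultimately show ?thesis
      unfolding cost.simps add_mult_distrib by linarith
  qed
  then show ?case by blast
qed auto


section \<open>Structured reflections acting on a column\<close>

text \<open>The window may run past \<open>n\<close>; since \<open>z\<close> vanishes there, every
  step can sum over the full \<open>l + 1\<close> offsets without a boundary case.\<close>

lemma sum_window_split:
  fixes z :: "nat \<Rightarrow> real"
  assumes "\<And>i. i < k \<Longrightarrow> z i = 0" "\<And>i. n \<le> i \<Longrightarrow> z i = 0"
  shows "(\<Sum>i<n. z i) = (\<Sum>e<Suc l. z (k + e)) + (\<Sum>i\<in>{Suc (k + l)..<n}. z i)"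
proof -
  have "(\<Sum>i<n. z i) = sum z ({k..<k + Suc l} \<union> {Suc (k + l)..<n})"
  proof (rule sum.mono_neutral_cong)
    show "z i = 0" if "i \<in> ({k..<k + Suc l} \<union> {Suc (k + l)..<n}) - {..<n}" for i
      using that assms(2) by auto
    show "z i = 0" if "i \<in> {..<n} - ({k..<k + Suc l} \<union> {Suc (k + l)..<n})" for i
      using that assms(1)[of i] by (cases "i < k") auto
  qed auto
  also have "\<dots> = sum z {k..<k + Suc l} + sum z {Suc (k + l)..<n}"
    by (rule sum.union_disjoint) auto
  also have "sum z {k..<k + Suc l} = (\<Sum>e<Suc l. z (k + e))"
    by (subst sum.atLeastLessThan_shift_0) (auto simp: atLeast0LessThan)
  finally show ?thesis .
qed

lemma sum_prefix_split:
  fixes z :: "nat \<Rightarrow> real"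
  assumes "\<And>i. n \<le> i \<Longrightarrow> z i = 0"
  shows "(\<Sum>i<n. z i) = (\<Sum>i<k. z i) + (\<Sum>i\<in>{k..<n}. z i)"
proof -
  have "(\<Sum>i<n. z i) = sum z ({..<k} \<union> {k..<n})"
    by (rule sum.mono_neutral_cong) (use assms in auto)
  also have "\<dots> = sum z {..<k} + sum z {k..<n}"
    by (rule sum.union_disjoint) auto
  finally show ?thesis .
qed

lemma sum_mult_combination:
  fixes h :: "'a \<Rightarrow> real"
  assumes "\<And>x. x \<in> X \<Longrightarrow> g x = (\<Sum>c\<in>C. f c * G c x)"
  shows "(\<Sum>x\<in>X. h x * g x) = (\<Sum>c\<in>C. f c * (\<Sum>x\<in>X. h x * G c x))"
proof -
  have "(\<Sum>x\<in>X. h x * g x) = (\<Sum>x\<in>X. \<Sum>c\<in>C. f c * (h x * G c x))"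
    by (intro sum.cong refl) (simp add: assms sum_distrib_left ac_simps)
  then show ?thesis
    by (subst (asm) sum.swap) (simp only: sum_distrib_left)
qed

text \<open>
  Reflections whose vectors \<open>y k\<close> satisfy \<open>y k i = U i \<bullet> v k\<close> below row \<open>k + l\<close>, acting on a column \<open>d\<close>.
  After \<open>k\<close> of them, row \<open>i \<ge> k + l\<close> of the column is \<open>d i - U i \<bullet> acc k\<close>, so the
  rows in the window \<open>k..k + l\<close> and the vectors \<open>acc k\<close> and \<open>tail k = (\<Sum>i\<ge>k + l. U i * d i)\<close>
  suffice to perform the next reflection. The total \<open>\<tau> = (\<Sum>i. U i * d i)\<close> is an independent
  argument because it is also used for formal columns that are not columns of any matrix.
\<close>

locale reflections =
  fixes n l r :: nat and U y v :: "nat \<Rightarrow> nat \<Rightarrow> real"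
  assumes U_out: "n \<le> i \<Longrightarrow> U i a = 0"
    and y_above: "i < k \<Longrightarrow> y k i = 0"
    and y_out: "n \<le> i \<Longrightarrow> y k i = 0"
    and y_tail: "k < n \<Longrightarrow> k + l < i \<Longrightarrow> y k i = (\<Sum>a<r. U i a * v k a)"
begin

definition beta :: "nat \<Rightarrow> real" where
  "beta k = 2 / (\<Sum>i<n. (y k i)\<^sup>2)"

definition gram :: "nat \<Rightarrow> nat \<Rightarrow> nat \<Rightarrow> real" where
  "gram k a b = (\<Sum>i\<in>{k..<n}. U i a * U i b)"

definition tail :: "(nat \<Rightarrow> real) \<Rightarrow> (nat \<Rightarrow> real) \<Rightarrow> nat \<Rightarrow> nat \<Rightarrow> real" where
  "tail d \<tau> k a = \<tau> a - (\<Sum>i<k + l. U i a * d i)"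

text \<open>On a true column this is the inner product with the \<open>k\<close>-th reflection
  vector. Below the window the vector is \<open>U i \<bullet> v k\<close> and the column is
  \<open>d i - U i \<bullet> P\<close>; multiplying out leaves \<open>tail\<close> at
  \<open>Suc k\<close>, whose rows begin just below the window, and a Gram matrix term. The formula
  is jointly linear in its data and makes sense for an arbitrary \<open>\<tau>\<close>.\<close>

definition weight ::
  "(nat \<Rightarrow> real) \<Rightarrow> (nat \<Rightarrow> real) \<Rightarrow> nat \<Rightarrow> (nat \<Rightarrow> real) \<Rightarrow> (nat \<Rightarrow> real) \<Rightarrow> real" where
  "weight d \<tau> k x P = (\<Sum>e<Suc l. y k (k + e) * x (k + e)) +
     (\<Sum>a<r. v k a * tail d \<tau> (Suc k) a - (\<Sum>b<r. gram (Suc (k + l)) a b * v k b) * P a)"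

primrec state ::
  "(nat \<Rightarrow> real) \<Rightarrow> (nat \<Rightarrow> real) \<Rightarrow> nat \<Rightarrow> (nat \<Rightarrow> real) \<times> (nat \<Rightarrow> real)" where
  "state d \<tau> 0 = (d, \<lambda>_. 0)"
| "state d \<tau> (Suc k) =
     (let (x, P) = state d \<tau> k; w = weight d \<tau> k x P
      in (\<lambda>i. x i - beta k * y k i * w, \<lambda>a. P a + beta k * v k a * w))"

definition entry :: "(nat \<Rightarrow> real) \<Rightarrow> (nat \<Rightarrow> real) \<Rightarrow> nat \<Rightarrow> nat \<Rightarrow> real" where
  "entry d \<tau> k = fst (state d \<tau> k)"

definition acc :: "(nat \<Rightarrow> real) \<Rightarrow> (nat \<Rightarrow> real) \<Rightarrow> nat \<Rightarrow> nat \<Rightarrow> real" where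
  "acc d \<tau> k = snd (state d \<tau> k)"

lemma entry_0: "entry d \<tau> 0 = d"
  and acc_0: "acc d \<tau> 0 = (\<lambda>_. 0)"
  and entry_Suc: "entry d \<tau> (Suc k) =
    (\<lambda>i. entry d \<tau> k i - beta k * y k i * weight d \<tau> k (entry d \<tau> k) (acc d \<tau> k))"
  and acc_Suc: "acc d \<tau> (Suc k) =
    (\<lambda>a. acc d \<tau> k a + beta k * v k a * weight d \<tau> k (entry d \<tau> k) (acc d \<tau> k))"
  by (simp_all add: entry_def acc_def case_prod_unfold Let_def)

lemma tail_Suc: "tail d \<tau> (Suc k) a = tail d \<tau> k a - U (k + l) a * d (k + l)"
  by (simp add: tail_def)

lemma gram_Suc: "gram k a b = U k a * U k b + gram (Suc k) a b"
proof (cases "k < n")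
  case True
  then show ?thesis by (simp add: gram_def sum.atLeast_Suc_lessThan)
next
  case False
  then show ?thesis by (simp add: gram_def U_out)
qed

text \<open>Loops start at 0, so the programs sum \<open>n\<close> shifted rows; those beyond the
  last row are zero.\<close>

lemma gram_shift: "gram k a b = (\<Sum>t<n. U (t + k) a * U (t + k) b)"
proof -
  have "gram k a b = (\<Sum>i\<in>{k..<n + k}. U i a * U i b)"
    unfolding gram_def by (rule sum.mono_neutral_left) (auto simp: U_out not_less)
  also have "\<dots> = (\<Sum>t<n. U (t + k) a * U (t + k) b)"
    using sum.shift_bounds_nat_ivl[of "\<lambda>i. U i a * U i b" 0 k n]
    by (simp add: atLeast0LessThan)
  finally show ?thesis .
qed

text \<open>Below its window each reflection subtracts a multiple of
  \<open>U i \<bullet> v k\<close>, and the multiplier is the same for all rows, so the subtractions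
  gather in \<open>acc\<close>. This holds for formal columns too.\<close>

lemma entry_tail:
  assumes "k \<le> n" "k + l \<le> i"
  shows "entry d \<tau> k i = d i - (\<Sum>a<r. U i a * acc d \<tau> k a)"
  using assms
proof (induction k)
  case 0
  then show ?case by (simp add: entry_0 acc_0)
next
  case (Suc k)
  then have "y k i = (\<Sum>a<r. U i a * v k a)" by (intro y_tail) auto
  with Suc show ?case
    by (simp add: entry_Suc acc_Suc algebra_simps sum.distrib sum_distrib_left sum_distrib_right)
qed

text \<open>A reflection vector starts at its own index, so row \<open>i\<close> is final once step
  \<open>i\<close> is done.\<close>

lemma entry_stable: "i < k \<Longrightarrow> k \<le> k' \<Longrightarrow> entry d \<tau> k' i = entry d \<tau> k i"
  by (induction k' rule: nat_induct) (auto simp: entry_Suc y_above le_Suc_eq)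

lemma gram_form:
  assumes "\<And>i. i \<in> {Suc (k + l)..<n} \<Longrightarrow> z i = (\<Sum>a<r. U i a * c a)"
    and "\<And>i. i \<in> {Suc (k + l)..<n} \<Longrightarrow> z' i = (\<Sum>a<r. U i a * c' a)"
  shows "(\<Sum>i\<in>{Suc (k + l)..<n}. z i * z' i) =
    (\<Sum>a<r. (\<Sum>b<r. gram (Suc (k + l)) a b * c b) * c' a)"
proof -
  let ?I = "{Suc (k + l)..<n}"
  have "(\<Sum>i\<in>?I. z i * z' i) = (\<Sum>i\<in>?I. \<Sum>a<r. \<Sum>b<r. U i a * U i b * c b * c' a)"
  proof (rule sum.cong[OF refl])
    fix i assume i: "i \<in> ?I"
    have "z i * z' i = (\<Sum>a<r. U i a * c' a) * (\<Sum>b<r. U i b * c b)"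
      using assms i by (simp add: mult.commute)
    also have "\<dots> = (\<Sum>a<r. \<Sum>b<r. U i a * U i b * c b * c' a)"
      unfolding sum_product by (intro sum.cong refl) simp
    finally show "z i * z' i = (\<Sum>a<r. \<Sum>b<r. U i a * U i b * c b * c' a)" .
  qed
  also have "\<dots> = (\<Sum>a<r. \<Sum>b<r. \<Sum>i\<in>?I. U i a * U i b * c b * c' a)"
    by (subst sum.swap) (intro sum.cong refl sum.swap)
  also have "\<dots> = (\<Sum>a<r. (\<Sum>b<r. gram (Suc (k + l)) a b * c b) * c' a)"
    by (simp add: gram_def sum_distrib_right)
  finally show ?thesis .
qed

text \<open>Serves both the pivot column and the reflection vector made from it: they differ only in
  row \<open>k\<close> and share the coefficients \<open>c\<close>.\<close>

lemma norm_window: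
  assumes "\<And>i. i < k \<Longrightarrow> z i = 0" "\<And>i. n \<le> i \<Longrightarrow> z i = 0"
    and "\<And>i. k + l < i \<Longrightarrow> z i = (\<Sum>a<r. U i a * c a)"
  shows "(\<Sum>i<n. (z i)\<^sup>2) = (\<Sum>e<Suc l. (z (k + e))\<^sup>2) +
    (\<Sum>a<r. (\<Sum>b<r. gram (Suc (k + l)) a b * c b) * c a)"
  using sum_window_split[of k "\<lambda>i. (z i)\<^sup>2" n l] gram_form[of k z c z c] assms
  by (auto simp: power2_eq_square)

text \<open>Here \<open>\<tau>\<close> has to be the true total: only then is \<open>tail\<close>
  the sum over the lower rows of the column.\<close>

lemma weight_column:
  assumes k: "k < n" and d: "\<And>i. n \<le> i \<Longrightarrow> d i = 0"
    and \<tau>: "\<And>a. a < r \<Longrightarrow> \<tau> a = (\<Sum>i<n. U i a * d i)"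
  shows "weight d \<tau> k (entry d \<tau> k) (acc d \<tau> k) = (\<Sum>i<n. y k i * entry d \<tau> k i)"
proof -
  let ?I = "{Suc (k + l)..<n}" and ?x = "entry d \<tau> k" and ?P = "acc d \<tau> k"
  have "(\<Sum>i\<in>?I. y k i * ?x i) =
    (\<Sum>i\<in>?I. y k i * d i) - (\<Sum>i\<in>?I. y k i * (\<Sum>a<r. U i a * ?P a))"
    using k by (simp add: entry_tail sum_subtractf right_diff_distrib)
  also have "(\<Sum>i\<in>?I. y k i * (\<Sum>a<r. U i a * ?P a)) =
    (\<Sum>a<r. (\<Sum>b<r. gram (Suc (k + l)) a b * v k b) * ?P a)"
    by (rule gram_form) (use k in \<open>auto simp: y_tail\<close>)
  also have "(\<Sum>i\<in>?I. y k i * d i) = (\<Sum>i\<in>?I. \<Sum>a<r. v k a * (U i a * d i))"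
    using k by (intro sum.cong refl) (simp add: y_tail sum_distrib_left ac_simps)
  also have "\<dots> = (\<Sum>a<r. v k a * (\<Sum>i\<in>?I. U i a * d i))"
    by (subst sum.swap) (simp add: sum_distrib_left)
  also have "\<dots> = (\<Sum>a<r. v k a * tail d \<tau> (Suc k) a)"
  proof (intro sum.cong refl arg_cong[where f = "\<lambda>t. _ * t"])
    fix a assume "a \<in> {..<r}"
    then show "(\<Sum>i\<in>?I. U i a * d i) = tail d \<tau> (Suc k) a"
      using sum_prefix_split[of n "\<lambda>i. U i a * d i" "Suc (k + l)"] d
      by (simp add: tail_def \<tau>)
  qed
  finally have "(\<Sum>i\<in>?I. y k i * ?x i) = (\<Sum>a<r. v k a * tail d \<tau> (Suc k) a) -
    (\<Sum>a<r. (\<Sum>b<r. gram (Suc (k + l)) a b * v k b) * ?P a)" .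
  moreover have "(\<Sum>i<n. y k i * ?x i) =
      (\<Sum>e<Suc l. y k (k + e) * ?x (k + e)) + (\<Sum>i\<in>?I. y k i * ?x i)"
    by (rule sum_window_split) (auto simp: y_above y_out)
  ultimately show ?thesis
    by (simp add: weight_def sum_subtractf)
qed

text \<open>Up to step \<open>K\<close> the recursion reads \<open>d\<close> only above row
  \<open>K + l\<close>, through the windows and through the prefix subtracted in
  \<open>tail\<close>. Agreement on these rows must suffice, because a far column is a combination
  of the columns of \<open>W\<close> on its upper rows alone; its lower rows enter through
  \<open>\<tau>\<close>.\<close>

lemma state_linear:
  assumes d: "\<And>i. i < K + l \<Longrightarrow> d i = (\<Sum>c<q. f c * D c i)"
    and \<tau>: "\<And>a. a < r \<Longrightarrow> \<tau> a = (\<Sum>c<q. f c * \<theta> c a)"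
    and "k \<le> K"
  shows "(\<forall>i<K + l. entry d \<tau> k i = (\<Sum>c<q. f c * entry (D c) (\<theta> c) k i)) \<and>
    (\<forall>a<r. acc d \<tau> k a = (\<Sum>c<q. f c * acc (D c) (\<theta> c) k a))"
  using \<open>k \<le> K\<close>
proof (induction k)
  case 0
  then show ?case using d by (simp add: entry_0 acc_0)
next
  case (Suc k)
  have tl: "tail d \<tau> (Suc k) a = (\<Sum>c<q. f c * tail (D c) (\<theta> c) (Suc k) a)" if "a < r" for a
  proof -
    have "(\<Sum>i<Suc k + l. U i a * d i) = (\<Sum>c<q. f c * (\<Sum>i<Suc k + l. U i a * D c i))"
      by (rule sum_mult_combination) (use Suc.prems d in auto)
    then show ?thesis
      using that by (simp add: tail_def \<tau> right_diff_distrib sum_subtractf del: sum.lessThan_Suc)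
  qed
  let ?w = "\<lambda>c. weight (D c) (\<theta> c) k (entry (D c) (\<theta> c) k) (acc (D c) (\<theta> c) k)"
  have 1: "(\<Sum>e<Suc l. y k (k + e) * entry d \<tau> k (k + e)) =
    (\<Sum>c<q. f c * (\<Sum>e<Suc l. y k (k + e) * entry (D c) (\<theta> c) k (k + e)))"
    by (rule sum_mult_combination) (use Suc in auto)
  have 2: "(\<Sum>a<r. v k a * tail d \<tau> (Suc k) a) =
    (\<Sum>c<q. f c * (\<Sum>a<r. v k a * tail (D c) (\<theta> c) (Suc k) a))"
    by (rule sum_mult_combination) (simp add: tl)
  have 3: "(\<Sum>a<r. h a * acc d \<tau> k a) = (\<Sum>c<q. f c * (\<Sum>a<r. h a * acc (D c) (\<theta> c) k a))" for h
    by (rule sum_mult_combination) (use Suc in auto)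
  have w: "weight d \<tau> k (entry d \<tau> k) (acc d \<tau> k) = (\<Sum>c<q. f c * ?w c)"
    by (simp only: weight_def 1 2 3 sum_subtractf distrib_left right_diff_distrib sum.distrib)
  show ?case
    using Suc unfolding entry_Suc acc_Suc w
    by (auto simp: algebra_simps sum_distrib_left sum_subtractf sum.distrib)
qed

end


section \<open>Householder triangularisation of a semiseparable matrix\<close>

text \<open>
  The sign prevents cancellation to zero; for a column that already vanishes the value \<open>1\<close> keeps
  the reflection proper.
\<close>

definition hvec :: "nat \<Rightarrow> nat \<Rightarrow> (nat \<Rightarrow> real) \<Rightarrow> nat \<Rightarrow> real" where
  "hvec n k z i = (let \<sigma> = (\<Sum>i\<in>{k..<n}. (z i)\<^sup>2) in
     if i < k \<or> n \<le> i then 0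
     else if i = k then (if 0 < z k then z k + sqrt \<sigma> else if 0 < \<sigma> then z k - sqrt \<sigma> else 1)
     else z i)"

lemma hvec_pivot_nonzero:
  assumes "k < n"
  shows "hvec n k z k \<noteq> 0"
proof -
  have "0 \<le> (\<Sum>i\<in>{k..<n}. (z i)\<^sup>2)" by (intro sum_nonneg) auto
  then show ?thesis
    using assms by (auto simp: hvec_def Let_def add_pos_nonneg dest: less_imp_neq)
      (smt (verit) real_sqrt_gt_zero real_sqrt_ge_zero)+
qed

text \<open>Let \<open>s\<close> be the squared norm below the pivot and \<open>g\<close> the new
  pivot, that is \<open>z k\<close> plus or minus a root of \<open>\<sigma>\<close>. Then
  \<open>g\<^sup>2 + s = 2 * (g * z k + s)\<close>, so the reflection subtracts exactly one copy of
  its vector, and that vector equals \<open>z\<close> below row \<open>k\<close>.\<close>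

lemma hvec_annihilates:
  assumes k: "k < n" and i: "k < i" "i < n"
  shows "z i - 2 / (\<Sum>t<n. (hvec n k z t)\<^sup>2) * hvec n k z i * (\<Sum>t<n. hvec n k z t * z t) = 0"
proof -
  let ?h = "hvec n k z"
  define g s \<sigma> where "g = ?h k" and "s = (\<Sum>t\<in>{Suc k..<n}. (z t)\<^sup>2)"
    and "\<sigma> = (\<Sum>t\<in>{k..<n}. (z t)\<^sup>2)"
  have split: "(\<Sum>t<n. F t) = F k + (\<Sum>t\<in>{Suc k..<n}. F t)" if "\<And>t. t < k \<Longrightarrow> F t = 0"
    for F :: "nat \<Rightarrow> real"
  proof -
    have "(\<Sum>t<n. F t) = (\<Sum>t\<in>{k..<n}. F t)"
      by (rule sum.mono_neutral_right) (use that in auto)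
    then show ?thesis using k by (simp add: sum.atLeast_Suc_lessThan)
  qed
  have h: "?h t = z t" if "t \<in> {Suc k..<n}" for t
    using that by (auto simp: hvec_def Let_def)
  have hh: "(\<Sum>t<n. (?h t)\<^sup>2) = g\<^sup>2 + s"
    by (subst split) (auto simp: hvec_def g_def s_def h intro!: sum.cong)
  have hz: "(\<Sum>t<n. ?h t * z t) = g * z k + s"
    by (subst split) (auto simp: hvec_def g_def s_def h power2_eq_square intro!: sum.cong)
  have \<sigma>: "\<sigma> = (z k)\<^sup>2 + s"
    using k by (simp add: \<sigma>_def s_def sum.atLeast_Suc_lessThan)
  have s: "0 \<le> s" unfolding s_def by (intro sum_nonneg) auto
  show ?thesis
  proof (cases "\<sigma> = 0")
    \<comment> \<open>A column vanishing from the pivot downwards has nothing to eliminate; the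
      default pivot 1 affects row \<open>k\<close> of the vector only, and \<open>z i\<close> is
      already 0.\<close>
    case True
    then have "s = 0" using \<sigma> s by (smt (verit) zero_le_power2)
    then have "(z i)\<^sup>2 = 0"
      using sum_nonneg_eq_0_iff[of "{Suc k..<n}" "\<lambda>t. (z t)\<^sup>2"] i unfolding s_def by auto
    then show ?thesis using h[of i] i by simp
  next
    case False
    then have pos: "0 < \<sigma>" using \<sigma> s by (smt (verit) zero_le_power2)
    then obtain t where sq: "t * t = \<sigma>" and "g = z k + t \<or> g = z k - t"
      using k by (intro that[of "sqrt \<sigma>"]) (auto simp: g_def hvec_def \<sigma>_def[symmetric])
    then have "g\<^sup>2 + s = 2 * (g * z k + s)"
    proof (elim disjE)
      assume g: "g = z k + t"
      show ?thesis unfolding g using sq \<sigma> by (simp add: power2_eq_square algebra_simps)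
    next
      assume g: "g = z k - t"
      show ?thesis unfolding g using sq \<sigma> by (simp add: power2_eq_square algebra_simps)
    qed
    moreover have "0 < g\<^sup>2 + s"
      using hvec_pivot_nonzero[OF k, of z] s by (simp add: g_def add_pos_nonneg)
    ultimately have "2 / (g\<^sup>2 + s) * (g * z k + s) = 1" by (simp add: field_simps)
    then have "2 / (g\<^sup>2 + s) * z i * (g * z k + s) = z i"
      by (metis mult.assoc mult.commute mult.right_neutral)
    then show ?thesis
      unfolding hh hz using h[of i] i by simp
  qed
qed

text \<open>Of the band matrix only its effect is recorded: outside the band \<open>A\<close> agrees
  with the low-rank products. Rows from \<open>n\<close> on are zero, so windows may overlap the
  lower edge.\<close>

locale bps_data =
  fixes n r p l m :: nat and U V W S A :: "nat \<Rightarrow> nat \<Rightarrow> real"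
  assumes U_zero: "n \<le> i \<Longrightarrow> U i a = 0"
    and A_zero: "n \<le> i \<Longrightarrow> A i j = 0"
    and A_lower: "j < n \<Longrightarrow> j + l < i \<Longrightarrow> A i j = (\<Sum>a<r. U i a * V j a)"
    and A_upper: "j < n \<Longrightarrow> i + m < j \<Longrightarrow> A i j = (\<Sum>c<p. W i c * S j c)"
begin

text \<open>
  The second component \<open>P k a j\<close> only serves to express the tail of the \<open>k\<close>-th
  reflection vector as \<open>U i \<bullet> (V k - P k k)\<close>.
\<close>

primrec dense :: "nat \<Rightarrow> (nat \<Rightarrow> nat \<Rightarrow> real) \<times> (nat \<Rightarrow> nat \<Rightarrow> real)" where
  "dense 0 = (A, \<lambda>_ _. 0)"
| "dense (Suc k) =
     (let (M, P) = dense k; y = hvec n k (\<lambda>i. M i k);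
          b = 2 / (\<Sum>i<n. (y i)\<^sup>2); w = (\<lambda>j. \<Sum>i<n. y i * M i j)
      in (\<lambda>i j. M i j - b * y i * w j, \<lambda>a j. P a j + b * (V k a - P a k) * w j))"

definition M :: "nat \<Rightarrow> nat \<Rightarrow> nat \<Rightarrow> real" where "M k = fst (dense k)"
definition P :: "nat \<Rightarrow> nat \<Rightarrow> nat \<Rightarrow> real" where "P k = snd (dense k)"
definition y :: "nat \<Rightarrow> nat \<Rightarrow> real" where "y k = hvec n k (\<lambda>i. M k i k)"
definition v :: "nat \<Rightarrow> nat \<Rightarrow> real" where "v k a = V k a - P k a k"

lemma M_0: "M 0 = A" and P_0: "P 0 = (\<lambda>_ _. 0)"
  and M_Suc: "M (Suc k) i j =
    M k i j - 2 / (\<Sum>i<n. (y k i)\<^sup>2) * y k i * (\<Sum>i<n. y k i * M k i j)"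
  and P_Suc: "P (Suc k) a j =
    P k a j + 2 / (\<Sum>i<n. (y k i)\<^sup>2) * v k a * (\<Sum>i<n. y k i * M k i j)"
  by (simp_all add: M_def P_def y_def v_def case_prod_unfold Let_def)

lemma M_out: "n \<le> i \<Longrightarrow> M k i j = 0"
  by (induction k) (auto simp: M_0 M_Suc A_zero y_def hvec_def)

lemma y_eq_M: "k < i \<Longrightarrow> y k i = M k i k"
  by (auto simp: y_def hvec_def Let_def M_out)

text \<open>The two claims feed each other: the tail of \<open>y k\<close> is read off from column
  \<open>k\<close> of \<open>M k\<close>, where \<open>A i k\<close> is
  \<open>U i \<bullet> V k\<close>, and this tail in turn yields \<open>M (Suc k)\<close>. The first
  implication is isolated as the local fact \<open>y\<close> and used inside the induction.\<close>

lemma M_tail: "k \<le> n \<Longrightarrow> k + l \<le> i \<Longrightarrow> M k i j = A i j - (\<Sum>a<r. U i a * P k a j)"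
  and y_tail: "k < n \<Longrightarrow> k + l < i \<Longrightarrow> y k i = (\<Sum>a<r. U i a * v k a)"
proof -
  have y: "y k i = (\<Sum>a<r. U i a * v k a)"
    if "M k i k = A i k - (\<Sum>a<r. U i a * P k a k)" "k < n" "k + l < i" for k i
    using that by (simp add: y_eq_M A_lower v_def right_diff_distrib sum_subtractf)
  show M: "k \<le> n \<Longrightarrow> k + l \<le> i \<Longrightarrow> M k i j = A i j - (\<Sum>a<r. U i a * P k a j)" for k i j
  proof (induction k arbitrary: i j)
    case 0
    then show ?case by (simp add: M_0 P_0)
  next
    case (Suc k)
    define b w where "b = 2 / (\<Sum>i<n. (y k i)\<^sup>2)" and "w = (\<Sum>i<n. y k i * M k i j)"
    have "y k i = (\<Sum>a<r. U i a * v k a)" using Suc by (intro y) auto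
    then have "M (Suc k) i j = M k i j - b * (\<Sum>a<r. U i a * v k a) * w"
      by (simp add: M_Suc b_def w_def)
    moreover have "P (Suc k) a j = P k a j + b * v k a * w" for a
      by (simp add: P_Suc b_def w_def)
    ultimately show ?case
      using Suc by (simp add: algebra_simps sum.distrib sum_distrib_left sum_distrib_right)
  qed
  show "k < n \<Longrightarrow> k + l < i \<Longrightarrow> y k i = (\<Sum>a<r. U i a * v k a)"
    by (intro y M) auto
qed

sublocale reflections n l r U y v
proof
  show "k < n \<Longrightarrow> k + l < i \<Longrightarrow> y k i = (\<Sum>a<r. U i a * v k a)" for k i
    by (rule y_tail)
qed (auto simp: U_zero y_def hvec_def)

definition total :: "nat \<Rightarrow> nat \<Rightarrow> real" where
  "total j a = (\<Sum>i<n. U i a * A i j)"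

text \<open>Bridge between the specification and the compressed recursion: with the true total,
  \<open>weight_column\<close> turns the weight into the inner product that \<open>dense\<close>
  uses.\<close>

lemma column_state:
  "k \<le> n \<Longrightarrow> entry (\<lambda>i. A i j) (total j) k = (\<lambda>i. M k i j) \<and>
    acc (\<lambda>i. A i j) (total j) k = (\<lambda>a. P k a j)"
proof (induction k)
  case 0
  then show ?case by (simp add: entry_0 acc_0 M_0 P_0)
next
  case (Suc k)
  then have "weight (\<lambda>i. A i j) (total j) k (\<lambda>i. M k i j) (\<lambda>a. P k a j) =
      (\<Sum>i<n. y k i * M k i j)"
    using weight_column[of k "\<lambda>i. A i j" "total j", OF _ A_zero total_def] by simp
  with Suc show ?case
    by (simp add: entry_Suc acc_Suc M_Suc P_Suc beta_def)
qed

text \<open>Column \<open>k\<close> is cleared by \<open>hvec_annihilates\<close>. For an earlier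
  column every product with \<open>y k\<close> has a zero factor, so step \<open>k\<close> leaves it
  unchanged.\<close>

lemma M_annihilated: "k \<le> n \<Longrightarrow> j < k \<Longrightarrow> j < i \<Longrightarrow> M k i j = 0"
proof (induction k arbitrary: i)
  case (Suc k)
  show ?case
  proof (cases "j = k")
    case True
    show ?thesis
    proof (cases "i < n")
      case True
      then show ?thesis
        using hvec_annihilates[of k n i "\<lambda>i. M k i k"] Suc.prems \<open>j = k\<close>
        by (simp add: M_Suc y_def)
    qed (simp add: M_out)
  next
    case False
    have "y k t * M k t j = 0" for t
      using Suc False by (cases "t < k") (auto simp: y_above)
    then have "(\<Sum>t<n. y k t * M k t j) = 0" by (intro sum.neutral) auto
    then show ?thesis using Suc False by (simp add: M_Suc)
  qed
qed simp

text \<open>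
  A column \<open>j\<close> far to the right of the diagonal is, down to row \<open>j - m\<close>, the combination of the
  columns of \<open>W\<close> with coefficients \<open>S j\<close>; its lower rows enter the recursion only through its
  total. Hence its state is the combination of the states of \<open>p + r\<close> formal columns: the columns
  of \<open>W\<close> with total \<open>0\<close>, and the zero column with total the \<open>a\<close>-th unit vector.
\<close>

definition feature_col :: "nat \<Rightarrow> nat \<Rightarrow> real" where
  "feature_col c i = (if c < p then W i c else 0)"

definition feature_total :: "nat \<Rightarrow> nat \<Rightarrow> real" where
  "feature_total c a = (if c = p + a then 1 else 0)"

definition coord :: "nat \<Rightarrow> nat \<Rightarrow> real" where
  "coord j c = (if c < p then S j c else total j (c - p))"

text \<open>Rows \<open>i < k + l\<close> satisfy \<open>i + m < j\<close>, so there
  \<open>A i j\<close> comes from \<open>W\<close> and \<open>S\<close>, and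
  \<open>state_linear\<close> applies with \<open>K = k\<close>. This inequality is the source of
  the upper bandwidth \<open>l + m\<close> of \<open>R\<close>.\<close>

lemma far_column_state:
  assumes "j < n" "k + (l + m) \<le> j"
  shows "i < k + l \<Longrightarrow>
      M k i j = (\<Sum>c<p + r. coord j c * entry (feature_col c) (feature_total c) k i)"
    and "a < r \<Longrightarrow>
      P k a j = (\<Sum>c<p + r. coord j c * acc (feature_col c) (feature_total c) k a)"
proof -
  have d: "A i j = (\<Sum>c<p + r. coord j c * feature_col c i)" if "i < k + l" for i
  proof -
    have "(\<Sum>c<p + r. coord j c * feature_col c i) = (\<Sum>c<p. coord j c * feature_col c i)"
      by (rule sum.mono_neutral_right) (auto simp: feature_col_def)
    also have "\<dots> = (\<Sum>c<p. W i c * S j c)"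
      by (rule sum.cong) (auto simp: feature_col_def coord_def)
    also have "\<dots> = A i j"
      by (rule A_upper[symmetric]) (use assms that in auto)
    finally show ?thesis by simp
  qed
  have \<tau>: "total j a = (\<Sum>c<p + r. coord j c * feature_total c a)" if "a < r" for a
  proof -
    have "(\<Sum>c<p + r. coord j c * feature_total c a) = (\<Sum>c<p + r. if c = p + a then coord j c else 0)"
      by (rule sum.cong) (auto simp: feature_total_def)
    then show ?thesis using that by (simp add: coord_def)
  qed
  have "k \<le> n" using assms by simp
  with state_linear[where K = k and k = k and d = "\<lambda>i. A i j" and \<tau> = "total j" and D = feature_col
      and \<theta> = feature_total, OF d \<tau>]
  show "i < k + l \<Longrightarrow>
      M k i j = (\<Sum>c<p + r. coord j c * entry (feature_col c) (feature_total c) k i)"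
    and "a < r \<Longrightarrow>
      P k a j = (\<Sum>c<p + r. coord j c * acc (feature_col c) (feature_total c) k a)"
    by (simp_all add: column_state)
qed

lemma M_stable: "i < k \<Longrightarrow> k \<le> k' \<Longrightarrow> k' \<le> n \<Longrightarrow> M k' i j = M k i j"
  using entry_stable[of i k k' "\<lambda>i. A i j" "total j"] column_state[of k j] column_state[of k' j]
  by auto

text \<open>Row \<open>i\<close> is final at step \<open>Suc i\<close>, and the distance condition
  is that of \<open>far_column_state\<close> at this step. One factor depends on the row and the
  other on the column, which gives the upper rank \<open>p + r\<close>.\<close>

lemma R_far:
  assumes "j < n" "i + (l + m) < j"
  shows "M n i j =
    (\<Sum>c<p + r. entry (feature_col c) (feature_total c) (Suc i) i * coord j c)"
  using far_column_state(1)[of j "Suc i" i] M_stable[of i "Suc i" n j] assms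
  by (simp add: mult.commute)

text \<open>For rows above \<open>k + l\<close> the column is \<open>W i \<bullet> S j\<close>. A
  formal column \<open>c < p\<close> has total 0, so its \<open>tail\<close> is minus the product of
  \<open>U\<close> with the passed rows of \<open>W\<close>: the numbers required here are kept as
  part of its state.\<close>

lemma far_coord_total:
  assumes "j < n" "k + (l + m) \<le> j"
  shows "total j a =
    (\<Sum>i\<in>{k + l..<n}. U i a * A i j) - (\<Sum>c<p. tail (feature_col c) (feature_total c) k a * S j c)"
proof -
  have "total j a = (\<Sum>i<k + l. U i a * A i j) + (\<Sum>i\<in>{k + l..<n}. U i a * A i j)"
    unfolding total_def by (rule sum_prefix_split) (simp add: A_zero)
  moreover have "(\<Sum>i<k + l. U i a * A i j) = (\<Sum>i<k + l. \<Sum>c<p. U i a * W i c * S j c)"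
    using assms by (intro sum.cong refl) (simp add: A_upper sum_distrib_left ac_simps)
  moreover have "\<dots> = (\<Sum>c<p. (\<Sum>i<k + l. U i a * W i c) * S j c)"
    by (subst sum.swap) (simp add: sum_distrib_right)
  moreover have "\<dots> = - (\<Sum>c<p. tail (feature_col c) (feature_total c) k a * S j c)"
    by (simp add: tail_def feature_total_def feature_col_def sum_negf)
  ultimately show ?thesis by simp
qed

text \<open>After \<open>l + m + 1\<close> rows the row index exceeds \<open>j + l\<close>, so the
  rest of the column is \<open>U i \<bullet> V j\<close> and reduces to a Gram matrix.\<close>

lemma column_tail:
  assumes "j < n" "j \<le> k + (l + m)"
  shows "(\<Sum>i\<in>{k + l..<n}. U i a * A i j) =
    (\<Sum>e<Suc (l + m). U (k + l + e) a * A (k + l + e) j) +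
    (\<Sum>b<r. gram (Suc (k + l + (l + m))) a b * V j b)"
proof -
  let ?z = "\<lambda>i. if i < k + l then 0 else U i a * A i j"
  have "(\<Sum>i\<in>{k + l..<n}. U i a * A i j) = (\<Sum>i<n. ?z i)"
    by (rule sum.mono_neutral_cong_left) auto
  also have "\<dots> = (\<Sum>e<Suc (l + m). ?z (k + l + e)) + (\<Sum>i\<in>{Suc (k + l + (l + m))..<n}. ?z i)"
    by (rule sum_window_split) (auto simp: A_zero)
  also have "(\<Sum>i\<in>{Suc (k + l + (l + m))..<n}. ?z i) =
      (\<Sum>i\<in>{Suc (k + l + (l + m))..<n}. \<Sum>b<r. U i a * U i b * V j b)"
    using assms by (intro sum.cong refl) (simp add: A_lower sum_distrib_left ac_simps)
  also have "\<dots> = (\<Sum>b<r. gram (Suc (k + l + (l + m))) a b * V j b)"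
    by (subst sum.swap) (simp add: gram_def sum_distrib_right)
  finally show ?thesis by simp
qed

end


section \<open>Products of Householder reflections\<close>

lemma householder_carrier: "y \<in> carrier_vec n \<Longrightarrow> householder y \<in> carrier_mat n n"
  by (intro carrier_matI) (simp_all add: householder_def)

lemma transpose_householder: "transpose_mat (householder y) = householder y"
proof (rule eq_matI)
  fix i j assume "i < dim_row (householder y)" "j < dim_col (householder y)"
  then show "transpose_mat (householder y) $$ (i, j) = householder y $$ (i, j)"
    by (simp add: householder_def)
qed (simp_all add: householder_def)

lemma householder_mult_vec:
  assumes "y \<in> carrier_vec n" "x \<in> carrier_vec n"
  shows "householder y *\<^sub>v x = vec n (\<lambda>i. x $ i - 2 / (y \<bullet> y) * y $ i * (y \<bullet> x))"
proof (rule eq_vecI)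
  fix i assume "i < dim_vec (vec n (\<lambda>i. x $ i - 2 / (y \<bullet> y) * y $ i * (y \<bullet> x)))"
  then have i: "i < n" by simp
  have "(householder y *\<^sub>v x) $ i =
      (\<Sum>j = 0..<n. ((if i = j then 1 else 0) - 2 / (y \<bullet> y) * (y $ i * y $ j)) * x $ j)"
    using i assms by (simp add: householder_def scalar_prod_def)
  also have "\<dots> = (\<Sum>j = 0..<n. if j = i then x $ j else 0) -
      (\<Sum>j = 0..<n. 2 / (y \<bullet> y) * y $ i * (y $ j * x $ j))"
    by (subst sum_subtractf[symmetric]) (rule sum.cong, auto simp: algebra_simps)
  also have "\<dots> = x $ i - 2 / (y \<bullet> y) * y $ i * (y \<bullet> x)"
    unfolding sum_distrib_left[symmetric] using i assms by (simp add: scalar_prod_def[of _ x])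
  finally show "(householder y *\<^sub>v x) $ i =
      vec n (\<lambda>i. x $ i - 2 / (y \<bullet> y) * y $ i * (y \<bullet> x)) $ i"
    using i by simp
qed (use assms in \<open>auto simp: householder_def\<close>)

lemma real_scalar_prod_self_nonzero:
  fixes y :: "real vec"
  assumes "y \<in> carrier_vec n" "y \<noteq> 0\<^sub>v n"
  shows "y \<bullet> y \<noteq> 0"
proof
  assume "y \<bullet> y = 0"
  then have "(\<Sum>i\<in>{0..<n}. y $ i * y $ i) = 0" using assms(1) by (simp add: scalar_prod_def)
  then have "\<forall>i\<in>{0..<n}. y $ i * y $ i = 0"
    by (subst (asm) sum_nonneg_eq_0_iff) auto
  then have "y = 0\<^sub>v n" using assms(1) by (intro eq_vecI) auto
  then show False using assms(2) by simp
qed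

lemma householder_involution:
  assumes "y \<in> carrier_vec n" "y \<noteq> 0\<^sub>v n" "x \<in> carrier_vec n"
  shows "householder y *\<^sub>v (householder y *\<^sub>v x) = x"
proof -
  let ?x = "householder y *\<^sub>v x"
  have x: "?x = vec n (\<lambda>i. x $ i - 2 / (y \<bullet> y) * y $ i * (y \<bullet> x))"
    using assms by (simp add: householder_mult_vec)
  have "y \<bullet> y \<noteq> 0"
    using assms by (intro real_scalar_prod_self_nonzero)
  moreover have "y \<bullet> ?x = y \<bullet> x - 2 / (y \<bullet> y) * (y \<bullet> x) * (y \<bullet> y)"
  proof -
    have "y \<bullet> ?x = (\<Sum>i = 0..<n. y $ i * x $ i - 2 / (y \<bullet> y) * (y \<bullet> x) * (y $ i * y $ i))"
      using assms unfolding x by (simp add: scalar_prod_def[of _ "vec _ _"] algebra_simps)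
    also have "\<dots> = y \<bullet> x - 2 / (y \<bullet> y) * (y \<bullet> x) * (y \<bullet> y)"
      unfolding sum_subtractf sum_distrib_left[symmetric]
      using assms by (simp add: scalar_prod_def)
    finally show ?thesis .
  qed
  ultimately have "y \<bullet> ?x = - (y \<bullet> x)" by simp
  moreover have "?x \<in> carrier_vec n" unfolding x by simp
  ultimately have "householder y *\<^sub>v ?x = vec n (\<lambda>i. ?x $ i + 2 / (y \<bullet> y) * y $ i * (y \<bullet> x))"
    using assms by (simp add: householder_mult_vec)
  also have "\<dots> = x"
    using assms by (intro eq_vecI) (auto simp: x)
  finally show ?thesis .
qed

lemma householder_square:
  assumes "y \<in> carrier_vec n" "y \<noteq> 0\<^sub>v n"
  shows "householder y * householder y = 1\<^sub>m n"
proof (rule eq_matI)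
  have H: "householder y \<in> carrier_mat n n" using assms householder_carrier by blast
  fix i j assume "i < dim_row (1\<^sub>m n :: real mat)" "j < dim_col (1\<^sub>m n :: real mat)"
  then have ij: "i < n" "j < n" by auto
  have "householder y *\<^sub>v unit_vec n j = col (householder y) j"
    using H ij by (intro eq_vecI) auto
  then have "(householder y * householder y) $$ (i, j) = (householder y *\<^sub>v (householder y *\<^sub>v unit_vec n j)) $ i"
    using H ij by simp
  also have "\<dots> = unit_vec n j $ i" using assms by (simp add: householder_involution)
  finally show "(householder y * householder y) $$ (i, j) = 1\<^sub>m n $$ (i, j)"
    using ij by simp
qed (use assms in \<open>auto simp: householder_def\<close>)

definition reflection_prod :: "real mat \<Rightarrow> nat list \<Rightarrow> real mat" where
  "reflection_prod Y ks = foldr (\<lambda>k Q. householder (col Y k) * Q) ks (1\<^sub>m (dim_row Y))"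

lemma reflection_prod_carrier: "Y \<in> carrier_mat n n \<Longrightarrow> reflection_prod Y ks \<in> carrier_mat n n"
  by (induction ks) (auto simp: reflection_prod_def householder_def)

lemma householder_prod_carrier: "Y \<in> carrier_mat n n \<Longrightarrow> householder_prod Y \<in> carrier_mat n n"
  using reflection_prod_carrier[of Y n "[0..<n]"]
  by (simp add: householder_prod_def reflection_prod_def)

lemma reflection_prod_orthogonal:
  assumes "Y \<in> carrier_mat n n" "\<And>k. k \<in> set ks \<Longrightarrow> col Y k \<noteq> 0\<^sub>v n"
  shows "reflection_prod Y ks * transpose_mat (reflection_prod Y ks) = 1\<^sub>m n"
  using assms(2)
proof (induction ks)
  case Nil
  then show ?case using assms(1) by (simp add: reflection_prod_def)
next
  case (Cons k ks)
  let ?H = "householder (col Y k)" and ?Q = "reflection_prod Y ks"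
  have H: "?H \<in> carrier_mat n n" using assms(1) by (intro householder_carrier) auto
  have Q: "?Q \<in> carrier_mat n n" using assms(1) by (rule reflection_prod_carrier)
  have "(?H * ?Q) * transpose_mat (?H * ?Q) = ?H * ?Q * (transpose_mat ?Q * ?H)"
    using H Q by (simp add: transpose_mult[OF H Q] transpose_householder)
  also have "\<dots> = ?H * (?Q * transpose_mat ?Q) * ?H"
    using H Q by (simp add: assoc_mult_mat[of _ n n _ n _ n])
  also have "\<dots> = 1\<^sub>m n"
    using H Q Cons assms(1) by (simp add: householder_square[where n = n] carrier_vecI)
  finally show ?case by (simp add: reflection_prod_def)
qed

lemma householder_prod_orthogonal:
  assumes "Y \<in> carrier_mat n n" "\<And>k. k < n \<Longrightarrow> col Y k \<noteq> 0\<^sub>v n"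
  shows "householder_prod Y * transpose_mat (householder_prod Y) = 1\<^sub>m n"
    and "transpose_mat (householder_prod Y) * householder_prod Y = 1\<^sub>m n"
proof -
  show *: "householder_prod Y * transpose_mat (householder_prod Y) = 1\<^sub>m n"
    using reflection_prod_orthogonal[of Y n "[0..<n]"] assms
    by (auto simp: householder_prod_def reflection_prod_def)
  show "transpose_mat (householder_prod Y) * householder_prod Y = 1\<^sub>m n"
    by (rule mat_mult_left_right_inverse[OF _ _ *])
      (use householder_prod_carrier[OF assms(1)] in auto)
qed

text \<open>Each reflection is its own inverse, so undoing the steps from the last to the first
  gives the product in the order of \<open>householder_prod\<close>; orthogonality then gives the
  transposed form. The first form yields the factorization column by column, the second the
  transformed right-hand side.\<close>

lemma successive_reflections:
  assumes Y: "Y \<in> carrier_mat n n" "\<And>k. k < n \<Longrightarrow> col Y k \<noteq> 0\<^sub>v n"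
    and z: "\<And>k i. k < n \<Longrightarrow> i < n \<Longrightarrow> z (Suc k) i = z k i -
      2 / (\<Sum>t<n. (Y $$ (t, k))\<^sup>2) * Y $$ (i, k) * (\<Sum>t<n. Y $$ (t, k) * z k t)"
  shows "householder_prod Y *\<^sub>v vec n (z n) = vec n (z 0)"
    and "transpose_mat (householder_prod Y) *\<^sub>v vec n (z 0) = vec n (z n)"
proof -
  let ?H = "\<lambda>k. householder (col Y k)"
  have H: "?H k \<in> carrier_mat n n" for k using Y(1) by (intro householder_carrier) auto
  have c: "col Y k \<in> carrier_vec n" for k using Y(1) by auto
  have step: "?H k *\<^sub>v vec n (z k) = vec n (z (Suc k))" if k: "k < n" for k
    using k Y(1) by (auto simp: householder_mult_vec[OF c] z scalar_prod_def power2_eq_square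
        atLeast0LessThan intro!: eq_vecI)
  have undo: "?H k *\<^sub>v vec n (z (Suc k)) = vec n (z k)" if k: "k < n" for k
    unfolding step[OF k, symmetric] using householder_involution[OF c] Y(2) k by simp
  have "reflection_prod Y [k..<n] *\<^sub>v vec n (z n) = vec n (z k)" if "k \<le> n" for k
    using that
  proof (induction rule: inc_induct)
    case base
    then show ?case using Y(1) by (simp add: reflection_prod_def)
  next
    case (step k)
    have "reflection_prod Y [k..<n] = ?H k * reflection_prod Y [Suc k..<n]"
      using step(2) by (simp add: reflection_prod_def upt_conv_Cons)
    then show ?case
      using step H reflection_prod_carrier[OF Y(1)] by (simp add: assoc_mult_mat_vec[of _ n n _ n] undo)
  qed
  then show 1: "householder_prod Y *\<^sub>v vec n (z n) = vec n (z 0)"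
    using Y(1) by (simp add: reflection_prod_def householder_prod_def)
  have Q: "householder_prod Y \<in> carrier_mat n n" using Y(1) by (rule householder_prod_carrier)
  show "transpose_mat (householder_prod Y) *\<^sub>v vec n (z 0) = vec n (z n)"
    unfolding 1[symmetric] using Q householder_prod_orthogonal(2)[OF Y]
    by (subst assoc_mult_mat_vec[symmetric, of _ n n _ n]) auto
qed

section \<open>From stored generators to the solved system\<close>

lemma stores_bps_iff:
  "stores_bps \<mu> X n r p l m A \<longleftrightarrow> A = mat n n (\<lambda>(i, j).
     (if i \<le> j + l \<and> j \<le> i + m then \<mu> (X @ ''.B'') i j else 0) +
     (if j < i then \<Sum>a<r. \<mu> (X @ ''.U'') i a * \<mu> (X @ ''.V'') j a else 0) +
     (if i < j then \<Sum>a<p. \<mu> (X @ ''.W'') i a * \<mu> (X @ ''.S'') j a else 0))"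
  unfolding stores_bps_def
  by (rule arg_cong[where f = "\<lambda>M. A = M"], rule eq_matI)
    (auto simp: bps_mat_def band_at_def mat_at_def tril_strict_def triu_strict_def
      scalar_prod_def atLeast0LessThan)

lemma invertible_matE:
  fixes A :: "real mat"
  assumes "invertible_mat A" "A \<in> carrier_mat n n"
  obtains B where "B \<in> carrier_mat n n" "A * B = 1\<^sub>m n" "B * A = 1\<^sub>m n"
proof -
  obtain B where B: "A * B = 1\<^sub>m n" "B * A = 1\<^sub>m (dim_row B)"
    using assms by (auto simp: invertible_mat_def inverts_mat_def)
  have "dim_col B = n" using arg_cong[OF B(1), of dim_col] by simp
  moreover have "dim_row B = n" using arg_cong[OF B(2), of dim_col] assms(2) by simp
  ultimately show ?thesis using that B by auto
qed

lemma upper_triangular_invertible_diag: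
  fixes R :: "real mat"
  assumes "R \<in> carrier_mat n n" "upper_triangular R" "invertible_mat R" "i < n"
  shows "R $$ (i, i) \<noteq> 0"
proof -
  obtain B where "B \<in> carrier_mat n n" "R * B = 1\<^sub>m n"
    using invertible_matE[OF assms(3,1)] by blast
  then have "det R * det B = 1"
    using det_mult[OF assms(1), of B] by simp
  then have "det R \<noteq> 0" by auto
  then have "0 \<notin> set (diag_mat R)"
    using det_upper_triangular[OF assms(2,1)] by (simp add: prod_list_zero_iff)
  then show ?thesis using assms(1,4) by (auto simp: diag_mat_def)
qed

text \<open>Back substitution requires \<open>R\<close> to be invertible; this is inherited from
  \<open>A\<close>, since an inverse \<open>B\<close> of \<open>A\<close> makes
  \<open>B * ?Q\<close> an inverse of \<open>R\<close>. Orthogonality of \<open>?Q\<close> then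
  combines the three stages.\<close>

lemma qr_based_approach_solves:
  assumes F: "qr_factorizes F" and T: "applies_reflections T" and S: "solves_triangular S"
    and A: "stores_bps \<mu> ''A'' n r p l m A" "invertible_mat A"
  shows "A *\<^sub>v vec_at (run (F ;; T ;; S) (size_env n r p l m) \<mu>) ''x'' n = vec_at \<mu> ''b'' n"
proof -
  let ?\<eta> = "size_env n r p l m"
  define \<mu>1 \<mu>2 \<mu>3 where "\<mu>1 = run F ?\<eta> \<mu>" and "\<mu>2 = run T ?\<eta> \<mu>1" and "\<mu>3 = run S ?\<eta> \<mu>2"
  let ?b = "vec_at \<mu> ''b'' n" and ?x = "vec_at \<mu>3 ''x'' n"
  obtain Y R where b: "vec_at \<mu>1 ''b'' n = ?b" and Y: "stores_bps \<mu>1 ''Y'' n r 0 l 0 Y"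
    "\<forall>k<n. col Y k \<noteq> 0\<^sub>v n" and R: "stores_bps \<mu>1 ''R'' n 0 (p + r) 0 (l + m) R"
    "upper_triangular R" and QR: "A = householder_prod Y * R"
    using F A(1) unfolding qr_factorizes_def Let_def \<mu>1_def by blast
  let ?Q = "householder_prod Y"
  have "vec_at \<mu>2 ''c'' n = transpose_mat ?Q *\<^sub>v vec_at \<mu>1 ''b'' n \<and>
    (\<forall>R. stores_bps \<mu>1 ''R'' n 0 (p + r) 0 (l + m) R \<longrightarrow>
      stores_bps \<mu>2 ''R'' n 0 (p + r) 0 (l + m) R)"
    using T[unfolded applies_reflections_def Let_def, THEN spec[of _ n], THEN spec[of _ r],
        THEN spec[of _ p], THEN spec[of _ l], THEN spec[of _ m], THEN spec[of _ Y],
        THEN spec[of _ \<mu>1], folded \<mu>2_def] Y by (rule mp[OF _ conjI])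
  then have c: "vec_at \<mu>2 ''c'' n = transpose_mat ?Q *\<^sub>v ?b"
    and R2: "stores_bps \<mu>2 ''R'' n 0 (p + r) 0 (l + m) R"
    using R(1) b by simp_all
  have YR: "Y \<in> carrier_mat n n" "R \<in> carrier_mat n n" "A \<in> carrier_mat n n"
    using Y(1) R(1) A(1) by (simp_all add: stores_bps_iff)
  have Q: "?Q \<in> carrier_mat n n" using YR(1) by (rule householder_prod_carrier)
  have QQ: "?Q * transpose_mat ?Q = 1\<^sub>m n" "transpose_mat ?Q * ?Q = 1\<^sub>m n"
    using householder_prod_orthogonal[OF YR(1)] Y(2) by auto
  obtain B where B: "B \<in> carrier_mat n n" "A * B = 1\<^sub>m n" "B * A = 1\<^sub>m n"
    using invertible_matE[OF A(2) YR(3)] by blast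
  have "invertible_mat R"
  proof -
    have 1: "(B * ?Q) * R = 1\<^sub>m n"
      using B(3) assoc_mult_mat[OF B(1) Q YR(2)] by (simp add: QR)
    moreover have "R * (B * ?Q) = 1\<^sub>m n"
      by (rule mat_mult_left_right_inverse[OF _ _ 1]) (use B Q YR in auto)
    ultimately show ?thesis
      using B(1) Q YR unfolding invertible_mat_def inverts_mat_def
      by (intro conjI exI[of _ "B * ?Q"]) auto
  qed
  then have "R *\<^sub>v ?x = transpose_mat ?Q *\<^sub>v ?b"
    using S[unfolded solves_triangular_def Let_def, THEN spec[of _ n], THEN spec[of _ r],
        THEN spec[of _ p], THEN spec[of _ l], THEN spec[of _ m], THEN spec[of _ R],
        THEN spec[of _ \<mu>2], folded \<mu>3_def] R2 R(2) c by simp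
  then have "A *\<^sub>v ?x = ?Q *\<^sub>v (transpose_mat ?Q *\<^sub>v ?b)"
    using Q YR by (simp add: QR assoc_mult_mat_vec[of _ n n _ n] vec_at_def)
  also have "\<dots> = ?b"
    using Q QQ by (subst assoc_mult_mat_vec[symmetric, of _ n n _ n]) (auto simp: vec_at_def)
  finally show ?thesis by (simp add: \<mu>1_def \<mu>2_def \<mu>3_def)
qed


section \<open>Applying the reflections\<close>

text \<open>
  Array \<open>u\<close> holds \<open>U\<close> with zero rows appended, so that windows may overlap the last row. Column \<open>c\<close>
  of the arrays \<open>d\<close>, \<open>X\<close>, \<open>P\<close>, \<open>T\<close> holds the data, the current rows, \<open>acc\<close> and \<open>tail\<close> of the
  column in slot \<open>c\<close>; \<open>G\<close> holds \<open>gram\<close>, and \<open>y\<close>, \<open>h\<close>, \<open>s\<close> the window of the current reflection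
  vector, the product of \<open>G\<close> with its \<open>v\<close>, and its squared norm.
\<close>

abbreviation (input) "kl \<equiv> IAdd (IVar ''k'') (IVar ''l'')"
abbreviation (input) "ke \<equiv> IAdd (IVar ''k'') (IVar ''e'')"

definition pad_copy :: "string \<Rightarrow> string \<Rightarrow> iexp \<Rightarrow> iexp \<Rightarrow> prog" where
  "pad_copy X Z N N' =
     For ''i'' N (For ''a'' N' (IfLess (IVar ''i'') (IVar ''n'')
       (Assign X (IVar ''i'') (IVar ''a'') (RCell Z (IVar ''i'') (IVar ''a'')))
       (Assign X (IVar ''i'') (IVar ''a'') (RNum 0))))"

lemma run_pad_copy:
  assumes "Z \<noteq> X" "\<And>t. ival N' (\<eta>(''i'' := t)) = ival N' \<eta>"
  shows "run (pad_copy X Z N N') \<eta> \<mu> = upd_region X (\<lambda>i j. i < ival N \<eta> \<and> j < ival N' \<eta>)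
    (\<lambda>i j. if i < \<eta> ''n'' then \<mu> Z i j else 0) \<mu>"
  unfolding pad_copy_def
  by (rule run_For_For_cells[where a = "\<lambda>s t. s" and b = "\<lambda>s t. t" and M = "ival N' \<eta>"])
    (use assms(1) in \<open>simp_all add: assms(2)\<close>)

definition gram_init :: "string \<Rightarrow> iexp \<Rightarrow> prog" where
  "gram_init X s =
     For ''a'' (IVar ''r'') (For ''b'' (IVar ''r'')
       (sum_into X (IVar ''a'') (IVar ''b'') ''t'' (IVar ''n'') (RNum 0)
         (RMul (RCell ''u'' (IAdd (IVar ''t'') s) (IVar ''a''))
           (RCell ''u'' (IAdd (IVar ''t'') s) (IVar ''b'')))))"

lemma run_gram_init:
  assumes "X \<noteq> ''u''"
    "\<And>t t' t''. ival s (\<eta>(''a'' := t, ''b'' := t', ''t'' := t'')) = ival s \<eta>"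
  shows "run (gram_init X s) \<eta> \<mu> = upd_region X (\<lambda>i j. i < \<eta> ''r'' \<and> j < \<eta> ''r'')
    (\<lambda>a b. \<Sum>t<\<eta> ''n''. \<mu> ''u'' (t + ival s \<eta>) a * \<mu> ''u'' (t + ival s \<eta>) b) \<mu>"
  unfolding gram_init_def
  by (rule run_For_For_cells[where a = "\<lambda>s t. s" and b = "\<lambda>s t. t" and M = "\<eta> ''r''"])
    (use assms(1) in \<open>simp_all add: run_sum_into assms(2) upd_cell_apply\<close>)

definition gram_down :: "string \<Rightarrow> iexp \<Rightarrow> prog" where
  "gram_down X s =
     For ''a'' (IVar ''r'') (For ''b'' (IVar ''r'')
       (Assign X (IVar ''a'') (IVar ''b'') (RSub (RCell X (IVar ''a'') (IVar ''b''))
         (RMul (RCell ''u'' s (IVar ''a'')) (RCell ''u'' s (IVar ''b''))))))"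

text \<open>The array is updated in place, so each cell is read before it is written; hence the
  treatment by disjoint regions.\<close>

lemma run_gram_down:
  assumes "X \<noteq> ''u''" "\<And>t t'. ival s (\<eta>(''a'' := t, ''b'' := t')) = ival s \<eta>"
  shows "run (gram_down X s) \<eta> \<mu> = upd_region X (\<lambda>i j. i < \<eta> ''r'' \<and> j < \<eta> ''r'')
    (\<lambda>a b. \<mu> X a b - \<mu> ''u'' (ival s \<eta>) a * \<mu> ''u'' (ival s \<eta>) b) \<mu>"
proof -
  let ?f = "\<lambda>a b. \<mu> X a b - \<mu> ''u'' (ival s \<eta>) a * \<mu> ''u'' (ival s \<eta>) b"
  let ?S = "Assign X (IVar ''a'') (IVar ''b'') (RSub (RCell X (IVar ''a'') (IVar ''b''))
         (RMul (RCell ''u'' s (IVar ''a'')) (RCell ''u'' s (IVar ''b''))))"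
  have 1: "run (For ''b'' (IVar ''r'') ?S) (\<eta>(''a'' := t)) \<nu> =
     upd_region X (\<lambda>i j. i = t \<and> j < \<eta> ''r'') ?f \<nu>"
    if "\<And>Y. Y \<noteq> X \<Longrightarrow> \<nu> Y = \<mu> Y" "\<And>j. j < \<eta> ''r'' \<Longrightarrow> \<nu> X t j = \<mu> X t j" for t \<nu>
    by (rule run_For_region[where D = "\<lambda>s i j. i = t \<and> j = s"])
      (use assms(1) in \<open>auto simp: assms(2-) that upd_cell_apply
        intro!: upd_cell_eq_upd_region\<close>)
  show ?thesis
    unfolding gram_down_def
    by (rule run_For_region[where D = "\<lambda>s i j. i = s \<and> j < \<eta> ''r''"])
      (simp_all add: 1 del: run.simps)
qed

text \<open>Row \<open>k + l\<close> joins the window: \<open>entry_tail\<close> gives its current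
  value from the data and \<open>acc\<close>, and its contribution leaves
  \<open>tail\<close>.\<close>

definition enter_row :: "iexp \<Rightarrow> prog" where
  "enter_row s =
     sum_into ''X'' kl s ''a'' (IVar ''r'') (RCell ''d'' kl s)
       (RSub (RNum 0) (RMul (RCell ''u'' kl (IVar ''a'')) (RCell ''P'' (IVar ''a'') s))) ;;
     For ''a'' (IVar ''r'') (Assign ''T'' (IVar ''a'') s (RSub (RCell ''T'' (IVar ''a'') s)
       (RMul (RCell ''u'' kl (IVar ''a'')) (RCell ''d'' kl s))))"

lemma run_enter_row:
  assumes "\<And>t. ival s (\<eta>(''a'' := t)) = ival s \<eta>"
  shows "run (enter_row s) \<eta> \<mu> =
    upd_region ''T'' (\<lambda>i j. i < \<eta> ''r'' \<and> j = ival s \<eta>)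
      (\<lambda>i j. \<mu> ''T'' i j - \<mu> ''u'' (\<eta> ''k'' + \<eta> ''l'') i * \<mu> ''d'' (\<eta> ''k'' + \<eta> ''l'') j)
      (upd_cell ''X'' (\<eta> ''k'' + \<eta> ''l'') (ival s \<eta>)
        (\<mu> ''d'' (\<eta> ''k'' + \<eta> ''l'') (ival s \<eta>) -
          (\<Sum>a<\<eta> ''r''. \<mu> ''u'' (\<eta> ''k'' + \<eta> ''l'') a * \<mu> ''P'' a (ival s \<eta>))) \<mu>)"
proof -
  let ?f = "\<lambda>i j. \<mu> ''T'' i j - \<mu> ''u'' (\<eta> ''k'' + \<eta> ''l'') i * \<mu> ''d'' (\<eta> ''k'' + \<eta> ''l'') j"
  have 1: "run (For ''a'' (IVar ''r'') (Assign ''T'' (IVar ''a'') s (RSub (RCell ''T'' (IVar ''a'') s)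
       (RMul (RCell ''u'' kl (IVar ''a'')) (RCell ''d'' kl s))))) \<eta> (upd_cell ''X'' i j z \<mu>) =
     upd_region ''T'' (\<lambda>i j. i < \<eta> ''r'' \<and> j = ival s \<eta>) ?f (upd_cell ''X'' i j z \<mu>)" for i j z
    by (rule run_For_region[where D = "\<lambda>t i j. i = t \<and> j = ival s \<eta>"])
      (auto simp: assms upd_cell_apply intro!: upd_cell_eq_upd_region)
  show ?thesis
    by (simp add: enter_row_def run_sum_into assms upd_cell_apply sum_negf 1 del: run.simps(6))
qed

definition load_h :: prog where
  "load_h = For ''a'' (IVar ''r'') (sum_into ''h'' (IVar ''a'') (INum 0) ''b'' (IVar ''r'') (RNum 0)
     (RMul (RCell ''G'' (IVar ''a'') (IVar ''b'')) (RCell ''Y.V'' (IVar ''k'') (IVar ''b''))))"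

lemma run_load_h:
  "run load_h \<eta> \<mu> = upd_region ''h'' (\<lambda>i j. i < \<eta> ''r'' \<and> j = 0)
    (\<lambda>i j. \<Sum>b<\<eta> ''r''. \<mu> ''G'' i b * \<mu> ''Y.V'' (\<eta> ''k'') b) \<mu>"
  unfolding load_h_def
  by (rule run_For_region[where D = "\<lambda>t i j. i = t \<and> j = 0"])
    (auto simp: run_sum_into upd_cell_apply intro!: upd_cell_eq_upd_region)

definition norm_sq :: prog where
  "norm_sq =
     sum_into ''s'' (INum 0) (INum 0) ''e'' (IAdd (IVar ''l'') (INum 1)) (RNum 0)
       (RMul (RCell ''y'' (IVar ''e'') (INum 0)) (RCell ''y'' (IVar ''e'') (INum 0))) ;;
     sum_into ''s'' (INum 0) (INum 0) ''a'' (IVar ''r'') (RCell ''s'' (INum 0) (INum 0))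
       (RMul (RCell ''h'' (IVar ''a'') (INum 0)) (RCell ''Y.V'' (IVar ''k'') (IVar ''a'')))"

lemma run_norm_sq:
  "run norm_sq \<eta> \<mu> = upd_cell ''s'' 0 0 ((\<Sum>e<Suc (\<eta> ''l''). (\<mu> ''y'' e 0)\<^sup>2) +
     (\<Sum>a<\<eta> ''r''. \<mu> ''h'' a 0 * \<mu> ''Y.V'' (\<eta> ''k'') a)) \<mu>"
  by (simp add: norm_sq_def run_sum_into upd_cell_apply power2_eq_square del: sum.lessThan_Suc)
    (simp add: upd_cell_def)

text \<open>Leaves \<open>beta k\<close> times the weight in \<open>w\<close>. The Gram matrix
  enters through \<open>h\<close>, which is computed once per step and shared by all slots.\<close>

definition scaled_weight :: "iexp \<Rightarrow> prog" where
  "scaled_weight s =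
     sum_into ''w'' (INum 0) (INum 0) ''e'' (IAdd (IVar ''l'') (INum 1)) (RNum 0)
       (RMul (RCell ''y'' (IVar ''e'') (INum 0)) (RCell ''X'' ke s)) ;;
     sum_into ''w'' (INum 0) (INum 0) ''a'' (IVar ''r'') (RCell ''w'' (INum 0) (INum 0))
       (RSub (RMul (RCell ''Y.V'' (IVar ''k'') (IVar ''a'')) (RCell ''T'' (IVar ''a'') s))
         (RMul (RCell ''h'' (IVar ''a'') (INum 0)) (RCell ''P'' (IVar ''a'') s))) ;;
     Assign ''w'' (INum 0) (INum 0)
       (RMul (RDiv (RNum 2) (RCell ''s'' (INum 0) (INum 0))) (RCell ''w'' (INum 0) (INum 0)))"

definition reflect :: "iexp \<Rightarrow> prog" where
  "reflect s =
     scaled_weight s ;;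
     For ''e'' (IAdd (IVar ''l'') (INum 1)) (Assign ''X'' ke s
       (RSub (RCell ''X'' ke s)
         (RMul (RCell ''y'' (IVar ''e'') (INum 0)) (RCell ''w'' (INum 0) (INum 0))))) ;;
     For ''a'' (IVar ''r'') (Assign ''P'' (IVar ''a'') s (RAdd (RCell ''P'' (IVar ''a'') s)
       (RMul (RCell ''Y.V'' (IVar ''k'') (IVar ''a'')) (RCell ''w'' (INum 0) (INum 0)))))"

lemma run_reflect:
  fixes \<eta> :: env and \<mu> :: memory and s :: iexp
  assumes "\<And>t. ival s (\<eta>(''a'' := t)) = ival s \<eta>" "\<And>t. ival s (\<eta>(''e'' := t)) = ival s \<eta>"
  defines "w \<equiv> 2 / \<mu> ''s'' 0 0 *
    ((\<Sum>e<Suc (\<eta> ''l''). \<mu> ''y'' e 0 * \<mu> ''X'' (\<eta> ''k'' + e) (ival s \<eta>)) +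
     (\<Sum>a<\<eta> ''r''. \<mu> ''Y.V'' (\<eta> ''k'') a * \<mu> ''T'' a (ival s \<eta>) - \<mu> ''h'' a 0 * \<mu> ''P'' a (ival s \<eta>)))"
  shows "run (reflect s) \<eta> \<mu> =
    upd_region ''P'' (\<lambda>i j. i < \<eta> ''r'' \<and> j = ival s \<eta>) (\<lambda>i j. \<mu> ''P'' i j + \<mu> ''Y.V'' (\<eta> ''k'') i * w)
     (upd_region ''X'' (\<lambda>i j. \<eta> ''k'' \<le> i \<and> i \<le> \<eta> ''k'' + \<eta> ''l'' \<and> j = ival s \<eta>)
       (\<lambda>i j. \<mu> ''X'' i j - \<mu> ''y'' (i - \<eta> ''k'') 0 * w) (upd_cell ''w'' 0 0 w \<mu>))"
proof -
  let ?\<mu>1 = "upd_cell ''w'' 0 0 w \<mu>"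
  let ?\<mu>2 = "upd_region ''X'' (\<lambda>i j. \<eta> ''k'' \<le> i \<and> i \<le> \<eta> ''k'' + \<eta> ''l'' \<and> j = ival s \<eta>)
       (\<lambda>i j. \<mu> ''X'' i j - \<mu> ''y'' (i - \<eta> ''k'') 0 * w) ?\<mu>1"
  have ex: "(\<exists>t<Suc (\<eta> ''l''). i = \<eta> ''k'' + t \<and> j = ival s \<eta>) \<longleftrightarrow>
      \<eta> ''k'' \<le> i \<and> i \<le> \<eta> ''k'' + \<eta> ''l'' \<and> j = ival s \<eta>" for i j
    by (auto intro!: exI[of _ "i - \<eta> ''k''"])
  have 1: "run (For ''e'' (IAdd (IVar ''l'') (INum 1)) (Assign ''X'' ke s
       (RSub (RCell ''X'' ke s)
         (RMul (RCell ''y'' (IVar ''e'') (INum 0)) (RCell ''w'' (INum 0) (INum 0)))))) \<eta> ?\<mu>1 = ?\<mu>2"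
    by (rule run_For_region[where D = "\<lambda>t i j. i = \<eta> ''k'' + t \<and> j = ival s \<eta>"])
      (auto simp: assms(1,2) upd_cell_apply ex intro!: upd_cell_eq_upd_region)
  have 2: "run (For ''a'' (IVar ''r'') (Assign ''P'' (IVar ''a'') s (RAdd (RCell ''P'' (IVar ''a'') s)
       (RMul (RCell ''Y.V'' (IVar ''k'') (IVar ''a'')) (RCell ''w'' (INum 0) (INum 0)))))) \<eta> ?\<mu>2 =
     upd_region ''P'' (\<lambda>i j. i < \<eta> ''r'' \<and> j = ival s \<eta>) (\<lambda>i j. \<mu> ''P'' i j + \<mu> ''Y.V'' (\<eta> ''k'') i * w) ?\<mu>2"
    by (rule run_For_region[where D = "\<lambda>t i j. i = t \<and> j = ival s \<eta>"])
      (auto simp: assms(1,2) upd_cell_apply upd_region_apply intro!: upd_cell_eq_upd_region)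
  have 4: "run (scaled_weight s) \<eta> \<mu> = ?\<mu>1"
    by (simp add: scaled_weight_def run_sum_into assms(1,2) upd_cell_apply upd_cell_overwrite w_def del: sum.lessThan_Suc)
  show ?thesis
    by (simp only: reflect_def run.simps(3) 4 1 2)
qed

section \<open>The state of one column in memory\<close>

context reflections
begin

text \<open>\<open>lo\<close> is the first row kept in the slot: 0 for the right-hand side and the
  formal columns, whose finished rows are output, and \<open>j - (l + m)\<close> for column
  \<open>j\<close>, whose slot is filled from that row on.\<close>

definition stored :: "memory \<Rightarrow> nat \<Rightarrow> nat \<Rightarrow> nat \<Rightarrow> (nat \<Rightarrow> real) \<Rightarrow> (nat \<Rightarrow> real) \<Rightarrow> bool" where
  "stored \<mu> c lo k d \<tau> \<longleftrightarrow>
     (\<forall>i. lo \<le> i \<and> i < k + l \<longrightarrow> \<mu> ''X'' i c = entry d \<tau> k i) \<and>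
     (\<forall>a<r. \<mu> ''P'' a c = acc d \<tau> k a) \<and> (\<forall>a<r. \<mu> ''T'' a c = tail d \<tau> k a)"

text \<open>The situation between \<open>enter_row\<close> and \<open>reflect\<close>: row
  \<open>k + l\<close> is in the window and \<open>T\<close> is already one step ahead of
  \<open>X\<close> and \<open>P\<close>.\<close>

definition extended :: "memory \<Rightarrow> nat \<Rightarrow> nat \<Rightarrow> nat \<Rightarrow> (nat \<Rightarrow> real) \<Rightarrow> (nat \<Rightarrow> real) \<Rightarrow> bool" where
  "extended \<mu> c lo k d \<tau> \<longleftrightarrow>
     (\<forall>i. lo \<le> i \<and> i \<le> k + l \<longrightarrow> \<mu> ''X'' i c = entry d \<tau> k i) \<and>
     (\<forall>a<r. \<mu> ''P'' a c = acc d \<tau> k a) \<and> (\<forall>a<r. \<mu> ''T'' a c = tail d \<tau> (Suc k) a)"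

lemma stored_cong:
  "stored \<mu> c lo k d \<tau> \<Longrightarrow> (\<And>Z i. Z \<in> {''X'', ''P'', ''T''} \<Longrightarrow> \<nu> Z i c = \<mu> Z i c) \<Longrightarrow>
    stored \<nu> c lo k d \<tau>"
  by (simp add: stored_def)

lemma extended_cong:
  "extended \<mu> c lo k d \<tau> \<Longrightarrow> (\<And>Z i. Z \<in> {''X'', ''P'', ''T''} \<Longrightarrow> \<nu> Z i c = \<mu> Z i c) \<Longrightarrow>
    extended \<nu> c lo k d \<tau>"
  by (simp add: extended_def)

lemma enter_row_correct:
  assumes "\<And>t. ival s (\<eta>(''a'' := t)) = ival s \<eta>" "ival s \<eta> = c"
    and "\<eta> ''k'' = k" "\<eta> ''l'' = l" "\<eta> ''r'' = r" "k < n"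
    and "stored \<mu> c lo k d \<tau>" "\<And>a. a < r \<Longrightarrow> \<mu> ''u'' (k + l) a = U (k + l) a"
    and "\<mu> ''d'' (k + l) c = d (k + l)"
  shows "extended (run (enter_row s) \<eta> \<mu>) c lo k d \<tau>"
  using assms(2-) entry_tail[of k "k + l" d \<tau>]
  by (auto simp: run_enter_row[OF assms(1)] extended_def stored_def upd_region_apply upd_cell_apply
      tail_Suc)

lemma enter_row_other:
  assumes "\<And>t. ival s (\<eta>(''a'' := t)) = ival s \<eta>" "ival s \<eta> \<noteq> c"
  shows "run (enter_row s) \<eta> \<mu> Z i c = \<mu> Z i c"
  using assms(2) by (auto simp: run_enter_row[OF assms(1)] upd_region_apply upd_cell_apply)

definition reflector_loaded :: "memory \<Rightarrow> nat \<Rightarrow> bool" where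
  "reflector_loaded \<mu> k \<longleftrightarrow> (\<forall>e\<le>l. \<mu> ''y'' e 0 = y k (k + e)) \<and> (\<forall>a<r. \<mu> ''Y.V'' k a = v k a) \<and>
     (\<forall>a<r. \<mu> ''h'' a 0 = (\<Sum>b<r. gram (Suc (k + l)) a b * v k b)) \<and>
     2 / \<mu> ''s'' 0 0 = beta k"

lemma reflect_correct:
  assumes "\<And>t. ival s (\<eta>(''a'' := t)) = ival s \<eta>" "\<And>t. ival s (\<eta>(''e'' := t)) = ival s \<eta>"
    and "ival s \<eta> = c" "\<eta> ''k'' = k" "\<eta> ''l'' = l" "\<eta> ''r'' = r"
    and ext: "extended \<mu> c lo k d \<tau>" and "lo \<le> k" and refl: "reflector_loaded \<mu> k"
  shows "stored (run (reflect s) \<eta> \<mu>) c lo (Suc k) d \<tau>"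
proof -
  have w: "2 / \<mu> ''s'' 0 0 *
    ((\<Sum>e<Suc (\<eta> ''l''). \<mu> ''y'' e 0 * \<mu> ''X'' (\<eta> ''k'' + e) (ival s \<eta>)) +
     (\<Sum>a<\<eta> ''r''. \<mu> ''Y.V'' (\<eta> ''k'') a * \<mu> ''T'' a (ival s \<eta>) - \<mu> ''h'' a 0 * \<mu> ''P'' a (ival s \<eta>)))
    = beta k * weight d \<tau> k (entry d \<tau> k) (acc d \<tau> k)"
    using assms(3-) unfolding weight_def reflector_loaded_def extended_def
    by (intro arg_cong2[where f = "(*)"] arg_cong2[where f = "(+)"] sum.cong) auto
  show ?thesis
    using assms(7-) unfolding run_reflect[OF assms(1,2)] w unfolding assms(3-6)
    by (auto simp: stored_def extended_def upd_region_apply upd_cell_apply entry_Suc acc_Suc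
        reflector_loaded_def y_above not_le)
qed

lemma reflect_other:
  assumes "\<And>t. ival s (\<eta>(''a'' := t)) = ival s \<eta>" "\<And>t. ival s (\<eta>(''e'' := t)) = ival s \<eta>"
    "ival s \<eta> \<noteq> c" "Z \<noteq> ''w''"
  shows "run (reflect s) \<eta> \<mu> Z i c = \<mu> Z i c"
  using assms(3-) by (auto simp: run_reflect[OF assms(1,2)] upd_region_apply upd_cell_apply)

end


section \<open>Stored reflections applied to the right-hand side\<close>

definition load_reflector :: prog where
  "load_reflector =
     For ''e'' (IAdd (IVar ''l'') (INum 1))
       (IfLess ke (IVar ''n'')
         (IfLess (INum 0) (IVar ''e'')
           (sum_into ''y'' (IVar ''e'') (INum 0) ''a'' (IVar ''r'')
             (RCell ''Y.B'' ke (IVar ''k''))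
             (RMul (RCell ''u'' ke (IVar ''a''))
               (RCell ''Y.V'' (IVar ''k'') (IVar ''a''))))
           (Assign ''y'' (IVar ''e'') (INum 0)
             (RCell ''Y.B'' ke (IVar ''k''))))
         (Assign ''y'' (IVar ''e'') (INum 0) (RNum 0)))"

lemma run_load_reflector:
  "run load_reflector \<eta> \<mu> = upd_region ''y'' (\<lambda>i j. i \<le> \<eta> ''l'' \<and> j = 0)
    (\<lambda>e j. if \<eta> ''k'' + e < \<eta> ''n'' then \<mu> ''Y.B'' (\<eta> ''k'' + e) (\<eta> ''k'') +
       (if 0 < e then \<Sum>a<\<eta> ''r''. \<mu> ''u'' (\<eta> ''k'' + e) a * \<mu> ''Y.V'' (\<eta> ''k'') a else 0) else 0) \<mu>"
  unfolding load_reflector_def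
  by (rule run_For_region[where D = "\<lambda>t i j. i = t \<and> j = 0"])
    (auto simp: run_sum_into upd_cell_apply intro!: upd_cell_eq_upd_region)

definition apply_init :: prog where
  "apply_init =
     pad_copy ''u'' ''Y.U'' (IAdd (IVar ''n'') (IVar ''l'')) (IVar ''r'') ;;
     pad_copy ''d'' ''b'' (IAdd (IVar ''n'') (IVar ''l'')) (INum 1) ;;
     For ''i'' (IVar ''l'') (Assign ''X'' (IVar ''i'') (INum 0) (RCell ''d'' (IVar ''i'') (INum 0))) ;;
     For ''a'' (IVar ''r'') (Assign ''P'' (IVar ''a'') (INum 0) (RNum 0)) ;;
     For ''a'' (IVar ''r'') (sum_into ''T'' (IVar ''a'') (INum 0) ''t'' (IVar ''n'') (RNum 0)
       (RMul (RCell ''u'' (IAdd (IVar ''t'') (IVar ''l'')) (IVar ''a''))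
         (RCell ''d'' (IAdd (IVar ''t'') (IVar ''l'')) (INum 0)))) ;;
     gram_init ''G'' (IVar ''l'')"

definition apply_step :: prog where
  "apply_step =
     enter_row (INum 0) ;; gram_down ''G'' kl ;; load_reflector ;; load_h ;; norm_sq ;;
     reflect (INum 0)"

definition apply_prog :: prog where
  "apply_prog = apply_init ;; For ''k'' (IVar ''n'') apply_step ;;
     For ''i'' (IVar ''n'') (Assign ''c'' (IVar ''i'') (INum 0) (RCell ''X'' (IVar ''i'') (INum 0)))"

lemmas program_defs = pad_copy_def gram_init_def gram_down_def enter_row_def load_h_def norm_sq_def
  scaled_weight_def reflect_def sum_into_def load_reflector_def apply_init_def apply_step_def
  apply_prog_def

lemma run_apply_init:
  assumes u_def: "\<And>i a. u i a = (if i < \<eta> ''n'' then \<mu> ''Y.U'' i a else 0)"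
    and d_def: "\<And>i. d i = (if i < \<eta> ''n'' then \<mu> ''b'' i 0 else 0)"
    and \<nu>_def: "\<nu> = run apply_init \<eta> \<mu>"
  shows "i < \<eta> ''n'' + \<eta> ''l'' \<Longrightarrow> a < \<eta> ''r'' \<Longrightarrow> \<nu> ''u'' i a = u i a" (is "PROP ?A")
    and "i < \<eta> ''n'' + \<eta> ''l'' \<Longrightarrow> \<nu> ''d'' i 0 = d i" (is "PROP ?B")
    and "i < \<eta> ''l'' \<Longrightarrow> \<nu> ''X'' i 0 = d i" (is "PROP ?C")
    and "a < \<eta> ''r'' \<Longrightarrow> \<nu> ''P'' a 0 = 0" (is "PROP ?D")
    and "a < \<eta> ''r'' \<Longrightarrow> \<nu> ''T'' a 0 = (\<Sum>t<\<eta> ''n''. u (t + \<eta> ''l'') a * d (t + \<eta> ''l''))" (is "PROP ?E")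
    and "a < \<eta> ''r'' \<Longrightarrow> b < \<eta> ''r'' \<Longrightarrow>
      \<nu> ''G'' a b = (\<Sum>t<\<eta> ''n''. u (t + \<eta> ''l'') a * u (t + \<eta> ''l'') b)" (is "PROP ?F")
proof -
  have X: "run (For ''i'' (IVar ''l'') (Assign ''X'' (IVar ''i'') (INum 0) (RCell ''d'' (IVar ''i'') (INum 0)))) \<eta> \<mu> =
    upd_region ''X'' (\<lambda>i j. i < \<eta> ''l'' \<and> j = 0) (\<lambda>i j. \<mu> ''d'' i 0) \<mu>" for \<mu>
    by (rule run_For_region[where D = "\<lambda>t i j. i = t \<and> j = 0"])
      (auto simp: intro!: upd_cell_eq_upd_region)
  have P: "run (For ''a'' (IVar ''r'') (Assign ''P'' (IVar ''a'') (INum 0) (RNum 0))) \<eta> \<mu> =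
    upd_region ''P'' (\<lambda>i j. i < \<eta> ''r'' \<and> j = 0) (\<lambda>i j. 0) \<mu>" for \<mu>
    by (rule run_For_region[where D = "\<lambda>t i j. i = t \<and> j = 0"])
      (auto simp: intro!: upd_cell_eq_upd_region)
  have T: "run (For ''a'' (IVar ''r'') (sum_into ''T'' (IVar ''a'') (INum 0) ''t'' (IVar ''n'') (RNum 0)
       (RMul (RCell ''u'' (IAdd (IVar ''t'') (IVar ''l'')) (IVar ''a''))
         (RCell ''d'' (IAdd (IVar ''t'') (IVar ''l'')) (INum 0))))) \<eta> \<mu> =
    upd_region ''T'' (\<lambda>i j. i < \<eta> ''r'' \<and> j = 0)
      (\<lambda>i j. \<Sum>t<\<eta> ''n''. \<mu> ''u'' (t + \<eta> ''l'') i * \<mu> ''d'' (t + \<eta> ''l'') 0) \<mu>" for \<mu>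
    by (rule run_For_region[where D = "\<lambda>t i j. i = t \<and> j = 0"])
      (auto simp: run_sum_into upd_cell_apply intro!: upd_cell_eq_upd_region)
  note eqs = \<nu>_def apply_init_def run.simps(3) X P T run_gram_init run_pad_copy
  show "PROP ?A" and "PROP ?B" and "PROP ?C" and "PROP ?D" and "PROP ?E" and "PROP ?F"
    by (simp_all add: eqs upd_region_apply u_def d_def del: run.simps(6) cong: if_cong)
qed

context reflections
begin

lemma gram_down_correct:
  assumes "\<eta> ''r'' = r" "ival s \<eta> = i" "\<And>t t'. ival s (\<eta>(''a'' := t, ''b'' := t')) = i" "X \<noteq> ''u''"
    and "\<And>a b. a < r \<Longrightarrow> b < r \<Longrightarrow> \<mu> X a b = gram i a b" "\<And>a. a < r \<Longrightarrow> \<mu> ''u'' i a = U i a"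
    and "a < r" "b < r"
  shows "run (gram_down X s) \<eta> \<mu> X a b = gram (Suc i) a b"
  using assms by (subst run_gram_down) (auto simp: upd_region_apply gram_Suc[of i])

lemma norm_correct:
  assumes "\<eta> ''k'' = k" "\<eta> ''l'' = l" "\<eta> ''r'' = r"
    and "\<And>e. e \<le> l \<Longrightarrow> \<mu> ''y'' e 0 = z (k + e)"
    and "\<And>a. a < r \<Longrightarrow> \<mu> ''Y.V'' k a = c a"
    and "\<And>a. a < r \<Longrightarrow> \<mu> ''h'' a 0 = (\<Sum>b<r. gram (Suc (k + l)) a b * c b)"
    and "\<And>i. i < k \<Longrightarrow> z i = 0" "\<And>i. n \<le> i \<Longrightarrow> z i = 0"
    and "\<And>i. k + l < i \<Longrightarrow> z i = (\<Sum>a<r. U i a * c a)"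
  shows "run norm_sq \<eta> \<mu> ''s'' 0 0 = (\<Sum>i<n. (z i)\<^sup>2)"
proof -
  have "(\<Sum>i<n. (z i)\<^sup>2) = (\<Sum>e<Suc l. (z (k + e))\<^sup>2) +
    (\<Sum>a<r. (\<Sum>b<r. gram (Suc (k + l)) a b * c b) * c a)"
    by (rule norm_window) (use assms in auto)
  also have "\<dots> = (\<Sum>e<Suc l. (\<mu> ''y'' e 0)\<^sup>2) + (\<Sum>a<r. \<mu> ''h'' a 0 * \<mu> ''Y.V'' k a)"
    using assms by (intro arg_cong2[where f = "(+)"] sum.cong) auto
  finally show ?thesis
    using assms(1-3) by (simp add: run_norm_sq upd_cell_apply del: sum.lessThan_Suc)
qed

text \<open>The hypotheses \<open>V\<close> and \<open>B\<close> are the interface to the generators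
  of \<open>Y\<close>: band part plus lower semiseparable part reproduce the window of
  \<open>y k\<close>.\<close>

lemma apply_step_correct:
  assumes env: "\<eta> ''n'' = n" "\<eta> ''k'' = k" "\<eta> ''l'' = l" "\<eta> ''r'' = r" and k: "k < n"
    and st: "stored \<mu> 0 0 k d \<tau>"
    and G: "\<And>a b. a < r \<Longrightarrow> b < r \<Longrightarrow> \<mu> ''G'' a b = gram (k + l) a b"
    and u: "\<And>i a. i < n + l \<Longrightarrow> a < r \<Longrightarrow> \<mu> ''u'' i a = U i a"
    and d: "\<mu> ''d'' (k + l) 0 = d (k + l)"
    and V: "\<And>a. a < r \<Longrightarrow> \<mu> ''Y.V'' k a = v k a"
    and B: "\<And>i. k \<le> i \<Longrightarrow> i \<le> k + l \<Longrightarrow> i < n \<Longrightarrow>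
      \<mu> ''Y.B'' i k + (if k < i then \<Sum>a<r. U i a * v k a else 0) = y k i"
  shows "stored (run apply_step \<eta> \<mu>) 0 0 (Suc k) d \<tau>"
    and "\<And>a b. a < r \<Longrightarrow> b < r \<Longrightarrow> run apply_step \<eta> \<mu> ''G'' a b = gram (Suc k + l) a b"
proof -
  define \<mu>1 \<mu>2 \<mu>3 \<mu>4 \<mu>5 where "\<mu>1 = run (enter_row (INum 0)) \<eta> \<mu>"
    and "\<mu>2 = run (gram_down ''G'' kl) \<eta> \<mu>1" and "\<mu>3 = run load_reflector \<eta> \<mu>2"
    and "\<mu>4 = run load_h \<eta> \<mu>3" and "\<mu>5 = run norm_sq \<eta> \<mu>4"
  have ext: "extended \<mu>1 0 0 k d \<tau>"
    unfolding \<mu>1_def by (rule enter_row_correct) (use env k st u d in auto)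
  have 1: "\<mu>1 Z = \<mu> Z" if "Z \<notin> {''X'', ''T''}" for Z
    using that unfolding \<mu>1_def by (intro run_unwritten) (simp add: program_defs)
  have 2: "\<mu>2 Z = \<mu>1 Z" if "Z \<noteq> ''G''" for Z
    using that unfolding \<mu>2_def by (intro run_unwritten) (simp add: program_defs)
  have 3: "\<mu>3 Z = \<mu>2 Z" if "Z \<noteq> ''y''" for Z
    using that unfolding \<mu>3_def by (intro run_unwritten) (simp add: program_defs)
  have 4: "\<mu>4 Z = \<mu>3 Z" if "Z \<noteq> ''h''" for Z
    using that unfolding \<mu>4_def by (intro run_unwritten) (simp add: program_defs)
  have 5: "\<mu>5 Z = \<mu>4 Z" if "Z \<noteq> ''s''" for Z
    using that unfolding \<mu>5_def by (intro run_unwritten) (simp add: program_defs)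
  have G2: "\<mu>2 ''G'' a b = gram (Suc (k + l)) a b" if "a < r" "b < r" for a b
    unfolding \<mu>2_def by (rule gram_down_correct) (use env k G u that in \<open>auto simp: 1\<close>)
  have V2: "\<mu>2 ''Y.V'' k a = v k a" if "a < r" for a
    using V that by (simp add: 2 1)
  have y3: "\<mu>3 ''y'' e 0 = y k (k + e)" if "e \<le> l" for e
  proof (cases "k + e < n")
    case True
    then show ?thesis
      using B[of "k + e"] that u V unfolding \<mu>3_def run_load_reflector
      by (simp add: upd_region_apply env 2 1 split: if_splits)
  next
    case False
    then show ?thesis
      using that unfolding \<mu>3_def run_load_reflector
      by (simp add: upd_region_apply env y_out)
  qed
  have h4: "\<mu>4 ''h'' a 0 = (\<Sum>b<r. gram (Suc (k + l)) a b * v k b)" if "a < r" for a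
    unfolding \<mu>4_def run_load_h using that by (simp add: upd_region_apply env 3 G2 V2)
  have s: "\<mu>5 ''s'' 0 0 = (\<Sum>i<n. (y k i)\<^sup>2)"
    unfolding \<mu>5_def
    by (rule norm_correct) (use env y3 h4 V2 k in \<open>auto simp: 4 3 y_above y_out y_tail\<close>)
  have rl: "reflector_loaded \<mu>5 k"
    unfolding reflector_loaded_def s beta_def using y3 h4 V2 by (simp add: 5 4 3)
  have ext5: "extended \<mu>5 0 0 k d \<tau>"
    by (rule extended_cong[OF ext]) (auto simp: 5 4 3 2)
  have run: "run apply_step \<eta> \<mu> = run (reflect (INum 0)) \<eta> \<mu>5"
    by (simp add: apply_step_def \<mu>1_def \<mu>2_def \<mu>3_def \<mu>4_def \<mu>5_def)
  show "stored (run apply_step \<eta> \<mu>) 0 0 (Suc k) d \<tau>"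
    unfolding run by (rule reflect_correct[OF _ _ _ env(2-4) ext5 _ rl]) simp_all
  fix a b assume "a < r" "b < r"
  then show "run apply_step \<eta> \<mu> ''G'' a b = gram (Suc k + l) a b"
    unfolding run by (subst run_unwritten) (simp_all add: program_defs 5 4 3 G2)
qed

end

lemma applies_reflections_apply_prog: "applies_reflections apply_prog"
  unfolding applies_reflections_def Let_def
proof (intro allI impI conjI, elim conjE)
  fix n r p l m :: nat and Y :: "real mat" and \<mu> :: memory
  assume st: "stores_bps \<mu> ''Y'' n r 0 l 0 Y" and nz: "\<forall>k<n. col Y k \<noteq> 0\<^sub>v n"
  define \<eta> where "\<eta> = size_env n r p l m"
  have env: "\<eta> ''n'' = n" "\<eta> ''r'' = r" "\<eta> ''l'' = l" by (simp_all add: \<eta>_def size_env_def)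
  define U where "U = (\<lambda>i a. if i < n then \<mu> ''Y.U'' i a else 0)"
  \<comment> \<open>Cut off outside the matrix, so that the conditions of the locale also hold for
    indices from \<open>n\<close> on.\<close>
  define y where "y = (\<lambda>k i. if i < n \<and> k < n then Y $$ (i, k) else 0)"
  define v where "v = \<mu> ''Y.V''"
  define d where "d = (\<lambda>i. if i < n then \<mu> ''b'' i 0 else 0)"
  define \<tau> where "\<tau> = (\<lambda>a. \<Sum>i<n. U i a * d i)"
  have Y: "Y \<in> carrier_mat n n" using st by (simp add: stores_bps_iff)
  have Yij: "Y $$ (i, j) = (if j \<le> i \<and> i \<le> j + l then \<mu> ''Y.B'' i j else 0) +
      (if j < i then \<Sum>a<r. U i a * v j a else 0)" if "i < n" "j < n" for i j
    using st that by (auto simp: stores_bps_iff U_def v_def)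
  interpret reflections n l r U y v
    by unfold_locales (auto simp: U_def y_def Yij)
  define \<mu>0 where "\<mu>0 = run apply_init \<eta> \<mu>"
  have Ud: "\<And>i a. U i a = (if i < n then \<mu> ''Y.U'' i a else 0)" "\<And>i. d i = (if i < n then \<mu> ''b'' i 0 else 0)"
    by (simp_all add: U_def d_def)
  note init = run_apply_init[of U \<eta> \<mu> d, unfolded env, OF Ud \<mu>0_def]
  have frame0: "\<mu>0 Z = \<mu> Z" if "Z \<notin> {''u'', ''d'', ''X'', ''P'', ''T'', ''G''}" for Z
    using that unfolding \<mu>0_def by (intro run_unwritten) (simp add: program_defs)
  let ?inv = "\<lambda>k \<nu>. stored \<nu> 0 0 k d \<tau> \<and> (\<forall>a<r. \<forall>b<r. \<nu> ''G'' a b = gram (k + l) a b) \<and>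
    (\<forall>Z. Z \<notin> written apply_step \<longrightarrow> \<nu> Z = \<mu>0 Z)"
  define \<mu>1 where "\<mu>1 = run (For ''k'' (IVar ''n'') apply_step) \<eta> \<mu>0"
  have "?inv (ival (IVar ''n'') \<eta>) \<mu>1"
    unfolding \<mu>1_def
  proof (rule run_For_invariant[where I = ?inv])
    \<comment> \<open>The program sums \<open>n\<close> rows starting at row \<open>l\<close>; the
      excess rows are zero, so this is the total minus the first \<open>l\<close> rows.\<close>
    have tail0: "(\<Sum>t<n. U (t + l) a * d (t + l)) = tail d \<tau> 0 a" for a
    proof -
      have "(\<Sum>i<n. U i a * d i) = (\<Sum>i<n + l. U i a * d i)"
        by (rule sum.mono_neutral_left) (auto simp: U_def)
      also have "\<dots> = (\<Sum>i<l. U i a * d i) + (\<Sum>t<n. U (t + l) a * d (t + l))"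
        by (induction n) (simp_all add: add.assoc)
      finally show ?thesis by (simp add: tail_def \<tau>_def)
    qed
    show "?inv 0 \<mu>0"
      using init(3-6) by (auto simp: stored_def entry_0 acc_0 tail0 gram_shift)
  next
    fix k \<nu> assume "k < ival (IVar ''n'') \<eta>" and I: "?inv k \<nu>"
    then have k: "k < n" by (simp add: env)
    have "Z \<notin> written apply_step" if "Z \<in> {''u'', ''d'', ''Y.B'', ''Y.V''}" for Z
      using that by (auto simp: program_defs)
    then have fr: "\<nu> Z = \<mu>0 Z" if "Z \<in> {''u'', ''d'', ''Y.B'', ''Y.V''}" for Z
      using I that by blast
    have st: "stored \<nu> 0 0 k d \<tau>" and G: "\<And>a b. a < r \<Longrightarrow> b < r \<Longrightarrow> \<nu> ''G'' a b = gram (k + l) a b"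
      using I by blast+
    have step: "\<nu> ''u'' i a = U i a" if "i < n + l" "a < r" for i a
      using that by (simp add: fr init)
    have "\<nu> ''d'' (k + l) 0 = d (k + l)" "\<And>a. \<nu> ''Y.V'' k a = v k a"
      using k by (simp_all add: fr init frame0 v_def)
    moreover have "\<nu> ''Y.B'' i k + (if k < i then \<Sum>a<r. U i a * v k a else 0) = y k i"
      if "k \<le> i" "i \<le> k + l" "i < n" for i
      using that k by (simp add: fr frame0 y_def Yij)
    ultimately have "stored (run apply_step (\<eta>(''k'' := k)) \<nu>) 0 0 (Suc k) d \<tau>"
      "\<And>a b. a < r \<Longrightarrow> b < r \<Longrightarrow> run apply_step (\<eta>(''k'' := k)) \<nu> ''G'' a b = gram (Suc k + l) a b"
      using env apply_step_correct[OF _ _ _ _ k st G step, of "\<eta>(''k'' := k)"] by simp_all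
    moreover have "run apply_step (\<eta>(''k'' := k)) \<nu> Z = \<mu>0 Z" if "Z \<notin> written apply_step" for Z
      using I that run_unwritten by metis
    ultimately show "?inv (Suc k) (run apply_step (\<eta>(''k'' := k)) \<nu>)"
      by blast
  qed
  then have "stored \<mu>1 0 0 n d \<tau>" by (simp add: env)
  then have X: "\<mu>1 ''X'' i 0 = entry d \<tau> n i" if "i < n" for i
    using that by (simp add: stored_def)
  have "run apply_prog \<eta> \<mu> = upd_region ''c'' (\<lambda>i j. i < n \<and> j = 0) (\<lambda>i j. \<mu>1 ''X'' i 0) \<mu>1"
  proof -
    have "run (For ''i'' (IVar ''n'') (Assign ''c'' (IVar ''i'') (INum 0) (RCell ''X'' (IVar ''i'') (INum 0)))) \<eta> \<mu>1 =
      upd_region ''c'' (\<lambda>i j. i < n \<and> j = 0) (\<lambda>i j. \<mu>1 ''X'' i 0) \<mu>1"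
      by (rule run_For_region[where D = "\<lambda>t i j. i = t \<and> j = 0"])
        (auto simp: env intro!: upd_cell_eq_upd_region)
    then show ?thesis by (simp add: apply_prog_def \<mu>1_def \<mu>0_def)
  qed
  then have "vec_at (run apply_prog \<eta> \<mu>) ''c'' n = vec n (entry d \<tau> n)"
    by (auto simp: vec_at_def upd_region_apply X)
  also have "\<dots> = transpose_mat (householder_prod Y) *\<^sub>v vec n (entry d \<tau> 0)"
  proof (rule successive_reflections(2)[OF Y, symmetric])
    fix k i assume ki: "k < n" "i < n"
    have "weight d \<tau> k (entry d \<tau> k) (acc d \<tau> k) = (\<Sum>i<n. y k i * entry d \<tau> k i)"
      by (rule weight_column[OF ki(1)]) (simp add: d_def, simp add: \<tau>_def)
    moreover have "y k t = Y $$ (t, k)" if "t < n" for t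
      using that ki by (simp add: y_def)
    ultimately show "entry d \<tau> (Suc k) i = entry d \<tau> k i -
      2 / (\<Sum>t<n. (Y $$ (t, k))\<^sup>2) * Y $$ (i, k) * (\<Sum>t<n. Y $$ (t, k) * entry d \<tau> k t)"
      using ki by (simp add: entry_Suc beta_def)
  qed (use nz in auto)
  also have "vec n (entry d \<tau> 0) = vec_at \<mu> ''b'' n"
    by (auto simp: entry_0 d_def vec_at_def)
  finally show "vec_at (run apply_prog (size_env n r p l m) \<mu>) ''c'' n =
      transpose_mat (householder_prod Y) *\<^sub>v vec_at \<mu> ''b'' n"
    by (simp add: \<eta>_def)
next
  fix n r p l m :: nat and \<mu> :: memory and R :: "real mat"
  assume "stores_bps \<mu> ''R'' n 0 (p + r) 0 (l + m) R"
  moreover have "Z \<notin> written apply_prog"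
    if "Z \<in> {''R.B'', ''R.U'', ''R.V'', ''R.W'', ''R.S''}" for Z
    using that by (auto simp: program_defs)
  ultimately show "stores_bps (run apply_prog (size_env n r p l m) \<mu>) ''R'' n 0 (p + r) 0 (l + m) R"
    by (simp add: stores_bps_def band_at_def mat_at_def run_unwritten cong: if_cong)
qed


section \<open>Back substitution\<close>

text \<open>\<open>z\<close> accumulates the products of \<open>S\<close> with the unknowns already
  found, so the semiseparable part of a row costs \<open>p + r\<close> multiplications. Loops count
  upwards, hence the row \<open>n - (t + 1)\<close>. The divisor is a band cell because the
  semiseparable part of \<open>R\<close> is strictly upper.\<close>

definition back_step :: prog where
  "back_step =
     (let i = ISub (IVar ''n'') (IAdd (IVar ''t'') (INum 1)); q = IAdd (IVar ''p'') (IVar ''r'');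
          j = IAdd i (IAdd (INum 1) (IVar ''e'')) in
      sum_into ''x'' i (INum 0) ''e'' (IAdd (IVar ''l'') (IVar ''m'')) (RCell ''c'' i (INum 0))
        (RSub (RNum 0) (RMul (RCell ''R.B'' i j) (RCell ''x'' j (INum 0)))) ;;
      sum_into ''x'' i (INum 0) ''a'' q (RCell ''x'' i (INum 0))
        (RSub (RNum 0) (RMul (RCell ''R.W'' i (IVar ''a'')) (RCell ''z'' (IVar ''a'') (INum 0)))) ;;
      Assign ''x'' i (INum 0) (RDiv (RCell ''x'' i (INum 0)) (RCell ''R.B'' i i)) ;;
      For ''a'' q (Assign ''z'' (IVar ''a'') (INum 0) (RAdd (RCell ''z'' (IVar ''a'') (INum 0))
        (RMul (RCell ''R.S'' i (IVar ''a'')) (RCell ''x'' i (INum 0))))))"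

text \<open>The zeros after the end of \<open>x\<close> neutralize the band cells in columns from
  \<open>n\<close> on, whose content is arbitrary.\<close>

definition back_init :: prog where
  "back_init =
     For ''e'' (IAdd (IVar ''l'') (IVar ''m''))
       (Assign ''x'' (IAdd (IVar ''n'') (IVar ''e'')) (INum 0) (RNum 0)) ;;
     For ''a'' (IAdd (IVar ''p'') (IVar ''r'')) (Assign ''z'' (IVar ''a'') (INum 0) (RNum 0))"

definition back_substitution :: prog where
  "back_substitution = back_init ;; For ''t'' (IVar ''n'') back_step"

lemma solves_triangular_back_substitution: "solves_triangular back_substitution"
  unfolding solves_triangular_def Let_def
proof (intro allI impI, elim conjE)
  fix n r p l m :: nat and R :: "real mat" and \<mu> :: memory
  assume st: "stores_bps \<mu> ''R'' n 0 (p + r) 0 (l + m) R"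
    and up: "upper_triangular R" and inv: "invertible_mat R"
  define \<eta> where "\<eta> = size_env n r p l m"
  have env: "\<eta> ''n'' = n" "\<eta> ''r'' = r" "\<eta> ''p'' = p" "\<eta> ''l'' = l" "\<eta> ''m'' = m"
    by (simp_all add: \<eta>_def size_env_def)
  define L q where "L = l + m" and "q = p + r"
  define B W S where "B = \<mu> ''R.B''" and "W = \<mu> ''R.W''" and "S = \<mu> ''R.S''"
  have R: "R \<in> carrier_mat n n" using st by (simp add: stores_bps_iff)
  have Rij: "R $$ (i, j) = (if i \<le> j \<and> j \<le> i + L then B i j else 0) +
      (if i < j then \<Sum>a<q. W i a * S j a else 0)" if "i < n" "j < n" for i j
    using st that by (simp add: stores_bps_iff B_def W_def S_def L_def q_def)
  have diag: "B i i \<noteq> 0" if "i < n" for i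
    using upper_triangular_invertible_diag[OF R up inv that] Rij[OF that that] by simp
  \<comment> \<open>The left-hand side of equation \<open>i\<close> in the shape the program
    evaluates, with band terms that may run past column \<open>n - 1\<close>.\<close>
  define row where "row = (\<lambda>(x :: nat \<Rightarrow> real) i. B i i * x i + (\<Sum>e<L. B i (Suc (i + e)) * x (Suc (i + e))) +
    (\<Sum>a<q. W i a * (\<Sum>j\<in>{Suc i..<n}. S j a * x j)))"
  let ?inv = "\<lambda>t \<nu>. (\<forall>i. n - t \<le> i \<and> i < n \<longrightarrow> row (\<lambda>j. \<nu> ''x'' j 0) i = \<mu> ''c'' i 0) \<and>
    (\<forall>e<L. \<nu> ''x'' (n + e) 0 = 0) \<and>
    (\<forall>a<q. \<nu> ''z'' a 0 = (\<Sum>j\<in>{n - t..<n}. S j a * \<nu> ''x'' j 0)) \<and>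
    (\<forall>Z. Z \<notin> {''x'', ''z''} \<longrightarrow> \<nu> Z = \<mu> Z)"
  define i where "i = ISub (IVar ''n'') (IAdd (IVar ''t'') (INum 1))"
  define \<mu>0 where "\<mu>0 = run back_init \<eta> \<mu>"
  have \<mu>0: "\<mu>0 = upd_region ''z'' (\<lambda>i j. i < q \<and> j = 0) (\<lambda>i j. 0)
      (upd_region ''x'' (\<lambda>i j. n \<le> i \<and> i < n + L \<and> j = 0) (\<lambda>i j. 0) \<mu>)"
  proof -
    have ex: "(\<exists>t<L. i = n + t \<and> j = 0) \<longleftrightarrow> n \<le> i \<and> i < n + L \<and> j = (0::nat)" for i j
      by (auto intro!: exI[of _ "i - n"])
    have "run (For ''e'' (IAdd (IVar ''l'') (IVar ''m''))
        (Assign ''x'' (IAdd (IVar ''n'') (IVar ''e'')) (INum 0) (RNum 0))) \<eta> \<mu> =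
      upd_region ''x'' (\<lambda>i j. n \<le> i \<and> i < n + L \<and> j = 0) (\<lambda>i j. 0) \<mu>"
      by (rule run_For_region[where D = "\<lambda>t i j. i = n + t \<and> j = 0"])
        (auto simp: env L_def[symmetric] ex intro!: upd_cell_eq_upd_region)
    moreover have "run (For ''a'' (IAdd (IVar ''p'') (IVar ''r'')) (Assign ''z'' (IVar ''a'') (INum 0) (RNum 0))) \<eta> \<nu> =
      upd_region ''z'' (\<lambda>i j. i < q \<and> j = 0) (\<lambda>i j. 0) \<nu>" for \<nu>
      by (rule run_For_region[where D = "\<lambda>t i j. i = t \<and> j = 0"])
        (auto simp: env q_def intro!: upd_cell_eq_upd_region)
    ultimately show ?thesis unfolding \<mu>0_def by (simp only: back_init_def run.simps(3))
  qed
  have "run back_substitution \<eta> \<mu> = run (For ''t'' (IVar ''n'') back_step) \<eta> \<mu>0"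
    by (simp add: back_substitution_def \<mu>0_def)
  moreover have "?inv (ival (IVar ''n'') \<eta>) (run (For ''t'' (IVar ''n'') back_step) \<eta> \<mu>0)"
  proof (rule run_For_invariant[where I = ?inv])
    show "?inv 0 \<mu>0" by (auto simp: \<mu>0 upd_region_apply upd_region_other)
  next
    fix t \<nu> assume "t < ival (IVar ''n'') \<eta>" and I: "?inv t \<nu>"
    then have t: "t < n" by (simp add: env)
    define k where "k = n - Suc t"
    have k: "k < n" "n - t = Suc k" "n - Suc t = k" using t by (auto simp: k_def)
    have ik: "ival i (\<eta>(''t'' := t)) = k" "ival i (\<eta>(''t'' := t, ''e'' := s)) = k"
      "ival i (\<eta>(''t'' := t, ''a'' := s)) = k" for s
      by (simp_all add: i_def env k_def)
    define xk where "xk = (\<mu> ''c'' k 0 - (\<Sum>e<L. B k (Suc (k + e)) * \<nu> ''x'' (Suc (k + e)) 0) -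
      (\<Sum>a<q. W k a * \<nu> ''z'' a 0)) / B k k"
    define \<nu>' where "\<nu>' = run back_step (\<eta>(''t'' := t)) \<nu>"
    have fr: "\<nu> Z = \<mu> Z" if "Z \<notin> {''x'', ''z''}" for Z using I that by blast
    have z: "run (For ''a'' (IAdd (IVar ''p'') (IVar ''r'')) (Assign ''z'' (IVar ''a'') (INum 0)
        (RAdd (RCell ''z'' (IVar ''a'') (INum 0)) (RMul (RCell ''R.S'' i (IVar ''a''))
          (RCell ''x'' i (INum 0)))))) (\<eta>(''t'' := t)) \<mu>' =
      upd_region ''z'' (\<lambda>i j. i < q \<and> j = 0) (\<lambda>a j. \<mu>' ''z'' a 0 + \<mu>' ''R.S'' k a * \<mu>' ''x'' k 0) \<mu>'" for \<mu>'
      by (rule run_For_region[where D = "\<lambda>t i j. i = t \<and> j = 0"])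
        (auto simp: env q_def ik intro!: upd_cell_eq_upd_region)
    have \<nu>': "\<nu>' = upd_region ''z'' (\<lambda>i j. i < q \<and> j = 0) (\<lambda>a j. \<nu> ''z'' a 0 + S k a * xk)
        (upd_cell ''x'' k 0 xk \<nu>)"
      unfolding \<nu>'_def back_step_def Let_def i_def[symmetric] run.simps(3) z
      by (simp add: run_sum_into ik env upd_cell_apply upd_cell_overwrite fr sum_negf xk_def B_def W_def S_def
          L_def[symmetric] q_def[symmetric])
    have x': "\<nu>' ''x'' j 0 = (if j = k then xk else \<nu> ''x'' j 0)" for j
      by (simp add: \<nu>' upd_region_apply upd_cell_apply)
    have sums: "(\<Sum>j\<in>{i..<n}. S j a * \<nu>' ''x'' j 0) = (\<Sum>j\<in>{i..<n}. S j a * \<nu> ''x'' j 0)"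
      if "k < i" for i a using that by (intro sum.cong) (auto simp: x')
    have "row (\<lambda>j. \<nu>' ''x'' j 0) i = \<mu> ''c'' i 0" if "k \<le> i" "i < n" for i
    proof (cases "i = k")
      case True
      have "B k k * xk = \<mu> ''c'' k 0 - (\<Sum>e<L. B k (Suc (k + e)) * \<nu> ''x'' (Suc (k + e)) 0) -
          (\<Sum>a<q. W k a * \<nu> ''z'' a 0)"
        using diag[OF k(1)] by (simp add: xk_def)
      then show ?thesis using True I by (simp add: row_def x' sums k)
    next
      case False
      then show ?thesis using that I k by (simp add: row_def x' sums)
    qed
    moreover have "\<nu>' ''z'' a 0 = (\<Sum>j\<in>{k..<n}. S j a * \<nu>' ''x'' j 0)" if "a < q" for a
      using that I k(1) by (simp add: \<nu>' upd_region_apply upd_cell_apply sum.atLeast_Suc_lessThan[of k] k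
        cong: sum.cong)
        (simp add: \<nu>'[symmetric] sums)
    ultimately show "?inv (Suc t) (run back_step (\<eta>(''t'' := t)) \<nu>)"
      unfolding \<nu>'_def[symmetric] k(3) using I k
      by (auto simp: x') (auto simp: \<nu>' upd_region_other upd_cell_def)
  qed
  ultimately have I: "?inv n (run back_substitution \<eta> \<mu>)" by (simp add: env)
  define x where "x = (\<lambda>j. run back_substitution \<eta> \<mu> ''x'' j 0)"
  have "(\<Sum>j<n. R $$ (i, j) * x j) = \<mu> ''c'' i 0" if i: "i < n" for i
  proof -
    let ?z = "\<lambda>j. if i \<le> j \<and> j \<le> i + L \<and> j < n then B i j * x j else 0"
    have "(\<Sum>j<n. R $$ (i, j) * x j) = (\<Sum>j<n. ?z j) + (\<Sum>j<n. if i < j then (\<Sum>a<q. W i a * S j a) * x j else 0)"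
      unfolding sum.distrib[symmetric] using i by (intro sum.cong) (auto simp: Rij distrib_right)
    also have "(\<Sum>j<n. ?z j) = (\<Sum>e<Suc L. ?z (i + e)) + (\<Sum>j\<in>{Suc (i + L)..<n}. ?z j)"
      by (rule sum_window_split) auto
    also have "(\<Sum>j\<in>{Suc (i + L)..<n}. ?z j) = 0" by (intro sum.neutral) auto
    also have "(\<Sum>e<Suc L. ?z (i + e)) = (\<Sum>e<Suc L. B i (i + e) * x (i + e))"
    proof (rule sum.cong[OF refl])
      fix e assume "e \<in> {..<Suc L}"
      moreover have "x (i + e) = 0" if "n \<le> i + e" "e \<le> L"
        using I[THEN conjunct2, THEN conjunct1, rule_format, of "i + e - n"] that i by (simp add: x_def)
      ultimately show "?z (i + e) = B i (i + e) * x (i + e)" by auto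
    qed
    also have "\<dots> = B i i * x i + (\<Sum>e<L. B i (Suc (i + e)) * x (Suc (i + e)))"
      by (subst sum.lessThan_Suc_shift) simp
    also have "(\<Sum>j<n. if i < j then (\<Sum>a<q. W i a * S j a) * x j else 0) =
        (\<Sum>j\<in>{Suc i..<n}. \<Sum>a<q. W i a * (S j a * x j))"
      by (rule sum.mono_neutral_cong_right) (auto simp: sum_distrib_right mult.assoc)
    also have "\<dots> = (\<Sum>a<q. W i a * (\<Sum>j\<in>{Suc i..<n}. S j a * x j))"
      by (subst sum.swap) (simp add: sum_distrib_left)
    also have "B i i * x i + (\<Sum>e<L. B i (Suc (i + e)) * x (Suc (i + e))) + 0 +
        (\<Sum>a<q. W i a * (\<Sum>j\<in>{Suc i..<n}. S j a * x j)) = \<mu> ''c'' i 0"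
      using I i by (simp add: row_def x_def)
    finally show ?thesis .
  qed
  then show "R *\<^sub>v vec_at (run back_substitution (size_env n r p l m) \<mu>) ''x'' n = vec_at \<mu> ''c'' n"
    using R unfolding \<eta>_def[symmetric]
    by (intro eq_vecI) (auto simp: vec_at_def scalar_prod_def x_def atLeast0LessThan)
qed


section \<open>The factorization program\<close>

text \<open>
  Slots \<open>c < p + r\<close> carry the formal columns, slot \<open>p + r + j\<close> carries column \<open>j\<close>. Column \<open>k + (l + m)\<close>
  is created from the formal columns in step \<open>k\<close>, the earlier ones directly; \<open>G2\<close> is \<open>gram\<close> at the
  row below which the entering column is \<open>U * V j\<close>.
\<close>

abbreviation (input) "qx \<equiv> IAdd (IVar ''p'') (IVar ''r'')"
abbreviation (input) "Lx \<equiv> IAdd (IVar ''l'') (IVar ''m'')"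
abbreviation (input) "kL \<equiv> IAdd (IVar ''k'') Lx"
abbreviation (input) "slot j \<equiv> IAdd qx j"

section \<open>Creating the slot of an entering column\<close>

definition bps_entry ::
  "memory \<Rightarrow> nat \<Rightarrow> nat \<Rightarrow> nat \<Rightarrow> nat \<Rightarrow> nat \<Rightarrow> nat \<Rightarrow> nat \<Rightarrow> real" where
  "bps_entry \<mu> n r p l m i j = (if i < n then
     (if j < i then \<Sum>a<r. \<mu> ''A.U'' i a * \<mu> ''A.V'' j a
      else if i < j then \<Sum>a<p. \<mu> ''A.W'' i a * \<mu> ''A.S'' j a else 0) +
     (if i \<le> j + l \<and> j \<le> i + m then \<mu> ''A.B'' i j else 0) else 0)"

definition load_entry :: "iexp \<Rightarrow> iexp \<Rightarrow> prog" where
  "load_entry i j =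
     IfLess i (IVar ''n'')
       (IfLess j i
         (sum_into ''d'' i (slot j) ''a'' (IVar ''r'') (RNum 0)
           (RMul (RCell ''A.U'' i (IVar ''a'')) (RCell ''A.V'' j (IVar ''a''))))
         (IfLess i j
           (sum_into ''d'' i (slot j) ''a'' (IVar ''p'') (RNum 0)
             (RMul (RCell ''A.W'' i (IVar ''a'')) (RCell ''A.S'' j (IVar ''a''))))
           (Assign ''d'' i (slot j) (RNum 0))) ;;
        IfLess i (IAdd (IAdd j (IVar ''l'')) (INum 1))
         (IfLess j (IAdd (IAdd i (IVar ''m'')) (INum 1))
           (Assign ''d'' i (slot j) (RAdd (RCell ''d'' i (slot j)) (RCell ''A.B'' i j))) Skip) Skip)
       (Assign ''d'' i (slot j) (RNum 0))"

lemma run_load_entry: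
  assumes "\<And>t. ival i (\<eta>(''a'' := t)) = ival i \<eta>" "\<And>t. ival j (\<eta>(''a'' := t)) = ival j \<eta>"
  shows "run (load_entry i j) \<eta> \<mu> =
    upd_cell ''d'' (ival i \<eta>) (\<eta> ''p'' + \<eta> ''r'' + ival j \<eta>)
      (bps_entry \<mu> (\<eta> ''n'') (\<eta> ''r'') (\<eta> ''p'') (\<eta> ''l'') (\<eta> ''m'') (ival i \<eta>) (ival j \<eta>)) \<mu>"
  by (simp add: load_entry_def bps_entry_def run_sum_into assms upd_cell_apply upd_cell_overwrite
      less_Suc_eq_le)

text \<open>A column \<open>j = k0 + (l + m)\<close> created in step \<open>k0\<close> stays active
  through step \<open>j\<close>, when row \<open>j + l\<close> enters; this is the last row loaded.
  The last \<open>l + m + 1\<close> of the loaded rows are those that \<open>tail_col\<close>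
  reads.\<close>

definition load_col :: "iexp \<Rightarrow> iexp \<Rightarrow> prog" where
  "load_col j k0 = For ''e'' (IAdd (IAdd (IVar ''l'') Lx) (INum 1)) (load_entry (IAdd k0 (IVar ''e'')) j)"

lemma run_load_col:
  assumes j: "\<And>t. ival j (\<eta>(''e'' := t)) = J" "\<And>t t'. ival j (\<eta>(''e'' := t, ''a'' := t')) = J"
    and k: "\<And>t. ival k0 (\<eta>(''e'' := t)) = K" "\<And>t t'. ival k0 (\<eta>(''e'' := t, ''a'' := t')) = K"
  shows "run (load_col j k0) \<eta> \<mu> =
    upd_region ''d'' (\<lambda>i c. K \<le> i \<and> i \<le> K + (\<eta> ''l'' + (\<eta> ''l'' + \<eta> ''m'')) \<and> c = \<eta> ''p'' + \<eta> ''r'' + J)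
      (\<lambda>i c. bps_entry \<mu> (\<eta> ''n'') (\<eta> ''r'') (\<eta> ''p'') (\<eta> ''l'') (\<eta> ''m'') i J) \<mu>"
proof -
  let ?q = "\<eta> ''p'' + \<eta> ''r'' + J"
  have ex: "(\<exists>t<Suc N. i = K + t \<and> c = ?q) \<longleftrightarrow> K \<le> i \<and> i \<le> K + N \<and> c = ?q" for i c N
    by (auto intro!: exI[of _ "i - K"])
  show ?thesis
    unfolding load_col_def
  proof (rule run_For_region[where D = "\<lambda>t i c. i = K + t \<and> c = ?q"])
    fix t \<nu> assume \<nu>: "\<And>Y. Y \<noteq> ''d'' \<Longrightarrow> \<nu> Y = \<mu> Y"
    have "bps_entry \<nu> = bps_entry \<mu>" by (intro ext) (simp add: bps_entry_def \<nu>)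
    then show "run (load_entry (IAdd k0 (IVar ''e'')) j) (\<eta>(''e'' := t)) \<nu> =
      upd_region ''d'' (\<lambda>i c. i = K + t \<and> c = ?q)
       (\<lambda>i c. bps_entry \<mu> (\<eta> ''n'') (\<eta> ''r'') (\<eta> ''p'') (\<eta> ''l'') (\<eta> ''m'') i J) \<nu>"
      by (subst run_load_entry) (auto simp: j k intro!: upd_cell_eq_upd_region)
  qed (use ex in auto)
qed

definition tail_col :: "iexp \<Rightarrow> iexp \<Rightarrow> prog" where
  "tail_col j k0 = For ''a'' (IVar ''r'')
     (sum_into ''T'' (IVar ''a'') (slot j) ''e'' (IAdd Lx (INum 1)) (RNum 0)
       (RMul (RCell ''u'' (IAdd (IAdd k0 (IVar ''l'')) (IVar ''e'')) (IVar ''a''))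
         (RCell ''d'' (IAdd (IAdd k0 (IVar ''l'')) (IVar ''e'')) (slot j))) ;;
      sum_into ''T'' (IVar ''a'') (slot j) ''b'' (IVar ''r'') (RCell ''T'' (IVar ''a'') (slot j))
       (RMul (RCell ''G2'' (IVar ''a'') (IVar ''b'')) (RCell ''A.V'' j (IVar ''b''))))"

lemma run_tail_col:
  assumes j: "\<And>t. ival j (\<eta>(''a'' := t)) = J" "\<And>t t'. ival j (\<eta>(''a'' := t, ''e'' := t')) = J"
      "\<And>t t'. ival j (\<eta>(''a'' := t, ''b'' := t')) = J"
    and k: "\<And>t t'. ival k0 (\<eta>(''a'' := t, ''e'' := t')) = K"
  shows "run (tail_col j k0) \<eta> \<mu> =
    upd_region ''T'' (\<lambda>i c. i < \<eta> ''r'' \<and> c = \<eta> ''p'' + \<eta> ''r'' + J)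
      (\<lambda>a c. (\<Sum>e<Suc (\<eta> ''l'' + \<eta> ''m''). \<mu> ''u'' (K + \<eta> ''l'' + e) a * \<mu> ''d'' (K + \<eta> ''l'' + e) c) +
        (\<Sum>b<\<eta> ''r''. \<mu> ''G2'' a b * \<mu> ''A.V'' J b)) \<mu>"
  unfolding tail_col_def
  by (rule run_For_region[where D = "\<lambda>t i c. i = t \<and> c = \<eta> ''p'' + \<eta> ''r'' + J"])
    (auto simp: run_sum_into j k upd_cell_apply upd_cell_overwrite simp del: sum.lessThan_Suc
      intro!: upd_cell_eq_upd_region)

text \<open>The columns \<open>j < l + m\<close> have no earlier step in which they could be
  created. Before any reflection the state is the column itself with zero \<open>acc\<close>, so
  they are set up without coordinates.\<close>

definition first_col :: prog where
  "first_col =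
     load_col (IVar ''c'') (INum 0) ;; tail_col (IVar ''c'') (INum 0) ;;
     For ''i'' (IVar ''l'') (Assign ''X'' (IVar ''i'') (slot (IVar ''c''))
       (RCell ''d'' (IVar ''i'') (slot (IVar ''c'')))) ;;
     For ''a'' (IVar ''r'') (Assign ''P'' (IVar ''a'') (slot (IVar ''c'')) (RNum 0))"

definition first_cols :: prog where
  "first_cols = For ''c'' Lx first_col"

definition coords_S :: prog where
  "coords_S = For ''c'' (IVar ''p'') (Assign ''R.S'' kL (IVar ''c'')
       (RCell ''A.S'' kL (IVar ''c'')))"

text \<open>Program form of \<open>far_coord_total\<close>: the slot of the entering column holds
  its own tail, the slots \<open>c < p\<close> hold the tails of the formal columns.\<close>

definition coords_total :: prog where
  "coords_total = For ''b'' (IVar ''r'') (sum_into ''R.S'' kL (IAdd (IVar ''p'') (IVar ''b''))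
       ''c'' (IVar ''p'') (RCell ''T'' (IVar ''b'') (slot kL))
       (RSub (RNum 0) (RMul (RCell ''T'' (IVar ''b'') (IVar ''c''))
         (RCell ''A.S'' kL (IVar ''c'')))))"

definition coords :: prog where
  "coords = coords_S ;; coords_total"

lemma run_coords:
  fixes \<eta> \<mu>
  defines "j \<equiv> \<eta> ''k'' + (\<eta> ''l'' + \<eta> ''m'')"
  shows "run coords \<eta> \<mu> =
    upd_region ''R.S'' (\<lambda>i c. i = j \<and> c < \<eta> ''p'' + \<eta> ''r'')
      (\<lambda>i c. if c < \<eta> ''p'' then \<mu> ''A.S'' j c else \<mu> ''T'' (c - \<eta> ''p'') (\<eta> ''p'' + \<eta> ''r'' + j) -
        (\<Sum>c'<\<eta> ''p''. \<mu> ''T'' (c - \<eta> ''p'') c' * \<mu> ''A.S'' j c')) \<mu>"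
proof -
  have 1: "run coords_S \<eta> \<mu> =
    upd_region ''R.S'' (\<lambda>i c. i = j \<and> c < \<eta> ''p'') (\<lambda>i c. \<mu> ''A.S'' j c) \<mu>" for \<mu>
    unfolding coords_S_def
    by (rule run_For_region[where D = "\<lambda>t i c. i = j \<and> c = t"])
      (auto simp: j_def intro!: upd_cell_eq_upd_region)
  have ex: "(\<exists>t<r. i = j \<and> c = p + t) \<longleftrightarrow> i = j \<and> p \<le> c \<and> c < p + r" for i c p r :: nat
    by (auto intro!: exI[of _ "c - p"])
  have 2: "run coords_total \<eta> \<mu> =
    upd_region ''R.S'' (\<lambda>i c. i = j \<and> \<eta> ''p'' \<le> c \<and> c < \<eta> ''p'' + \<eta> ''r'')
      (\<lambda>i c. \<mu> ''T'' (c - \<eta> ''p'') (\<eta> ''p'' + \<eta> ''r'' + j) -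
        (\<Sum>c'<\<eta> ''p''. \<mu> ''T'' (c - \<eta> ''p'') c' * \<mu> ''A.S'' j c')) \<mu>" for \<mu>
    unfolding coords_total_def
    by (rule run_For_region[where D = "\<lambda>t i c. i = j \<and> c = \<eta> ''p'' + t"])
      (auto simp: run_sum_into upd_cell_apply sum_negf ex j_def[symmetric] intro!: upd_cell_eq_upd_region)
  show ?thesis
    unfolding coords_def run.simps(3) 1 2
    by (auto simp: upd_region_def fun_eq_iff)
qed

definition combine_rows :: prog where
  "combine_rows = For ''e'' (IVar ''l'') (sum_into ''X'' ke (slot kL)
       ''c'' qx (RNum 0) (RMul (RCell ''R.S'' kL (IVar ''c''))
         (RCell ''X'' ke (IVar ''c''))))"

definition combine_acc :: prog where
  "combine_acc = For ''a'' (IVar ''r'') (sum_into ''P'' (IVar ''a'') (slot kL)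
       ''c'' qx (RNum 0) (RMul (RCell ''R.S'' kL (IVar ''c''))
         (RCell ''P'' (IVar ''a'') (IVar ''c''))))"

definition combine_col :: prog where
  "combine_col = combine_rows ;; combine_acc"

lemma run_combine_col:
  fixes \<eta> \<mu>
  defines "j \<equiv> \<eta> ''k'' + (\<eta> ''l'' + \<eta> ''m'')" and "q \<equiv> \<eta> ''p'' + \<eta> ''r''"
  shows "run combine_col \<eta> \<mu> =
    upd_region ''P'' (\<lambda>i c. i < \<eta> ''r'' \<and> c = q + j) (\<lambda>i c. \<Sum>c<q. \<mu> ''R.S'' j c * \<mu> ''P'' i c)
    (upd_region ''X'' (\<lambda>i c. \<eta> ''k'' \<le> i \<and> i < \<eta> ''k'' + \<eta> ''l'' \<and> c = q + j)
      (\<lambda>i c. \<Sum>c<q. \<mu> ''R.S'' j c * \<mu> ''X'' i c) \<mu>)"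
proof -
  have ex: "(\<exists>t<l. i = k + t \<and> c = q + j) \<longleftrightarrow> k \<le> i \<and> i < k + l \<and> c = q + j" for i c k l :: nat
    by (auto intro!: exI[of _ "i - k"])
  have 1: "run combine_rows \<eta> \<mu> =
    upd_region ''X'' (\<lambda>i c. \<eta> ''k'' \<le> i \<and> i < \<eta> ''k'' + \<eta> ''l'' \<and> c = q + j)
      (\<lambda>i c. \<Sum>c<q. \<mu> ''R.S'' j c * \<mu> ''X'' i c) \<mu>"
    unfolding combine_rows_def q_def j_def
    by (rule run_For_region_sequential[where D = "\<lambda>t i c. i = \<eta> ''k'' + t \<and> c = \<eta> ''p'' + \<eta> ''r'' + (\<eta> ''k'' + (\<eta> ''l'' + \<eta> ''m''))"], subst run_sum_into)
      (auto simp: upd_cell_apply ex[unfolded q_def j_def] intro!: upd_cell_eq_upd_region sum.cong)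
  have 2: "run combine_acc \<eta> \<mu>' =
    upd_region ''P'' (\<lambda>i c. i < \<eta> ''r'' \<and> c = q + j) (\<lambda>i c. \<Sum>c<q. \<mu>' ''R.S'' j c * \<mu>' ''P'' i c) \<mu>'" for \<mu>'
    unfolding combine_acc_def q_def j_def
    by (rule run_For_region_sequential[where D = "\<lambda>t i c. i = t \<and> c = \<eta> ''p'' + \<eta> ''r'' + (\<eta> ''k'' + (\<eta> ''l'' + \<eta> ''m''))"], subst run_sum_into)
      (auto simp: upd_cell_apply intro!: upd_cell_eq_upd_region sum.cong)
  show ?thesis
    unfolding combine_col_def run.simps(3) 1 2 by (simp add: upd_region_other)
qed

definition new_col :: prog where
  "new_col = load_col kL (IVar ''k'') ;; tail_col kL (IVar ''k'') ;;
     coords ;; combine_col"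

section \<open>Constructing the pivot reflector\<close>

definition pivot_sign :: prog where
  "pivot_sign =
     IfPos (RCell ''y'' (INum 0) (INum 0))
       (Assign ''y'' (INum 0) (INum 0)
         (RAdd (RCell ''y'' (INum 0) (INum 0)) (RSqrt (RCell ''s'' (INum 0) (INum 0)))))
       (IfPos (RCell ''s'' (INum 0) (INum 0))
         (Assign ''y'' (INum 0) (INum 0)
           (RSub (RCell ''y'' (INum 0) (INum 0)) (RSqrt (RCell ''s'' (INum 0) (INum 0)))))
         (Assign ''y'' (INum 0) (INum 0) (RNum 1)))"

definition pivot_V :: prog where
  "pivot_V = For ''a'' (IVar ''r'') (Assign ''Y.V'' (IVar ''k'') (IVar ''a'')
       (RSub (RCell ''A.V'' (IVar ''k'') (IVar ''a'')) (RCell ''P'' (IVar ''a'') (slot (IVar ''k'')))))"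

definition pivot_rows :: prog where
  "pivot_rows = For ''e'' (IAdd (IVar ''l'') (INum 1)) (Assign ''y'' (IVar ''e'') (INum 0)
       (RCell ''X'' ke (slot (IVar ''k''))))"

definition pivot_col :: prog where
  "pivot_col = pivot_V ;; pivot_rows"

lemma run_pivot_col:
  "run pivot_col \<eta> \<mu> = upd_region ''y'' (\<lambda>i j. i \<le> \<eta> ''l'' \<and> j = 0)
      (\<lambda>e j. \<mu> ''X'' (\<eta> ''k'' + e) (\<eta> ''p'' + \<eta> ''r'' + \<eta> ''k''))
    (upd_region ''Y.V'' (\<lambda>i j. i = \<eta> ''k'' \<and> j < \<eta> ''r'')
      (\<lambda>i a. \<mu> ''A.V'' i a - \<mu> ''P'' a (\<eta> ''p'' + \<eta> ''r'' + i)) \<mu>)"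
proof -
  have 1: "run pivot_V \<eta> \<mu> =
    upd_region ''Y.V'' (\<lambda>i j. i = \<eta> ''k'' \<and> j < \<eta> ''r'')
      (\<lambda>i a. \<mu> ''A.V'' i a - \<mu> ''P'' a (\<eta> ''p'' + \<eta> ''r'' + i)) \<mu>"
    unfolding pivot_V_def
    by (rule run_For_region[where D = "\<lambda>t i j. i = \<eta> ''k'' \<and> j = t"])
      (auto intro!: upd_cell_eq_upd_region)
  have 2: "run pivot_rows \<eta> \<mu>' =
    upd_region ''y'' (\<lambda>i j. i \<le> \<eta> ''l'' \<and> j = 0)
      (\<lambda>e j. \<mu>' ''X'' (\<eta> ''k'' + e) (\<eta> ''p'' + \<eta> ''r'' + \<eta> ''k'')) \<mu>'" for \<mu>'
    unfolding pivot_rows_def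
    by (rule run_For_region[where D = "\<lambda>t i j. i = t \<and> j = 0"])
      (auto intro!: upd_cell_eq_upd_region)
  show ?thesis
    unfolding pivot_col_def run.simps(3) 1 2 by (simp add: upd_region_other)
qed

text \<open>Below the diagonal the product \<open>U i \<bullet> v k\<close> is subtracted, since it
  is added again when band and semiseparable part are combined; on the diagonal that part is
  absent.\<close>

definition store_reflector :: prog where
  "store_reflector =
     For ''e'' (IAdd (IVar ''l'') (INum 1)) (IfLess (INum 0) (IVar ''e'')
       (sum_into ''Y.B'' ke (IVar ''k'') ''a'' (IVar ''r'')
         (RCell ''y'' (IVar ''e'') (INum 0))
         (RSub (RNum 0) (RMul (RCell ''u'' ke (IVar ''a''))
           (RCell ''Y.V'' (IVar ''k'') (IVar ''a'')))))
       (Assign ''Y.B'' ke (IVar ''k'') (RCell ''y'' (IVar ''e'') (INum 0))))"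

lemma run_store_reflector:
  "run store_reflector \<eta> \<mu> =
    upd_region ''Y.B'' (\<lambda>i j. \<eta> ''k'' \<le> i \<and> i \<le> \<eta> ''k'' + \<eta> ''l'' \<and> j = \<eta> ''k'')
     (\<lambda>i j. \<mu> ''y'' (i - \<eta> ''k'') 0 -
       (if \<eta> ''k'' < i then \<Sum>a<\<eta> ''r''. \<mu> ''u'' i a * \<mu> ''Y.V'' (\<eta> ''k'') a else 0)) \<mu>"
proof -
  have ex: "(\<exists>t<Suc l. i = k + t \<and> j = k) \<longleftrightarrow> k \<le> i \<and> i \<le> k + l \<and> j = k" for i j k l :: nat
    by (auto intro!: exI[of _ "i - k"])
  show ?thesis
    unfolding store_reflector_def
    by (rule run_For_region[where D = "\<lambda>t i j. i = \<eta> ''k'' + t \<and> j = \<eta> ''k''"])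
      (auto simp: run_sum_into upd_cell_apply sum_negf ex intro!: upd_cell_eq_upd_region)
qed

text \<open>The squared norm is computed twice: of the pivot column, to fix the new pivot, and of
  the resulting vector, for \<open>beta\<close>. One \<open>h\<close> serves both because only row
  \<open>k\<close> changes in between.\<close>

definition make_pivot :: prog where
  "make_pivot = pivot_col ;; load_h ;; norm_sq ;; pivot_sign ;; norm_sq ;; store_reflector"

text \<open>The new column is created before row \<open>k + l\<close> enters, so all active slots
  pass through the step at the same stage. Slots for columns \<open>k\<close> to
  \<open>k + l + m\<close> hold those that are neither finished nor still represented by
  coordinates.\<close>

definition factor_step :: prog where
  "factor_step =
     new_col ;;
     gram_down ''G2'' (IAdd (IAdd kl Lx) (INum 1)) ;;
     For ''c'' qx (enter_row (IVar ''c'')) ;;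
     For ''c'' (IAdd Lx (INum 1)) (enter_row (slot (IAdd (IVar ''k'') (IVar ''c'')))) ;;
     gram_down ''G'' kl ;;
     make_pivot ;;
     For ''c'' qx (reflect (IVar ''c'')) ;;
     For ''c'' (IAdd Lx (INum 1)) (reflect (slot (IAdd (IVar ''k'') (IVar ''c''))))"

section \<open>Initialization and output\<close>

definition zero_data :: prog where
  "zero_data = For ''i'' (IAdd (IVar ''n'') (IVar ''l'')) (For ''b'' (IVar ''r'')
       (Assign ''d'' (IVar ''i'') (IAdd (IVar ''p'') (IVar ''b'')) (RNum 0)))"

definition feature_rows :: prog where
  "feature_rows = For ''i'' (IVar ''l'') (For ''c'' qx
       (Assign ''X'' (IVar ''i'') (IVar ''c'') (RCell ''d'' (IVar ''i'') (IVar ''c''))))"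

definition feature_acc :: prog where
  "feature_acc = For ''a'' (IVar ''r'') (For ''c'' qx (Assign ''P'' (IVar ''a'') (IVar ''c'') (RNum 0)))"

definition feature_tail :: prog where
  "feature_tail = For ''a'' (IVar ''r'') (For ''c'' qx
       (IfLess (IVar ''c'') (IAdd (IVar ''p'') (IVar ''a''))
          (Assign ''T'' (IVar ''a'') (IVar ''c'') (RNum 0))
          (IfLess (IAdd (IVar ''p'') (IVar ''a'')) (IVar ''c'')
            (Assign ''T'' (IVar ''a'') (IVar ''c'') (RNum 0))
            (Assign ''T'' (IVar ''a'') (IVar ''c'') (RNum 1))) ;;
        sum_into ''T'' (IVar ''a'') (IVar ''c'') ''i'' (IVar ''l'') (RCell ''T'' (IVar ''a'') (IVar ''c''))
          (RSub (RNum 0) (RMul (RCell ''u'' (IVar ''i'') (IVar ''a'')) (RCell ''d'' (IVar ''i'') (IVar ''c''))))))"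

definition init_features :: prog where
  "init_features = pad_copy ''d'' ''A.W'' (IAdd (IVar ''n'') (IVar ''l'')) (IVar ''p'') ;; zero_data ;; feature_rows ;; feature_acc ;; feature_tail"

text \<open>The initial sum for \<open>G2\<close> shifts the row index by
  \<open>l + (l + m) + 1\<close>, which dictates the padding of \<open>u\<close>.\<close>

definition factor_init :: prog where
  "factor_init =
     pad_copy ''u'' ''A.U'' (IAdd (IVar ''n'') (IAdd (IVar ''l'') (IAdd Lx (INum 1)))) (IVar ''r'') ;;
     pad_copy ''Y.U'' ''A.U'' (IVar ''n'') (IVar ''r'') ;;
     gram_init ''G'' (IVar ''l'') ;;
     gram_init ''G2'' (IAdd (IVar ''l'') (IAdd Lx (INum 1))) ;;
     init_features ;;
     first_cols"

definition store_W_row :: prog where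
  "store_W_row = For ''c'' qx
     (Assign ''R.W'' (IVar ''i'') (IVar ''c'') (RCell ''X'' (IVar ''i'') (IVar ''c'')))"

text \<open>Subtracting the product of the other generators makes band plus semiseparable part
  correct whatever \<open>R.S\<close> contains. This matters for columns \<open>j < l + m\<close>,
  for which no coordinates are computed.\<close>

definition store_B_row :: prog where
  "store_B_row = For ''e'' (IAdd Lx (INum 1)) (IfLess (INum 0) (IVar ''e'')
     (sum_into ''R.B'' (IVar ''i'') (IAdd (IVar ''i'') (IVar ''e'')) ''c'' qx
       (RCell ''X'' (IVar ''i'') (slot (IAdd (IVar ''i'') (IVar ''e''))))
       (RSub (RNum 0) (RMul (RCell ''R.W'' (IVar ''i'') (IVar ''c''))
         (RCell ''R.S'' (IAdd (IVar ''i'') (IVar ''e'')) (IVar ''c'')))))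
     (Assign ''R.B'' (IVar ''i'') (IAdd (IVar ''i'') (IVar ''e''))
       (RCell ''X'' (IVar ''i'') (slot (IAdd (IVar ''i'') (IVar ''e''))))))"

definition store_R :: prog where
  "store_R = For ''i'' (IVar ''n'') store_W_row ;; For ''i'' (IVar ''n'') store_B_row"

definition factor_prog :: prog where
  "factor_prog = factor_init ;; For ''k'' (IVar ''n'') factor_step ;; store_R"

lemmas factor_defs = program_defs load_entry_def load_col_def tail_col_def first_cols_def first_col_def coords_def
  combine_col_def new_col_def pivot_sign_def pivot_col_def store_reflector_def make_pivot_def
  factor_step_def init_features_def factor_init_def store_R_def factor_prog_def
  coords_S_def coords_total_def combine_rows_def combine_acc_def pivot_V_def
  pivot_rows_def zero_data_def feature_rows_def feature_acc_def feature_tail_def store_W_row_def store_B_row_def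

lemma run_store_R:
  fixes \<eta> \<mu>
  defines "q \<equiv> \<eta> ''p'' + \<eta> ''r''" and "L \<equiv> \<eta> ''l'' + \<eta> ''m''"
  shows "run store_R \<eta> \<mu> =
    upd_region ''R.B'' (\<lambda>i j. i < \<eta> ''n'' \<and> i \<le> j \<and> j \<le> i + L)
      (\<lambda>i j. \<mu> ''X'' i (q + j) - (if i < j then \<Sum>c<q. \<mu> ''X'' i c * \<mu> ''R.S'' j c else 0))
    (upd_region ''R.W'' (\<lambda>i c. i < \<eta> ''n'' \<and> c < q) (\<lambda>i c. \<mu> ''X'' i c) \<mu>)"
proof -
  have 1: "run store_W_row (\<eta>(''i'' := t)) \<nu> =
     upd_region ''R.W'' (\<lambda>i c. i = t \<and> c < q) (\<lambda>i c. \<mu> ''X'' i c) \<nu>"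
    if "\<And>Y. Y \<noteq> ''R.W'' \<Longrightarrow> \<nu> Y = \<mu> Y" for t \<nu>
    unfolding store_W_row_def
    by (rule run_For_region[where D = "\<lambda>s i c. i = t \<and> c = s"])
      (auto simp: that q_def intro!: upd_cell_eq_upd_region)
  have 2: "run (For ''i'' (IVar ''n'') store_W_row) \<eta> \<mu> =
     upd_region ''R.W'' (\<lambda>i c. i < \<eta> ''n'' \<and> c < q) (\<lambda>i c. \<mu> ''X'' i c) \<mu>" (is "_ = ?\<mu>1")
    by (rule run_For_region[where D = "\<lambda>s i c. i = s \<and> c < q"]) (simp_all add: 1 del: run.simps)
  let ?f = "\<lambda>i j. \<mu> ''X'' i (q + j) - (if i < j then \<Sum>c<q. \<mu> ''X'' i c * \<mu> ''R.S'' j c else 0)"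
  have ex: "(\<exists>s<Suc L. i = t \<and> j = t + s) \<longleftrightarrow> i = t \<and> t \<le> j \<and> j \<le> t + L" for i j t
    by (auto intro!: exI[of _ "j - t"])
  have 3: "run store_B_row (\<eta>(''i'' := t)) \<nu> =
     upd_region ''R.B'' (\<lambda>i j. i = t \<and> t \<le> j \<and> j \<le> t + L) ?f \<nu>"
    if "\<And>Y. Y \<noteq> ''R.B'' \<Longrightarrow> \<nu> Y = ?\<mu>1 Y" "t < \<eta> ''n''" for t \<nu>
    unfolding store_B_row_def
    by (rule run_For_region[where D = "\<lambda>s i j. i = t \<and> j = t + s"])
      (use that(2) in \<open>auto simp: that(1) run_sum_into upd_cell_apply upd_region_apply sum_negf ex
        q_def[symmetric] L_def[symmetric] intro!: upd_cell_eq_upd_region\<close>)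
  show ?thesis
    unfolding store_R_def run.simps(3) 2
  proof (rule run_For_region[where D = "\<lambda>s i j. i = s \<and> s \<le> j \<and> j \<le> s + L"], goal_cases)
    case (1 t \<nu>)
    then show ?case by (intro 3) auto
  qed auto
qed


section \<open>Correctness of the factorization\<close>

context reflections
begin

text \<open>Towards the end slots of columns beyond \<open>n\<close> are processed as well, with
  arbitrary content; \<open>good\<close> marks the meaningful ones. Instantiated with the false
  predicate, the second claim becomes a frame rule without obligations on states.\<close>

lemma enter_columns:
  assumes env: "\<eta> ''k'' = k" "\<eta> ''l'' = l" "\<eta> ''r'' = r" and k: "k < n"
    and s: "\<And>t. ival s (\<eta>(''c'' := t)) = base + t" "\<And>t t'. ival s (\<eta>(''c'' := t, ''a'' := t')) = base + t"
    and u: "\<And>a. a < r \<Longrightarrow> \<mu> ''u'' (k + l) a = U (k + l) a"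
    and st: "\<And>t. t < ival N \<eta> \<Longrightarrow> good t \<Longrightarrow> stored \<mu> (base + t) (lo t) k (d t) (\<tau> t)"
    and d: "\<And>t. t < ival N \<eta> \<Longrightarrow> good t \<Longrightarrow> \<mu> ''d'' (k + l) (base + t) = d t (k + l)"
  shows "t < ival N \<eta> \<Longrightarrow> good t \<Longrightarrow>
      extended (run (For ''c'' N (enter_row s)) \<eta> \<mu>) (base + t) (lo t) k (d t) (\<tau> t)" (is "PROP ?A")
    and "c < base \<or> base + ival N \<eta> \<le> c \<Longrightarrow> run (For ''c'' N (enter_row s)) \<eta> \<mu> Z i c = \<mu> Z i c" (is "PROP ?B")
proof -
  let ?inv = "\<lambda>i \<nu>. (\<forall>t<i. good t \<longrightarrow> extended \<nu> (base + t) (lo t) k (d t) (\<tau> t)) \<and>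
    (\<forall>Z j c. c < base \<or> base + i \<le> c \<longrightarrow> \<nu> Z j c = \<mu> Z j c) \<and>
    (\<forall>Z. Z \<notin> {''X'', ''T''} \<longrightarrow> \<nu> Z = \<mu> Z)"
  have "?inv (ival N \<eta>) (run (For ''c'' N (enter_row s)) \<eta> \<mu>)"
  proof (rule run_For_invariant[where I = ?inv])
    fix i \<nu> assume i: "i < ival N \<eta>" and I: "?inv i \<nu>"
    let ?\<nu> = "run (enter_row s) (\<eta>(''c'' := i)) \<nu>"
    have s': "ival s ((\<eta>(''c'' := i))(''a'' := t)) = ival s (\<eta>(''c'' := i))" for t by (simp add: s)
    have other: "?\<nu> Z j c = \<nu> Z j c" if "c \<noteq> base + i" for Z j c
      using that by (intro enter_row_other s') (simp add: s)
    have frame: "?\<nu> Z = \<mu> Z" if "Z \<notin> {''X'', ''T''}" for Z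
    proof -
      have "?\<nu> Z = \<nu> Z" using that by (intro run_unwritten) (simp add: enter_row_def sum_into_def)
      then show ?thesis using I that by simp
    qed
    have "extended ?\<nu> (base + t) (lo t) k (d t) (\<tau> t)" if "t < Suc i" "good t" for t
    proof (cases "t = i")
      case True
      have st': "stored \<nu> (base + i) (lo i) k (d i) (\<tau> i)"
        by (rule stored_cong[OF st[OF i]]) (use that True I in auto)
      have "\<nu> ''u'' = \<mu> ''u''" "\<nu> ''d'' = \<mu> ''d''" using I by simp_all
      then have ud: "\<And>a. a < r \<Longrightarrow> \<nu> ''u'' (k + l) a = U (k + l) a"
        "\<nu> ''d'' (k + l) (base + i) = d i (k + l)"
        using u d[OF i] that(2) True by simp_all
      have env': "(\<eta>(''c'' := i)) ''k'' = k" "(\<eta>(''c'' := i)) ''l'' = l" "(\<eta>(''c'' := i)) ''r'' = r"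
        by (simp_all add: env)
      show ?thesis
        unfolding \<open>t = i\<close> by (rule enter_row_correct[OF s' s(1) env' k st' ud])
    next
      case False
      then have "t < i" using that by simp
      then have "extended \<nu> (base + t) (lo t) k (d t) (\<tau> t)"
        using I that by blast
      then show ?thesis
        by (rule extended_cong) (rule other, use False in simp)
    qed
    moreover have "?\<nu> Z j c = \<mu> Z j c" if "c < base \<or> base + Suc i \<le> c" for Z j c
    proof -
      have "c \<noteq> base + i" "c < base \<or> base + i \<le> c" using that by auto
      moreover from this(2) have "\<nu> Z j c = \<mu> Z j c" using I that by blast
      ultimately show ?thesis using other that by simp
    qed
    ultimately show "?inv (Suc i) ?\<nu>" using frame by blast
  qed auto
  then show "PROP ?A" and "PROP ?B"
    by blast+
qed

lemma reflector_loaded_cong: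
  "reflector_loaded \<mu> k \<Longrightarrow> (\<And>Z. Z \<in> {''y'', ''Y.V'', ''h'', ''s''} \<Longrightarrow> \<nu> Z = \<mu> Z) \<Longrightarrow>
    reflector_loaded \<nu> k"
  by (simp add: reflector_loaded_def)

lemma reflect_columns:
  assumes env: "\<eta> ''k'' = k" "\<eta> ''l'' = l" "\<eta> ''r'' = r"
    and s: "\<And>t. ival s (\<eta>(''c'' := t)) = base + t" "\<And>t t'. ival s (\<eta>(''c'' := t, ''a'' := t')) = base + t"
      "\<And>t t'. ival s (\<eta>(''c'' := t, ''e'' := t')) = base + t"
    and refl: "reflector_loaded \<mu> k"
    and ext: "\<And>t. t < ival N \<eta> \<Longrightarrow> good t \<Longrightarrow> extended \<mu> (base + t) (lo t) k (d t) (\<tau> t)"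
    and lo: "\<And>t. t < ival N \<eta> \<Longrightarrow> good t \<Longrightarrow> lo t \<le> k"
  shows "t < ival N \<eta> \<Longrightarrow> good t \<Longrightarrow>
      stored (run (For ''c'' N (reflect s)) \<eta> \<mu>) (base + t) (lo t) (Suc k) (d t) (\<tau> t)" (is "PROP ?A")
    and "c < base \<or> base + ival N \<eta> \<le> c \<Longrightarrow> Z \<noteq> ''w'' \<Longrightarrow>
      run (For ''c'' N (reflect s)) \<eta> \<mu> Z i c = \<mu> Z i c" (is "PROP ?B")
proof -
  let ?inv = "\<lambda>i \<nu>. (\<forall>t<i. good t \<longrightarrow> stored \<nu> (base + t) (lo t) (Suc k) (d t) (\<tau> t)) \<and>
    (\<forall>Z j c. (c < base \<or> base + i \<le> c) \<and> Z \<noteq> ''w'' \<longrightarrow> \<nu> Z j c = \<mu> Z j c) \<and>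
    (\<forall>Z. Z \<notin> {''X'', ''P'', ''w''} \<longrightarrow> \<nu> Z = \<mu> Z)"
  have "?inv (ival N \<eta>) (run (For ''c'' N (reflect s)) \<eta> \<mu>)"
  proof (rule run_For_invariant[where I = ?inv])
    fix i \<nu> assume i: "i < ival N \<eta>" and I: "?inv i \<nu>"
    let ?\<nu> = "run (reflect s) (\<eta>(''c'' := i)) \<nu>"
    have s': "ival s ((\<eta>(''c'' := i))(''a'' := t)) = ival s (\<eta>(''c'' := i))"
      "ival s ((\<eta>(''c'' := i))(''e'' := t)) = ival s (\<eta>(''c'' := i))" for t by (simp_all add: s)
    have other: "?\<nu> Z j c = \<nu> Z j c" if "c \<noteq> base + i" "Z \<noteq> ''w''" for Z j c
      using that by (intro reflect_other s') (simp_all add: s)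
    have frame: "?\<nu> Z = \<mu> Z" if "Z \<notin> {''X'', ''P'', ''w''}" for Z
    proof -
      have "?\<nu> Z = \<nu> Z" using that by (intro run_unwritten) (simp add: program_defs)
      then show ?thesis using I that by simp
    qed
    have "stored ?\<nu> (base + t) (lo t) (Suc k) (d t) (\<tau> t)" if "t < Suc i" "good t" for t
    proof (cases "t = i")
      case True
      have ext': "extended \<nu> (base + i) (lo i) k (d i) (\<tau> i)"
        by (rule extended_cong[OF ext[OF i]]) (use that True I in auto)
      have refl': "reflector_loaded \<nu> k"
        by (rule reflector_loaded_cong[OF refl]) (use I in auto)
      have "lo i \<le> k" using lo i that True by simp
      then show ?thesis
        unfolding True by (intro reflect_correct[OF s' _ _ _ _ ext' _ refl']) (simp_all add: env s(1))
    next
      case False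
      then have "t < i" using that by simp
      then have "stored \<nu> (base + t) (lo t) (Suc k) (d t) (\<tau> t)"
        using I that by blast
      then show ?thesis
        by (rule stored_cong) (rule other, use False in auto)
    qed
    moreover have "?\<nu> Z j c = \<mu> Z j c" if "c < base \<or> base + Suc i \<le> c" "Z \<noteq> ''w''" for Z j c
    proof -
      have "c \<noteq> base + i" "c < base \<or> base + i \<le> c" using that by auto
      moreover from this(2) have "\<nu> Z j c = \<mu> Z j c" using I that by blast
      ultimately show ?thesis using other that by simp
    qed
    ultimately show "?inv (Suc i) ?\<nu>" using frame by blast
  qed auto
  then show "PROP ?A" and "PROP ?B"
    by blast+
qed

end

section \<open>Invariant and step of the factorization\<close>

context bps_data
begin

definition sized :: "env \<Rightarrow> bool" where
  "sized \<eta> \<longleftrightarrow> \<eta> ''n'' = n \<and> \<eta> ''r'' = r \<and> \<eta> ''p'' = p \<and> \<eta> ''l'' = l \<and> \<eta> ''m'' = m"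

definition inputs :: "memory \<Rightarrow> bool" where
  "inputs \<mu> \<longleftrightarrow> (\<forall>i a. i < n + (l + (l + m + 1)) \<and> a < r \<longrightarrow> \<mu> ''u'' i a = U i a) \<and>
     (\<forall>j<n. \<forall>a<r. \<mu> ''A.V'' j a = V j a) \<and> (\<forall>j<n. \<forall>c<p. \<mu> ''A.S'' j c = S j c) \<and>
     (\<forall>i j. j < n \<longrightarrow> bps_entry \<mu> n r p l m i j = A i j)"

lemma inputs_cong:
  assumes "inputs \<mu>"
    "\<And>Z. Z \<in> {''u'', ''A.B'', ''A.U'', ''A.V'', ''A.W'', ''A.S''} \<Longrightarrow> \<nu> Z = \<mu> Z"
  shows "inputs \<nu>"
proof -
  have "bps_entry \<nu> = bps_entry \<mu>"
    using assms(2) by (intro ext) (simp add: bps_entry_def)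
  with assms show ?thesis by (simp add: inputs_def)
qed

text \<open>The index \<open>min k (Suc j)\<close> records that the slot of column \<open>j\<close>
  is last changed in step \<open>j\<close> and from then on keeps its part of
  \<open>R\<close>.\<close>

definition columns_ok :: "memory \<Rightarrow> nat \<Rightarrow> nat \<Rightarrow> bool" where
  "columns_ok \<mu> k N \<longleftrightarrow>
     (\<forall>c<p + r. stored \<mu> c 0 k (feature_col c) (feature_total c)) \<and>
     (\<forall>j<n. j < N \<longrightarrow>
        stored \<mu> (p + r + j) (j - (l + m)) (min k (Suc j)) (\<lambda>i. A i j) (total j))"

definition data_ok :: "memory \<Rightarrow> nat \<Rightarrow> bool" where
  "data_ok \<mu> N \<longleftrightarrow>
     (\<forall>i<n + l. \<forall>c<p + r. \<mu> ''d'' i c = feature_col c i) \<and>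
     (\<forall>j<n. j < N \<longrightarrow> (\<forall>i. j - (l + m) \<le> i \<and> i \<le> j - (l + m) + (l + (l + m)) \<longrightarrow>
        \<mu> ''d'' i (p + r + j) = A i j))"

definition coords_ok :: "memory \<Rightarrow> nat \<Rightarrow> bool" where
  "coords_ok \<mu> N \<longleftrightarrow> (\<forall>j<n. l + m \<le> j \<and> j < N \<longrightarrow> (\<forall>c<p + r. \<mu> ''R.S'' j c = coord j c))"

lemma tail_column: "tail (\<lambda>i. A i j) (total j) k a = (\<Sum>i\<in>{k + l..<n}. U i a * A i j)"
  using sum_prefix_split[of n "\<lambda>i. U i a * A i j" "k + l"]
  by (simp add: tail_def total_def A_zero)

lemma tail_col_value:
  assumes "inputs \<mu>" "\<And>a b. a < r \<Longrightarrow> b < r \<Longrightarrow> \<mu> ''G2'' a b = gram (Suc (k + l + (l + m))) a b"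
    and "j < n" "j \<le> k + (l + m)" "k < n" "a < r"
    and "\<And>i. k + l \<le> i \<Longrightarrow> i \<le> k + (l + (l + m)) \<Longrightarrow> \<mu> ''d'' i c = A i j"
  shows "(\<Sum>e<Suc (l + m). \<mu> ''u'' (k + l + e) a * \<mu> ''d'' (k + l + e) c) +
      (\<Sum>b<r. \<mu> ''G2'' a b * \<mu> ''A.V'' j b) = tail (\<lambda>i. A i j) (total j) k a"
  unfolding tail_column column_tail[OF assms(3,4)]
  using assms by (intro arg_cong2[where f = "(+)"] sum.cong) (auto simp: inputs_def)

text \<open>The last steps create columns beyond \<open>n\<close>. Claims about the new slot are
  therefore guarded by \<open>j < n\<close>, while all other slots are shown to be
  untouched.\<close>

lemma new_col_correct:
  assumes env: "sized \<eta>" "\<eta> ''k'' = k" and k: "k < n" and inp: "inputs \<mu>"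
    and G: "\<And>a b. a < r \<Longrightarrow> b < r \<Longrightarrow> \<mu> ''G2'' a b = gram (Suc (k + l + (l + m))) a b"
    and col: "columns_ok \<mu> k (k + (l + m))" and dat: "data_ok \<mu> (k + (l + m))"
    and crd: "coords_ok \<mu> (k + (l + m))"
  shows "columns_ok (run new_col \<eta> \<mu>) k (Suc (k + (l + m)))"
    and "data_ok (run new_col \<eta> \<mu>) (Suc (k + (l + m)))"
    and "coords_ok (run new_col \<eta> \<mu>) (Suc (k + (l + m)))"
proof -
  define j where "j = k + (l + m)"
  let ?q = "p + r"
  define \<mu>1 \<mu>2 \<mu>3 \<nu> where "\<mu>1 = run (load_col kL (IVar ''k'')) \<eta> \<mu>"
    and "\<mu>2 = run (tail_col kL (IVar ''k'')) \<eta> \<mu>1" and "\<mu>3 = run coords \<eta> \<mu>2"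
    and "\<nu> = run combine_col \<eta> \<mu>3"
  have e: "\<eta> ''n'' = n" "\<eta> ''r'' = r" "\<eta> ''p'' = p" "\<eta> ''l'' = l" "\<eta> ''m'' = m"
    using env by (auto simp: sized_def)
  have \<mu>1: "\<mu>1 = upd_region ''d'' (\<lambda>i c. k \<le> i \<and> i \<le> k + (l + (l + m)) \<and> c = ?q + j)
      (\<lambda>i c. bps_entry \<mu> n r p l m i j) \<mu>"
    unfolding \<mu>1_def by (subst run_load_col[where J = j and K = k]) (simp_all add: e env j_def)
  have \<mu>2: "\<mu>2 = upd_region ''T'' (\<lambda>i c. i < r \<and> c = ?q + j)
      (\<lambda>a c. (\<Sum>e<Suc (l + m). \<mu>1 ''u'' (k + l + e) a * \<mu>1 ''d'' (k + l + e) c) +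
        (\<Sum>b<r. \<mu>1 ''G2'' a b * \<mu>1 ''A.V'' j b)) \<mu>1"
    unfolding \<mu>2_def by (subst run_tail_col[where J = j and K = k])
      (simp_all add: e env j_def del: sum.lessThan_Suc)
  have \<mu>3: "\<mu>3 = upd_region ''R.S'' (\<lambda>i c. i = j \<and> c < ?q)
      (\<lambda>i c. if c < p then \<mu>2 ''A.S'' j c else \<mu>2 ''T'' (c - p) (?q + j) -
        (\<Sum>c'<p. \<mu>2 ''T'' (c - p) c' * \<mu>2 ''A.S'' j c')) \<mu>2"
    unfolding \<mu>3_def run_coords by (simp add: e env j_def cong: if_cong)
  have \<nu>: "\<nu> = upd_region ''P'' (\<lambda>i c. i < r \<and> c = ?q + j) (\<lambda>i c. \<Sum>c<?q. \<mu>3 ''R.S'' j c * \<mu>3 ''P'' i c)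
    (upd_region ''X'' (\<lambda>i c. k \<le> i \<and> i < k + l \<and> c = ?q + j)
      (\<lambda>i c. \<Sum>c<?q. \<mu>3 ''R.S'' j c * \<mu>3 ''X'' i c) \<mu>3)"
    unfolding \<nu>_def run_combine_col by (simp add: e env j_def)
  have run: "run new_col \<eta> \<mu> = \<nu>"
    by (simp add: new_col_def \<nu>_def \<mu>3_def \<mu>2_def \<mu>1_def)
  have other: "\<nu> Z i c = \<mu> Z i c" if "c \<noteq> ?q + j" "Z \<noteq> ''R.S''" for Z i c
    using that by (simp add: \<nu> \<mu>3 \<mu>2 \<mu>1 upd_region_apply)
  have d1: "\<mu>1 ''d'' i (?q + j) = A i j" if "j < n" "k \<le> i" "i \<le> k + (l + (l + m))" for i
    using that inp by (simp add: \<mu>1 upd_region_apply inputs_def)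
  have inp1: "inputs \<mu>1" by (rule inputs_cong[OF inp]) (auto simp: \<mu>1 upd_region_def)
  have T: "\<mu>2 ''T'' a (?q + j) = tail (\<lambda>i. A i j) (total j) k a" if "j < n" "a < r" for a
  proof -
    have "\<mu>2 ''T'' a (?q + j) = (\<Sum>e<Suc (l + m). \<mu>1 ''u'' (k + l + e) a * \<mu>1 ''d'' (k + l + e) (?q + j)) +
        (\<Sum>b<r. \<mu>1 ''G2'' a b * \<mu>1 ''A.V'' j b)"
      using that by (simp add: \<mu>2 upd_region_apply)
    also have "\<dots> = tail (\<lambda>i. A i j) (total j) k a"
      by (rule tail_col_value[OF inp1])
        (use that k G d1 in \<open>auto simp: j_def \<mu>1 upd_region_other\<close>)
    finally show ?thesis .
  qed
  have feat: "stored \<mu> c 0 k (feature_col c) (feature_total c)" if "c < ?q" for c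
    using col that by (simp add: columns_ok_def)
  have RS: "\<mu>3 ''R.S'' j c = coord j c" if j: "j < n" and c: "c < ?q" for c
  proof (cases "c < p")
    case True
    then show ?thesis using inp1 j c by (simp add: \<mu>3 \<mu>2 upd_region_apply inputs_def coord_def)
  next
    case False
    have "\<mu>2 ''T'' (c - p) c' = tail (feature_col c') (feature_total c') k (c - p)" if "c' < p" for c'
      using feat[of c'] that c False by (simp add: \<mu>2 \<mu>1 upd_region_apply stored_def)
    moreover have "\<mu>2 ''A.S'' j c' = S j c'" if "c' < p" for c'
      using inp1 j that by (simp add: \<mu>2 upd_region_apply inputs_def)
    ultimately show ?thesis
      using False c j far_coord_total[OF j, of k "c - p"] T[OF j, of "c - p"]
      by (simp add: \<mu>3 upd_region_apply coord_def tail_column j_def)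
  qed
  have X3: "\<mu>3 ''X'' = \<mu> ''X''" "\<mu>3 ''P'' = \<mu> ''P''" by (simp_all add: \<mu>3 \<mu>2 \<mu>1 upd_region_other)
  have stj: "stored \<nu> (?q + j) k k (\<lambda>i. A i j) (total j)" if j: "j < n"
    unfolding stored_def
  proof (intro conjI allI impI)
    fix i assume i: "k \<le> i \<and> i < k + l"
    have "\<nu> ''X'' i (?q + j) = (\<Sum>c<?q. coord j c * entry (feature_col c) (feature_total c) k i)"
      using i feat by (simp add: \<nu> upd_region_apply RS j X3 stored_def)
    then show "\<nu> ''X'' i (?q + j) = entry (\<lambda>i. A i j) (total j) k i"
      using far_column_state(1)[OF j, of k i] i k column_state[of k j] by (simp add: j_def)
  next
    fix a assume a: "a < r"
    have "\<nu> ''P'' a (?q + j) = (\<Sum>c<?q. coord j c * acc (feature_col c) (feature_total c) k a)"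
      using a feat by (simp add: \<nu> upd_region_apply RS j X3 stored_def)
    then show "\<nu> ''P'' a (?q + j) = acc (\<lambda>i. A i j) (total j) k a"
      using far_column_state(2)[OF j, of k a] a k column_state[of k j] by (simp add: j_def)
    show "\<nu> ''T'' a (?q + j) = tail (\<lambda>i. A i j) (total j) k a"
      using T[OF j a] by (simp add: \<nu> \<mu>3 upd_region_apply)
  qed
  show "columns_ok (run new_col \<eta> \<mu>) k (Suc (k + (l + m)))"
    unfolding run columns_ok_def j_def[symmetric]
  proof (intro conjI allI impI)
    fix c assume "c < ?q"
    then show "stored \<nu> c 0 k (feature_col c) (feature_total c)"
      by (intro stored_cong[OF feat]) (auto simp: other)
  next
    fix i assume i: "i < n" "i < Suc j"
    show "stored \<nu> (?q + i) (i - (l + m)) (min k (Suc i)) (\<lambda>t. A t i) (total i)"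
    proof (cases "i = j")
      case True
      then show ?thesis using stj i by (simp add: j_def)
    next
      case False
      then have "stored \<mu> (?q + i) (i - (l + m)) (min k (Suc i)) (\<lambda>t. A t i) (total i)"
        using col i by (simp add: columns_ok_def j_def)
      then show ?thesis by (rule stored_cong) (use False in \<open>auto simp: other\<close>)
    qed
  qed
  show "data_ok (run new_col \<eta> \<mu>) (Suc (k + (l + m)))"
    unfolding run data_ok_def j_def[symmetric]
  proof (intro conjI allI impI)
    fix i c assume "i < n + l" "c < ?q"
    then show "\<nu> ''d'' i c = feature_col c i" using dat by (simp add: other data_ok_def)
  next
    fix i t assume i: "i < n" "i < Suc j" and t: "i - (l + m) \<le> t \<and> t \<le> i - (l + m) + (l + (l + m))"
    show "\<nu> ''d'' t (?q + i) = A t i"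
    proof (cases "i = j")
      case True
      then show ?thesis using d1[of t] i t by (simp add: \<nu> \<mu>3 \<mu>2 upd_region_apply j_def)
    next
      case False
      then show ?thesis using dat i t by (simp add: other data_ok_def j_def)
    qed
  qed
  show "coords_ok (run new_col \<eta> \<mu>) (Suc (k + (l + m)))"
    unfolding run coords_ok_def j_def[symmetric]
  proof (intro allI impI)
    fix i c assume i: "i < n" "l + m \<le> i \<and> i < Suc j" and c: "c < ?q"
    show "\<nu> ''R.S'' i c = coord i c"
    proof (cases "i = j")
      case True
      then show ?thesis using RS i c by (simp add: \<nu> upd_region_apply)
    next
      case False
      then show ?thesis
        using crd i c by (simp add: \<nu> \<mu>3 \<mu>2 \<mu>1 upd_region_apply coords_ok_def j_def)
    qed
  qed
qed

lemma make_pivot_correct: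
  assumes env: "sized \<eta>" "\<eta> ''k'' = k" and k: "k < n" and inp: "inputs \<mu>"
    and G: "\<And>a b. a < r \<Longrightarrow> b < r \<Longrightarrow> \<mu> ''G'' a b = gram (Suc (k + l)) a b"
    and ext: "extended \<mu> (p + r + k) (k - (l + m)) k (\<lambda>i. A i k) (total k)"
  shows "reflector_loaded (run make_pivot \<eta> \<mu>) k"
    and "k \<le> i \<Longrightarrow> i \<le> k + l \<Longrightarrow> run make_pivot \<eta> \<mu> ''Y.B'' i k =
      y k i - (if k < i then \<Sum>a<r. U i a * v k a else 0)"
    and "j \<noteq> k \<Longrightarrow> run make_pivot \<eta> \<mu> ''Y.B'' i j = \<mu> ''Y.B'' i j"
    and "j \<noteq> k \<Longrightarrow> run make_pivot \<eta> \<mu> ''Y.V'' j a = \<mu> ''Y.V'' j a"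
proof -
  define \<mu>1 \<mu>2 \<mu>3 \<mu>4 \<mu>5 \<nu> where "\<mu>1 = run pivot_col \<eta> \<mu>" and "\<mu>2 = run load_h \<eta> \<mu>1"
    and "\<mu>3 = run norm_sq \<eta> \<mu>2" and "\<mu>4 = run pivot_sign \<eta> \<mu>3" and "\<mu>5 = run norm_sq \<eta> \<mu>4"
    and "\<nu> = run store_reflector \<eta> \<mu>5"
  have e: "\<eta> ''n'' = n" "\<eta> ''r'' = r" "\<eta> ''p'' = p" "\<eta> ''l'' = l" "\<eta> ''m'' = m"
    using env by (auto simp: sized_def)
  have run: "run make_pivot \<eta> \<mu> = \<nu>"
    by (simp add: make_pivot_def \<mu>1_def \<mu>2_def \<mu>3_def \<mu>4_def \<mu>5_def \<nu>_def)
  have \<mu>1: "\<mu>1 = upd_region ''y'' (\<lambda>i j. i \<le> l \<and> j = 0) (\<lambda>e j. \<mu> ''X'' (k + e) (p + r + k))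
    (upd_region ''Y.V'' (\<lambda>i j. i = k \<and> j < r) (\<lambda>i a. \<mu> ''A.V'' i a - \<mu> ''P'' a (p + r + i)) \<mu>)"
    unfolding \<mu>1_def run_pivot_col by (simp add: e env)
  have 2: "\<mu>2 Z = \<mu>1 Z" if "Z \<noteq> ''h''" for Z
    using that unfolding \<mu>2_def by (intro run_unwritten) (simp add: factor_defs)
  have 3: "\<mu>3 Z = \<mu>2 Z" if "Z \<noteq> ''s''" for Z
    using that unfolding \<mu>3_def by (intro run_unwritten) (simp add: factor_defs)
  have 4: "\<mu>4 Z = \<mu>3 Z" if "Z \<noteq> ''y''" for Z
    using that unfolding \<mu>4_def by (intro run_unwritten) (simp add: factor_defs)
  have 5: "\<mu>5 Z = \<mu>4 Z" if "Z \<noteq> ''s''" for Z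
    using that unfolding \<mu>5_def by (intro run_unwritten) (simp add: factor_defs)
  have 6: "\<nu> Z = \<mu>5 Z" if "Z \<noteq> ''Y.B''" for Z
    using that unfolding \<nu>_def by (intro run_unwritten) (simp add: factor_defs)
  have V: "\<mu>1 ''Y.V'' k a = v k a" if "a < r" for a
    using that ext inp k column_state[of k k]
    by (simp add: \<mu>1 upd_region_apply v_def extended_def inputs_def)
  have y1: "\<mu>1 ''y'' e 0 = M k (k + e) k" if "e \<le> l" for e
    using that ext k column_state[of k k] by (simp add: \<mu>1 upd_region_apply extended_def)
  have h: "\<mu>2 ''h'' a 0 = (\<Sum>b<r. gram (Suc (k + l)) a b * v k b)" if "a < r" for a
    unfolding \<mu>2_def run_load_h using that
    by (simp add: upd_region_apply e env V) (simp add: \<mu>1 upd_region_apply G)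
  define \<sigma> where "\<sigma> = (\<Sum>i\<in>{k..<n}. (M k i k)\<^sup>2)"
  have s3: "\<mu>3 ''s'' 0 0 = \<sigma>"
  proof -
    \<comment> \<open>The finished rows of \<open>R\<close> above the pivot are cut off, so that the
      norm is the \<open>\<sigma>\<close> of \<open>hvec\<close>.\<close>
    let ?z = "\<lambda>i. if i < k then 0 else M k i k"
    have tail: "M k i k = (\<Sum>a<r. U i a * v k a)" if "k + l < i" for i
      using y_tail[OF k that] y_eq_M[of k i] that by simp
    have "\<mu>3 ''s'' 0 0 = (\<Sum>i<n. (?z i)\<^sup>2)"
      unfolding \<mu>3_def
      by (rule norm_correct[where c = "v k" and k = k])
        (auto simp: e env 2 V y1 h M_out tail)
    also have "\<dots> = \<sigma>"
      unfolding \<sigma>_def by (rule sum.mono_neutral_cong_right) auto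
    finally show ?thesis .
  qed
  have y4: "\<mu>4 ''y'' t 0 = y k (k + t)" if "t \<le> l" for t
  proof (cases "t = 0")
    case True
    have "\<mu>3 ''y'' 0 0 = M k k k" using y1[of 0] by (simp add: 3 2)
    then show ?thesis
      using True k unfolding \<mu>4_def pivot_sign_def
      by (simp add: s3 upd_cell_apply y_def hvec_def Let_def \<sigma>_def[symmetric])
  next
    case False
    then have "\<mu>4 ''y'' t 0 = \<mu>3 ''y'' t 0"
      unfolding \<mu>4_def pivot_sign_def by (simp add: upd_cell_apply)
    then show ?thesis using False that y1[of t] y_eq_M[of k "k + t"] by (simp add: 3 2)
  qed
  have s5: "\<mu>5 ''s'' 0 0 = (\<Sum>i<n. (y k i)\<^sup>2)"
    unfolding \<mu>5_def
    by (rule norm_correct[where c = "v k" and k = k])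
      (auto simp: e env 2 3 4 V y4 h y_above y_out y_tail[OF k])
  show "reflector_loaded (run make_pivot \<eta> \<mu>) k"
    unfolding run reflector_loaded_def beta_def
    by (simp add: 6 s5) (simp add: 5 y4 4 3 h, simp add: 2 V)
  show "run make_pivot \<eta> \<mu> ''Y.B'' i k = y k i - (if k < i then \<Sum>a<r. U i a * v k a else 0)"
    if "k \<le> i" "i \<le> k + l"
  proof -
    have "\<mu>5 ''y'' (i - k) 0 = y k i" using y4[of "i - k"] that by (simp add: 5)
    moreover have "\<mu>5 ''u'' i a = U i a" if "a < r" for a
      using that \<open>i \<le> k + l\<close> k inp
      by (simp add: 5 4 3 2) (simp add: \<mu>1 upd_region_other inputs_def)
    moreover have "\<mu>5 ''Y.V'' k a = v k a" if "a < r" for a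
      using that by (simp add: 5 4 3 2 V)
    ultimately show ?thesis
      using that unfolding run \<nu>_def run_store_reflector by (simp add: upd_region_apply e env)
  qed
  show "j \<noteq> k \<Longrightarrow> run make_pivot \<eta> \<mu> ''Y.B'' i j = \<mu> ''Y.B'' i j"
    unfolding run \<nu>_def run_store_reflector
    by (simp add: upd_region_apply e env 5 4 3 2) (simp add: \<mu>1 upd_region_other)
  show "j \<noteq> k \<Longrightarrow> run make_pivot \<eta> \<mu> ''Y.V'' j a = \<mu> ''Y.V'' j a"
    by (simp add: run 6 5 4 3 2) (simp add: \<mu>1 upd_region_apply)
qed

definition factor_inv :: "memory \<Rightarrow> nat \<Rightarrow> memory \<Rightarrow> bool" where
  "factor_inv \<mu>0 k \<nu> \<longleftrightarrow> columns_ok \<nu> k (k + (l + m)) \<and> data_ok \<nu> (k + (l + m)) \<and>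
     coords_ok \<nu> (k + (l + m)) \<and>
     (\<forall>a<r. \<forall>b<r. \<nu> ''G'' a b = gram (k + l) a b) \<and>
     (\<forall>a<r. \<forall>b<r. \<nu> ''G2'' a b = gram (Suc (k + l + (l + m))) a b) \<and>
     (\<forall>s<k. (\<forall>a<r. \<nu> ''Y.V'' s a = v s a) \<and> (\<forall>i. s \<le> i \<and> i \<le> s + l \<longrightarrow>
        \<nu> ''Y.B'' i s = y s i - (if s < i then \<Sum>a<r. U i a * v s a else 0))) \<and>
     (\<forall>Z. Z \<notin> written factor_step \<longrightarrow> \<nu> Z = \<mu>0 Z)"

lemma factor_step_correct:
  assumes env: "sized \<eta>" "\<eta> ''k'' = k" and k: "k < n" and inp: "inputs \<mu>0"
    and I: "factor_inv \<mu>0 k \<mu>"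
  shows "factor_inv \<mu>0 (Suc k) (run factor_step \<eta> \<mu>)"
proof -
  let ?q = "p + r" and ?L = "l + m"
  have e: "\<eta> ''n'' = n" "\<eta> ''r'' = r" "\<eta> ''p'' = p" "\<eta> ''l'' = l" "\<eta> ''m'' = m"
    using env by (auto simp: sized_def)
  define \<mu>1 \<mu>2 \<mu>3 \<mu>4 \<mu>5 \<mu>6 \<mu>7 \<nu> where "\<mu>1 = run new_col \<eta> \<mu>"
    and "\<mu>2 = run (gram_down ''G2'' (IAdd (IAdd kl Lx) (INum 1))) \<eta> \<mu>1"
    and "\<mu>3 = run (For ''c'' qx (enter_row (IVar ''c''))) \<eta> \<mu>2"
    and "\<mu>4 = run (For ''c'' (IAdd Lx (INum 1)) (enter_row (slot (IAdd (IVar ''k'') (IVar ''c''))))) \<eta> \<mu>3"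
    and "\<mu>5 = run (gram_down ''G'' kl) \<eta> \<mu>4"
    and "\<mu>6 = run make_pivot \<eta> \<mu>5"
    and "\<mu>7 = run (For ''c'' qx (reflect (IVar ''c''))) \<eta> \<mu>6"
    and "\<nu> = run (For ''c'' (IAdd Lx (INum 1)) (reflect (slot (IAdd (IVar ''k'') (IVar ''c''))))) \<eta> \<mu>7"
  have run: "run factor_step \<eta> \<mu> = \<nu>"
    by (simp only: factor_step_def run.simps(3) \<mu>1_def \<mu>2_def \<mu>3_def \<mu>4_def \<mu>5_def \<mu>6_def \<mu>7_def \<nu>_def)
  have f1: "\<mu>1 Z = \<mu> Z" if "Z \<notin> {''d'', ''T'', ''R.S'', ''X'', ''P''}" for Z
    using that unfolding \<mu>1_def by (intro run_unwritten) (simp add: factor_defs)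
  have f2: "\<mu>2 Z = \<mu>1 Z" if "Z \<noteq> ''G2''" for Z
    using that unfolding \<mu>2_def by (intro run_unwritten) (simp add: factor_defs)
  have f3: "\<mu>3 Z = \<mu>2 Z" if "Z \<notin> {''X'', ''T''}" for Z
    using that unfolding \<mu>3_def by (intro run_unwritten) (simp add: factor_defs)
  have f4: "\<mu>4 Z = \<mu>3 Z" if "Z \<notin> {''X'', ''T''}" for Z
    using that unfolding \<mu>4_def by (intro run_unwritten) (simp add: factor_defs)
  have f5: "\<mu>5 Z = \<mu>4 Z" if "Z \<noteq> ''G''" for Z
    using that unfolding \<mu>5_def by (intro run_unwritten) (simp add: factor_defs)
  have f6: "\<mu>6 Z = \<mu>5 Z" if "Z \<notin> {''Y.V'', ''y'', ''h'', ''s'', ''Y.B''}" for Z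
    using that unfolding \<mu>6_def by (intro run_unwritten) (simp add: factor_defs)
  have f7: "\<mu>7 Z = \<mu>6 Z" if "Z \<notin> {''X'', ''P'', ''w''}" for Z
    using that unfolding \<mu>7_def by (intro run_unwritten) (simp add: factor_defs)
  have f8: "\<nu> Z = \<mu>7 Z" if "Z \<notin> {''X'', ''P'', ''w''}" for Z
    using that unfolding \<nu>_def by (intro run_unwritten) (simp add: factor_defs)
  have "Z \<notin> written factor_step" if "Z \<in> {''u'', ''A.B'', ''A.U'', ''A.V'', ''A.W'', ''A.S''}" for Z
    using that by (auto simp: factor_defs)
  then have inp: "inputs \<mu>"
    using I by (intro inputs_cong[OF inp]) (auto simp: factor_inv_def)
  have G: "\<And>a b. a < r \<Longrightarrow> b < r \<Longrightarrow> \<mu> ''G'' a b = gram (k + l) a b"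
    and G2: "\<And>a b. a < r \<Longrightarrow> b < r \<Longrightarrow> \<mu> ''G2'' a b = gram (Suc (k + l + ?L)) a b"
    and old: "columns_ok \<mu> k (k + ?L)" "data_ok \<mu> (k + ?L)" "coords_ok \<mu> (k + ?L)"
    using I by (simp_all add: factor_inv_def)
  note new = new_col_correct[OF env k inp G2 old, folded \<mu>1_def]
  have u: "\<mu> ''u'' i a = U i a" if "i < n + (l + (?L + 1))" "a < r" for i a
    using inp that by (simp add: inputs_def)
  have u2: "\<mu>2 ''u'' = \<mu> ''u''" and u4: "\<mu>4 ''u'' = \<mu> ''u''" and u3: "\<mu>3 ''u'' = \<mu> ''u''"
    by (simp_all add: f1 f2 f3 f4)
  have G2': "\<mu>2 ''G2'' a b = gram (Suc (Suc k + l + ?L)) a b" if "a < r" "b < r" for a b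
    unfolding \<mu>2_def
    by (rule gram_down_correct[where i = "Suc (k + l + ?L)", THEN trans])
      (use that k in \<open>auto simp: e env f1 G2 u\<close>)
  have st2: "stored \<mu>2 c 0 k (feature_col c) (feature_total c)" if "c < ?q" for c
  proof -
    have "stored \<mu>1 c 0 k (feature_col c) (feature_total c)"
      using new(1) that unfolding columns_ok_def by blast
    then show ?thesis by (rule stored_cong) (auto simp: f2)
  qed
  have near2: "stored \<mu>2 (?q + j) (j - ?L) (min k (Suc j)) (\<lambda>i. A i j) (total j)"
    if "j < n" "j \<le> k + ?L" for j
  proof -
    have "stored \<mu>1 (?q + j) (j - ?L) (min k (Suc j)) (\<lambda>i. A i j) (total j)"
      using new(1) that unfolding columns_ok_def by (simp add: less_Suc_eq_le)
    then show ?thesis by (rule stored_cong) (auto simp: f2)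
  qed
  have d2: "\<mu>2 ''d'' (k + l) c = feature_col c (k + l)" if "c < ?q" for c
    using new(2) that k by (simp add: data_ok_def f2)
  have d2': "\<mu>2 ''d'' (k + l) (?q + j) = A (k + l) j" if "j < n" "k \<le> j" "j \<le> k + ?L" for j
  proof -
    have "j - ?L \<le> k + l" "k + l \<le> j - ?L + (l + ?L)" "j < Suc (k + ?L)" using that by auto
    then have "\<mu>1 ''d'' (k + l) (?q + j) = A (k + l) j"
      using new(2) that(1) unfolding data_ok_def by blast
    then show ?thesis by (simp add: f2)
  qed
  have ext3: "extended \<mu>3 (0 + c) 0 k (feature_col c) (feature_total c)" if "c < ?q" for c
    unfolding \<mu>3_def
    by (rule enter_columns(1)[where good = "\<lambda>_. True" and lo = "\<lambda>_. 0"])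
      (use that st2 d2 k in \<open>auto simp: e env u2 u\<close>)
  have oth3: "\<mu>3 Z i c = \<mu>2 Z i c" if "?q \<le> c" for Z i c
    unfolding \<mu>3_def
    by (rule enter_columns(2)[where base = 0 and good = "\<lambda>_. False" and k = k])
      (use that k in \<open>auto simp: e env u2 u\<close>)
  have near3: "stored \<mu>3 (?q + j) (j - ?L) (min k (Suc j)) (\<lambda>i. A i j) (total j)"
    if "j < n" "j \<le> k + ?L" for j
    by (rule stored_cong[OF near2[OF that]]) (auto simp: oth3)
  have ext4: "extended \<mu>4 (?q + k + t) (k + t - ?L) k (\<lambda>i. A i (k + t)) (total (k + t))"
    if "t < Suc ?L" "k + t < n" for t
    unfolding \<mu>4_def
  proof (rule enter_columns(1)[where good = "\<lambda>t. k + t < n" and k = k])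
    fix t assume t: "t < ival (IAdd Lx (INum 1)) \<eta>" "k + t < n"
    then show "stored \<mu>3 (?q + k + t) (k + t - ?L) k (\<lambda>i. A i (k + t)) (total (k + t))"
      using near3[of "k + t"] by (simp add: e add.assoc)
    show "\<mu>3 ''d'' (k + l) (?q + k + t) = A (k + l) (k + t)"
      using t d2'[of "k + t"] by (simp add: e f3 add.assoc)
  qed (use that k in \<open>auto simp: e env u3 u\<close>)
  have oth4: "\<mu>4 Z i c = \<mu>3 Z i c" if "c < ?q + k \<or> ?q + k + Suc ?L \<le> c" for Z i c
    unfolding \<mu>4_def
    by (rule enter_columns(2)[where base = "?q + k" and good = "\<lambda>_. False" and k = k])
      (use that k in \<open>auto simp: e env u3 u\<close>)
  have ext4f: "extended \<mu>4 c 0 k (feature_col c) (feature_total c)" if "c < ?q" for c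
  proof -
    have "extended \<mu>3 c 0 k (feature_col c) (feature_total c)" using ext3[OF that] by simp
    then show ?thesis by (rule extended_cong) (rule oth4, use that in simp)
  qed
  \<comment> \<open>Finished columns lie to the left of the active slots and are carried through the
    step by the frame claims.\<close>
  have done4: "stored \<mu>4 (?q + j) (j - ?L) (Suc j) (\<lambda>i. A i j) (total j)" if "j < k" for j
  proof -
    have "stored \<mu>3 (?q + j) (j - ?L) (Suc j) (\<lambda>i. A i j) (total j)"
      using near3[of j] that k by (simp add: min_absorb2)
    then show ?thesis by (rule stored_cong) (use that in \<open>auto simp: oth4\<close>)
  qed
  have G5: "\<mu>5 ''G'' a b = gram (Suc (k + l)) a b" if "a < r" "b < r" for a b
    unfolding \<mu>5_def
    by (rule gram_down_correct) (use that k in \<open>auto simp: e env f1 f2 f3 f4 G u\<close>)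
  have ext5: "extended \<mu>5 (?q + k) (k - ?L) k (\<lambda>i. A i k) (total k)"
  proof -
    have "extended \<mu>4 (?q + k) (k - ?L) k (\<lambda>i. A i k) (total k)" using ext4[of 0] k by simp
    then show ?thesis by (rule extended_cong) (auto simp: f5)
  qed
  have inp5: "inputs \<mu>5" by (rule inputs_cong[OF inp]) (auto simp: f1 f2 f3 f4 f5)
  note piv = make_pivot_correct[OF env k inp5 G5 ext5, folded \<mu>6_def]
  have ext6: "extended \<mu>6 (?q + k + t) (k + t - ?L) k (\<lambda>i. A i (k + t)) (total (k + t))"
    if "t < Suc ?L" "k + t < n" for t
    by (rule extended_cong[OF ext4[OF that]]) (auto simp: f5 f6)
  have ext6f: "extended \<mu>6 c 0 k (feature_col c) (feature_total c)" if "c < ?q" for c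
    by (rule extended_cong[OF ext4f[OF that]]) (auto simp: f5 f6)
  have st7: "stored \<mu>7 (0 + c) 0 (Suc k) (feature_col c) (feature_total c)" if "c < ?q" for c
    unfolding \<mu>7_def
    by (rule reflect_columns(1)[where good = "\<lambda>_. True" and lo = "\<lambda>_. 0"])
      (use that ext6f piv(1) in \<open>auto simp: e env\<close>)
  have oth7: "\<mu>7 Z i c = \<mu>6 Z i c" if "?q \<le> c" "Z \<noteq> ''w''" for Z i c
    unfolding \<mu>7_def
    by (rule reflect_columns(2)[where base = 0 and good = "\<lambda>_. False" and k = k])
      (use that piv(1) in \<open>auto simp: e env\<close>)
  have refl7: "reflector_loaded \<mu>7 k"
    by (rule reflector_loaded_cong[OF piv(1)]) (auto simp: f7)
  have st8: "stored \<nu> (?q + k + t) (k + t - ?L) (Suc k) (\<lambda>i. A i (k + t)) (total (k + t))"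
    if "t < Suc ?L" "k + t < n" for t
    unfolding \<nu>_def
  proof (rule reflect_columns(1)[where good = "\<lambda>t. k + t < n" and k = k])
    fix t assume t: "t < ival (IAdd Lx (INum 1)) \<eta>" "k + t < n"
    then have "extended \<mu>6 (?q + k + t) (k + t - ?L) k (\<lambda>i. A i (k + t)) (total (k + t))"
      by (intro ext6) (simp_all add: e)
    then show "extended \<mu>7 (?q + k + t) (k + t - ?L) k (\<lambda>i. A i (k + t)) (total (k + t))"
      by (rule extended_cong) (auto simp: oth7)
    show "k + t - ?L \<le> k" using t by (simp add: e)
  qed (use that refl7 in \<open>auto simp: e env\<close>)
  have oth8: "\<nu> Z i c = \<mu>7 Z i c" if "c < ?q + k \<or> ?q + k + Suc ?L \<le> c" "Z \<noteq> ''w''" for Z i c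
    unfolding \<nu>_def
    by (rule reflect_columns(2)[where base = "?q + k" and good = "\<lambda>_. False" and k = k])
      (use that refl7 in \<open>auto simp: e env\<close>)
  have "columns_ok \<nu> (Suc k) (Suc k + ?L)"
    unfolding columns_ok_def
  proof (intro conjI allI impI)
    fix c assume "c < ?q"
    then have "stored \<mu>7 c 0 (Suc k) (feature_col c) (feature_total c)" using st7[of c] by simp
    then show "stored \<nu> c 0 (Suc k) (feature_col c) (feature_total c)"
      by (rule stored_cong) (rule oth8, use \<open>c < ?q\<close> in auto)
  next
    fix j assume j: "j < n" "j < Suc k + ?L"
    show "stored \<nu> (?q + j) (j - ?L) (min (Suc k) (Suc j)) (\<lambda>i. A i j) (total j)"
    proof (cases "j < k")
      case True
      have "stored \<nu> (?q + j) (j - ?L) (Suc j) (\<lambda>i. A i j) (total j)"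
        by (rule stored_cong[OF done4[OF True]]) (use True in \<open>auto simp: oth8 oth7 f6 f5\<close>)
      then show ?thesis using True by (simp add: min_absorb2)
    next
      case False
      then show ?thesis
        using st8[of "j - k"] j by (simp add: min_absorb1 add.assoc)
    qed
  qed
  moreover have "data_ok \<nu> (Suc k + ?L)"
    using new(2) by (simp add: data_ok_def f2 f3 f4 f5 f6 f7 f8)
  moreover have "coords_ok \<nu> (Suc k + ?L)"
    using new(3) by (simp add: coords_ok_def f2 f3 f4 f5 f6 f7 f8)
  moreover have "\<nu> ''G'' a b = gram (Suc k + l) a b" if "a < r" "b < r" for a b
    using G5 that by (simp add: f6 f7 f8)
  moreover have "\<nu> ''G2'' a b = gram (Suc (Suc k + l + ?L)) a b" if "a < r" "b < r" for a b
    using G2'[OF that] by (simp add: f3 f4 f5 f6 f7 f8)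
  moreover have "\<nu> ''Y.V'' s a = v s a" if "s < Suc k" "a < r" for s a
  proof (cases "s = k")
    case True
    then show ?thesis using piv(1) that by (simp add: reflector_loaded_def f7 f8)
  next
    case False
    then show ?thesis
      using I that piv(4)[OF _ _ False] by (simp add: factor_inv_def f1 f2 f3 f4 f5 f7 f8)
  qed
  moreover have "\<nu> ''Y.B'' i s = y s i - (if s < i then \<Sum>a<r. U i a * v s a else 0)"
    if "s < Suc k" "s \<le> i" "i \<le> s + l" for s i
  proof (cases "s = k")
    case True
    then show ?thesis using piv(2)[of i] that by (simp add: f7 f8)
  next
    case False
    then have "s < k" using that by simp
    then have "\<mu> ''Y.B'' i s = y s i - (if s < i then \<Sum>a<r. U i a * v s a else 0)"
      using I that unfolding factor_inv_def by blast
    then show ?thesis using piv(3)[OF _ _ False] by (simp add: f1 f2 f3 f4 f5 f7 f8)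
  qed
  moreover have "\<nu> Z = \<mu>0 Z" if "Z \<notin> written factor_step" for Z
    using I that run_unwritten[OF that, of \<eta> \<mu>] by (simp add: run factor_inv_def)
  ultimately show ?thesis unfolding run factor_inv_def by blast
qed

end


section \<open>The initial state\<close>

lemma init_features_correct:
  fixes \<eta> \<mu>
  defines "\<nu> \<equiv> run init_features \<eta> \<mu>" and "q \<equiv> \<eta> ''p'' + \<eta> ''r''"
  shows "i < \<eta> ''n'' + \<eta> ''l'' \<Longrightarrow> c < q \<Longrightarrow>
      \<nu> ''d'' i c = (if c < \<eta> ''p'' \<and> i < \<eta> ''n'' then \<mu> ''A.W'' i c else 0)" (is "PROP ?A")
    and "i < \<eta> ''l'' \<Longrightarrow> c < q \<Longrightarrow> \<nu> ''X'' i c = \<nu> ''d'' i c" (is "PROP ?B")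
    and "a < \<eta> ''r'' \<Longrightarrow> c < q \<Longrightarrow> \<nu> ''P'' a c = 0" (is "PROP ?C")
    and "a < \<eta> ''r'' \<Longrightarrow> c < q \<Longrightarrow> \<nu> ''T'' a c = (if c = \<eta> ''p'' + a then 1 else 0) -
      (\<Sum>i<\<eta> ''l''. \<mu> ''u'' i a * \<nu> ''d'' i c)" (is "PROP ?D")
proof -
  define \<mu>1 \<mu>2 where "\<mu>1 = run (pad_copy ''d'' ''A.W'' (IAdd (IVar ''n'') (IVar ''l'')) (IVar ''p'')) \<eta> \<mu>"
    and "\<mu>2 = run zero_data \<eta> \<mu>1"
  have \<mu>1: "\<mu>1 = upd_region ''d'' (\<lambda>i j. i < \<eta> ''n'' + \<eta> ''l'' \<and> j < \<eta> ''p'')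
      (\<lambda>i j. if i < \<eta> ''n'' then \<mu> ''A.W'' i j else 0) \<mu>"
    unfolding \<mu>1_def by (subst run_pad_copy) simp_all
  have ex: "(\<exists>s<N. \<exists>t<r. i = s \<and> c = p + t) \<longleftrightarrow> i < N \<and> p \<le> c \<and> c < p + r" for i c N p r :: nat
    by (auto simp: le_iff_add)
  have \<mu>2: "\<mu>2 = upd_region ''d'' (\<lambda>i c. i < \<eta> ''n'' + \<eta> ''l'' \<and> \<eta> ''p'' \<le> c \<and> c < q) (\<lambda>i c. 0) \<mu>1"
    unfolding \<mu>2_def zero_data_def
    by (rule run_For_For_cells[where a = "\<lambda>s t. s" and b = "\<lambda>s t. \<eta> ''p'' + t" and M = "\<eta> ''r''"])
      (simp_all add: q_def ex)
  have \<mu>3: "run feature_rows \<eta> \<xi> =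
    upd_region ''X'' (\<lambda>i c. i < \<eta> ''l'' \<and> c < q) (\<lambda>i c. \<xi> ''d'' i c) \<xi>" for \<xi>
    unfolding feature_rows_def
    by (rule run_For_For_cells[where a = "\<lambda>s t. s" and b = "\<lambda>s t. t" and M = q])
      (simp_all add: q_def)
  have \<mu>4: "run feature_acc \<eta> \<xi> =
    upd_region ''P'' (\<lambda>i c. i < \<eta> ''r'' \<and> c < q) (\<lambda>i c. 0) \<xi>" for \<xi>
    unfolding feature_acc_def
    by (rule run_For_For_cells[where a = "\<lambda>s t. s" and b = "\<lambda>s t. t" and M = q])
      (simp_all add: q_def)
  have \<mu>5: "run feature_tail \<eta> \<xi> =
    upd_region ''T'' (\<lambda>i c. i < \<eta> ''r'' \<and> c < q) (\<lambda>a c. (if c = \<eta> ''p'' + a then 1 else 0) -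
      (\<Sum>i<\<eta> ''l''. \<xi> ''u'' i a * \<xi> ''d'' i c)) \<xi>" for \<xi>
    unfolding feature_tail_def
    by (rule run_For_For_cells[where a = "\<lambda>s t. s" and b = "\<lambda>s t. t" and M = q])
      (auto simp: q_def run_sum_into upd_cell_apply upd_cell_overwrite sum_negf)
  have \<nu>: "\<nu> = upd_region ''T'' (\<lambda>i c. i < \<eta> ''r'' \<and> c < q) (\<lambda>a c. (if c = \<eta> ''p'' + a then 1 else 0) -
      (\<Sum>i<\<eta> ''l''. \<mu> ''u'' i a * \<mu>2 ''d'' i c))
    (upd_region ''P'' (\<lambda>i c. i < \<eta> ''r'' \<and> c < q) (\<lambda>i c. 0)
    (upd_region ''X'' (\<lambda>i c. i < \<eta> ''l'' \<and> c < q) (\<lambda>i c. \<mu>2 ''d'' i c) \<mu>2))"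
    unfolding \<nu>_def init_features_def run.simps(3) \<mu>1_def[symmetric] \<mu>2_def[symmetric] \<mu>3 \<mu>4 \<mu>5
    by (simp add: upd_region_other) (simp add: \<mu>2 \<mu>1 upd_region_other)
  have d: "\<nu> ''d'' = \<mu>2 ''d''" by (simp add: \<nu> upd_region_other)
  show "PROP ?A"
    unfolding d by (simp add: \<mu>2 \<mu>1 upd_region_apply)
  show "PROP ?B" and "PROP ?C" and "PROP ?D"
    unfolding d by (simp_all add: \<nu> upd_region_apply)
qed

context bps_data
begin

lemma first_cols_correct:
  assumes sz: "sized \<eta>" and inp: "inputs \<mu>"
    and G2: "\<And>a b. a < r \<Longrightarrow> b < r \<Longrightarrow> \<mu> ''G2'' a b = gram (Suc (l + (l + m))) a b"
  shows "j < n \<Longrightarrow> j < l + m \<Longrightarrow>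
      stored (run first_cols \<eta> \<mu>) (p + r + j) 0 0 (\<lambda>i. A i j) (total j)" (is "PROP ?A")
    and "j < n \<Longrightarrow> j < l + m \<Longrightarrow> i \<le> l + (l + m) \<Longrightarrow>
      run first_cols \<eta> \<mu> ''d'' i (p + r + j) = A i j" (is "PROP ?B")
    and "c < p + r \<Longrightarrow> run first_cols \<eta> \<mu> Z i c = \<mu> Z i c" (is "PROP ?C")
proof -
  have e: "\<eta> ''n'' = n" "\<eta> ''r'' = r" "\<eta> ''p'' = p" "\<eta> ''l'' = l" "\<eta> ''m'' = m"
    using sz by (auto simp: sized_def)
  let ?q = "p + r"
  let ?inv = "\<lambda>t \<nu>. (\<forall>j<n. j < t \<longrightarrow> stored \<nu> (?q + j) 0 0 (\<lambda>i. A i j) (total j) \<and>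
      (\<forall>i\<le>l + (l + m). \<nu> ''d'' i (?q + j) = A i j)) \<and>
    (\<forall>Z i c. c < ?q \<longrightarrow> \<nu> Z i c = \<mu> Z i c) \<and>
    (\<forall>Z. Z \<notin> {''d'', ''T'', ''X'', ''P''} \<longrightarrow> \<nu> Z = \<mu> Z)"
  have "?inv (ival Lx \<eta>) (run (For ''c'' Lx first_col) \<eta> \<mu>)"
  proof (rule run_For_invariant[where I = ?inv])
    fix t \<nu> assume t: "t < ival Lx \<eta>" and I: "?inv t \<nu>"
    let ?\<eta> = "\<eta>(''c'' := t)"
    define \<mu>1 \<mu>2 \<nu>' where "\<mu>1 = run (load_col (IVar ''c'') (INum 0)) ?\<eta> \<nu>"
      and "\<mu>2 = run (tail_col (IVar ''c'') (INum 0)) ?\<eta> \<mu>1" and "\<nu>' = run first_col ?\<eta> \<nu>"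
    have \<mu>1: "\<mu>1 = upd_region ''d'' (\<lambda>i c. i \<le> l + (l + m) \<and> c = ?q + t)
        (\<lambda>i c. bps_entry \<nu> n r p l m i t) \<nu>"
      unfolding \<mu>1_def by (subst run_load_col[where J = t and K = 0]) (simp_all add: e)
    have \<mu>2: "\<mu>2 = upd_region ''T'' (\<lambda>i c. i < r \<and> c = ?q + t)
        (\<lambda>a c. (\<Sum>e<Suc (l + m). \<mu>1 ''u'' (0 + l + e) a * \<mu>1 ''d'' (0 + l + e) c) +
          (\<Sum>b<r. \<mu>1 ''G2'' a b * \<mu>1 ''A.V'' t b)) \<mu>1"
      unfolding \<mu>2_def by (subst run_tail_col[where J = t and K = 0])
        (simp_all add: e del: sum.lessThan_Suc)
    have X: "run (For ''i'' (IVar ''l'') (Assign ''X'' (IVar ''i'') (slot (IVar ''c''))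
        (RCell ''d'' (IVar ''i'') (slot (IVar ''c''))))) ?\<eta> \<xi> =
      upd_region ''X'' (\<lambda>i c. i < l \<and> c = ?q + t) (\<lambda>i c. \<xi> ''d'' i c) \<xi>" for \<xi>
      by (rule run_For_region[where D = "\<lambda>s i c. i = s \<and> c = ?q + t"])
        (auto simp: e intro!: upd_cell_eq_upd_region)
    have P: "run (For ''a'' (IVar ''r'') (Assign ''P'' (IVar ''a'') (slot (IVar ''c'')) (RNum 0))) ?\<eta> \<xi> =
      upd_region ''P'' (\<lambda>i c. i < r \<and> c = ?q + t) (\<lambda>i c. 0) \<xi>" for \<xi>
      by (rule run_For_region[where D = "\<lambda>s i c. i = s \<and> c = ?q + t"])
        (auto simp: e intro!: upd_cell_eq_upd_region)
    have \<nu>': "\<nu>' = upd_region ''P'' (\<lambda>i c. i < r \<and> c = ?q + t) (\<lambda>i c. 0)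
        (upd_region ''X'' (\<lambda>i c. i < l \<and> c = ?q + t) (\<lambda>i c. \<mu>2 ''d'' i c) \<mu>2)"
      unfolding \<nu>'_def first_col_def run.simps(3) \<mu>1_def[symmetric] \<mu>2_def[symmetric] X P ..
    have other: "\<nu>' Z i c = \<nu> Z i c" if "c \<noteq> ?q + t" for Z i c
      using that by (simp add: \<nu>' \<mu>2 \<mu>1 upd_region_apply)
    have fr: "\<nu> Z = \<mu> Z" if "Z \<notin> {''d'', ''T'', ''X'', ''P''}" for Z
      using I that by blast
    have inp1: "inputs \<mu>1"
      by (rule inputs_cong[OF inp]) (auto simp: \<mu>1 upd_region_def fr)
    have inpn: "inputs \<nu>"
      by (rule inputs_cong[OF inp]) (auto simp: fr)
    have d1: "\<mu>1 ''d'' i (?q + t) = A i t" if "t < n" "i \<le> l + (l + m)" for i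
      using that inpn by (simp add: \<mu>1 upd_region_apply inputs_def)
    have new: "stored \<nu>' (?q + t) 0 0 (\<lambda>i. A i t) (total t) \<and>
        (\<forall>i\<le>l + (l + m). \<nu>' ''d'' i (?q + t) = A i t)" if n: "t < n"
    proof -
      have "\<mu>2 ''T'' a (?q + t) = tail (\<lambda>i. A i t) (total t) 0 a" if "a < r" for a
      proof -
        have "\<mu>2 ''T'' a (?q + t) =
          (\<Sum>e<Suc (l + m). \<mu>1 ''u'' (0 + l + e) a * \<mu>1 ''d'' (0 + l + e) (?q + t)) +
          (\<Sum>b<r. \<mu>1 ''G2'' a b * \<mu>1 ''A.V'' t b)"
          using that by (simp add: \<mu>2 upd_region_apply)
        also have "\<dots> = tail (\<lambda>i. A i t) (total t) 0 a"
          by (rule tail_col_value[OF inp1])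
            (use that n t d1 G2 in \<open>auto simp: e \<mu>1 upd_region_other fr\<close>)
        finally show ?thesis .
      qed
      then have "stored \<nu>' (?q + t) 0 0 (\<lambda>i. A i t) (total t)"
        unfolding stored_def
        by (simp add: \<nu>' upd_region_apply acc_0 entry_0) (simp add: \<mu>2 upd_region_apply d1 n)
      moreover have "\<nu>' ''d'' i (?q + t) = A i t" if "i \<le> l + (l + m)" for i
        using d1[OF n that] by (simp add: \<nu>' \<mu>2 upd_region_apply)
      ultimately show ?thesis by blast
    qed
    have "stored \<nu>' (?q + j) 0 0 (\<lambda>i. A i j) (total j) \<and> (\<forall>i\<le>l + (l + m). \<nu>' ''d'' i (?q + j) = A i j)"
      if j: "j < n" "j < Suc t" for j
    proof (cases "j = t")
      case True
      then show ?thesis using new j by simp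
    next
      case False
      then have "j < t" using j by simp
      then have 1: "stored \<nu> (?q + j) 0 0 (\<lambda>i. A i j) (total j)"
        and 2: "\<forall>i\<le>l + (l + m). \<nu> ''d'' i (?q + j) = A i j"
        using I j by blast+
      have "stored \<nu>' (?q + j) 0 0 (\<lambda>i. A i j) (total j)"
        by (rule stored_cong[OF 1]) (rule other, use False in simp)
      then show ?thesis using 2 False by (simp add: other)
    qed
    moreover have "\<nu>' Z i c = \<mu> Z i c" if "c < ?q" for Z i c
    proof -
      have "\<nu>' Z i c = \<nu> Z i c" using that by (intro other) simp
      then show ?thesis using I that by simp
    qed
    moreover have "\<nu>' Z = \<mu> Z" if "Z \<notin> {''d'', ''T'', ''X'', ''P''}" for Z
    proof -
      have "\<nu>' Z = \<nu> Z" using that by (simp add: \<nu>' \<mu>2 \<mu>1 upd_region_other)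
      then show ?thesis using fr[OF that] by simp
    qed
    ultimately show "?inv (Suc t) (run first_col ?\<eta> \<nu>)"
      unfolding \<nu>'_def by blast
  qed simp
  then have I: "?inv (l + m) (run first_cols \<eta> \<mu>)"
    by (simp add: first_cols_def e)
  show "PROP ?A" and "PROP ?B" and "PROP ?C"
    using I by blast+
qed

lemma factor_init_correct:
  assumes sz: "sized \<eta>"
    and U: "\<And>i a. U i a = (if i < n then \<mu> ''A.U'' i a else 0)"
    and W: "\<And>i a. W i a = (if i < n then \<mu> ''A.W'' i a else 0)"
    and V: "V = \<mu> ''A.V''" and S: "S = \<mu> ''A.S''" and A: "A = bps_entry \<mu> n r p l m"
  defines "\<mu>0 \<equiv> run factor_init \<eta> \<mu>"
  shows "inputs \<mu>0" and "factor_inv \<mu>0 0 \<mu>0"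
    and "i < n \<Longrightarrow> a < r \<Longrightarrow> \<mu>0 ''Y.U'' i a = U i a"
proof -
  let ?q = "p + r" and ?L = "l + m"
  have e: "\<eta> ''n'' = n" "\<eta> ''r'' = r" "\<eta> ''p'' = p" "\<eta> ''l'' = l" "\<eta> ''m'' = m"
    using sz by (auto simp: sized_def)
  define \<mu>1 \<mu>2 where "\<mu>1 = run (
     pad_copy ''u'' ''A.U'' (IAdd (IVar ''n'') (IAdd (IVar ''l'') (IAdd Lx (INum 1)))) (IVar ''r'') ;;
     pad_copy ''Y.U'' ''A.U'' (IVar ''n'') (IVar ''r'') ;;
     gram_init ''G'' (IVar ''l'') ;;
     gram_init ''G2'' (IAdd (IVar ''l'') (IAdd Lx (INum 1)))) \<eta> \<mu>"
    and "\<mu>2 = run init_features \<eta> \<mu>1"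
  have \<mu>0: "\<mu>0 = run first_cols \<eta> \<mu>2"
    unfolding \<mu>0_def \<mu>1_def \<mu>2_def factor_init_def by simp
  have u1: "\<mu>1 ''u'' i a = U i a" if "i < n + (l + (?L + 1))" "a < r" for i a
    using that unfolding \<mu>1_def
    by (simp add: run_pad_copy run_gram_init upd_region_apply e U)
  have YU1: "\<mu>1 ''Y.U'' i a = U i a" if "i < n" "a < r" for i a
    using that unfolding \<mu>1_def
    by (simp add: run_pad_copy run_gram_init upd_region_apply e U)
  have G1: "\<mu>1 ''G'' a b = gram l a b" if "a < r" "b < r" for a b
    using that unfolding \<mu>1_def gram_shift
    by (simp add: run_pad_copy run_gram_init upd_region_apply e U)
  have G21: "\<mu>1 ''G2'' a b = gram (Suc (l + ?L)) a b" if "a < r" "b < r" for a b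
    using that unfolding \<mu>1_def gram_shift
    by (simp add: run_pad_copy run_gram_init upd_region_apply e U)
  have f1: "\<mu>1 Z = \<mu> Z" if "Z \<notin> {''u'', ''Y.U'', ''G'', ''G2''}" for Z
    using that unfolding \<mu>1_def by (intro run_unwritten) (simp add: factor_defs)
  have f2: "\<mu>2 Z = \<mu>1 Z" if "Z \<notin> {''d'', ''X'', ''P'', ''T''}" for Z
    using that unfolding \<mu>2_def by (intro run_unwritten) (simp add: factor_defs)
  have f0: "\<mu>0 Z = \<mu>2 Z" if "Z \<notin> {''d'', ''X'', ''P'', ''T''}" for Z
    using that unfolding \<mu>0 by (intro run_unwritten) (simp add: factor_defs)
  have "bps_entry \<mu>2 = bps_entry \<mu>"
    by (intro ext) (simp add: bps_entry_def f1 f2)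
  then have inp2: "inputs \<mu>2"
    unfolding inputs_def by (simp add: A V S f2 f1 u1)
  show inp0: "inputs \<mu>0" by (rule inputs_cong[OF inp2]) (auto simp: f0)
  note feat = init_features_correct[where \<eta> = \<eta> and \<mu> = \<mu>1, folded \<mu>2_def, unfolded e]
  have d2: "\<mu>2 ''d'' i c = feature_col c i" if "i < n + l" "c < ?q" for i c
    using feat(1)[OF that] by (simp add: f1 feature_col_def W)
  have G20: "\<mu>2 ''G2'' a b = gram (Suc (l + ?L)) a b" if "a < r" "b < r" for a b
    using G21[OF that] by (simp add: f2)
  note first = first_cols_correct[OF sz inp2 G20, folded \<mu>0]
  have st2: "stored \<mu>2 c 0 0 (feature_col c) (feature_total c)" if c: "c < ?q" for c
    unfolding stored_def
  proof (intro conjI allI impI)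
    fix i assume "0 \<le> i \<and> i < 0 + l"
    then show "\<mu>2 ''X'' i c = entry (feature_col c) (feature_total c) 0 i"
      using feat(2)[of i c] d2[of i c] c by (simp add: entry_0)
  next
    fix a assume a: "a < r"
    show "\<mu>2 ''P'' a c = acc (feature_col c) (feature_total c) 0 a"
      using feat(3)[OF a c] by (simp add: acc_0)
    show "\<mu>2 ''T'' a c = tail (feature_col c) (feature_total c) 0 a"
      using feat(4)[OF a c] a c by (simp add: tail_def feature_total_def d2 u1)
  qed
  have st0: "stored \<mu>0 c 0 0 (feature_col c) (feature_total c)" if "c < ?q" for c
    by (rule stored_cong[OF st2[OF that]]) (use first(3) that in auto)
  have "columns_ok \<mu>0 0 (0 + ?L)"
    unfolding columns_ok_def using st0 first(1) by simp
  moreover have "data_ok \<mu>0 (0 + ?L)"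
    unfolding data_ok_def using first(2,3) d2 by simp
  moreover have "coords_ok \<mu>0 (0 + ?L)" by (simp add: coords_ok_def)
  ultimately show "factor_inv \<mu>0 0 \<mu>0"
    unfolding factor_inv_def using G1 G21 by (simp add: f0 f2)
  show "i < n \<Longrightarrow> a < r \<Longrightarrow> \<mu>0 ''Y.U'' i a = U i a"
    using YU1 by (simp add: f0 f2)
qed

section \<open>Reading off the factors from the final memory\<close>

lemma factor_prog_correct:
  assumes sz: "sized \<eta>"
    and U: "\<And>i a. U i a = (if i < n then \<mu> ''A.U'' i a else 0)"
    and W: "\<And>i a. W i a = (if i < n then \<mu> ''A.W'' i a else 0)"
    and V: "V = \<mu> ''A.V''" and S: "S = \<mu> ''A.S''" and A: "A = bps_entry \<mu> n r p l m"
  shows "stores_bps (run factor_prog \<eta> \<mu>) ''Y'' n r 0 l 0 (mat n n (\<lambda>(i, k). y k i))"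
    and "stores_bps (run factor_prog \<eta> \<mu>) ''R'' n 0 (p + r) 0 (l + m) (mat n n (\<lambda>(i, j). M n i j))"
proof -
  let ?q = "p + r" and ?L = "l + m"
  have e: "\<eta> ''n'' = n" "\<eta> ''r'' = r" "\<eta> ''p'' = p" "\<eta> ''l'' = l" "\<eta> ''m'' = m"
    using sz by (auto simp: sized_def)
  define \<mu>0 \<mu>1 \<nu> where "\<mu>0 = run factor_init \<eta> \<mu>"
    and "\<mu>1 = run (For ''k'' (IVar ''n'') factor_step) \<eta> \<mu>0" and "\<nu> = run store_R \<eta> \<mu>1"
  note init = factor_init_correct[OF sz U W V S A, folded \<mu>0_def]
  have run: "run factor_prog \<eta> \<mu> = \<nu>"
    by (simp add: factor_prog_def \<mu>0_def \<mu>1_def \<nu>_def)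
  have "factor_inv \<mu>0 (ival (IVar ''n'') \<eta>) \<mu>1"
    unfolding \<mu>1_def
  proof (rule run_For_invariant[where I = "factor_inv \<mu>0"])
    fix k \<xi> assume "k < ival (IVar ''n'') \<eta>" "factor_inv \<mu>0 k \<xi>"
    then show "factor_inv \<mu>0 (Suc k) (run factor_step (\<eta>(''k'' := k)) \<xi>)"
      using sz by (intro factor_step_correct init(1)) (simp_all add: sized_def)
  qed (rule init(2))
  then have I: "factor_inv \<mu>0 n \<mu>1" by (simp add: e)
  have col: "columns_ok \<mu>1 n (n + ?L)" and crd: "coords_ok \<mu>1 (n + ?L)"
    using I by (simp_all add: factor_inv_def)
  have feat: "stored \<mu>1 c 0 n (feature_col c) (feature_total c)" if "c < ?q" for c
    using col that by (simp add: columns_ok_def)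
  have near: "stored \<mu>1 (?q + j) (j - ?L) (Suc j) (\<lambda>i. A i j) (total j)" if "j < n" for j
  proof -
    have "stored \<mu>1 (?q + j) (j - ?L) (min n (Suc j)) (\<lambda>i. A i j) (total j)"
      using col that by (simp add: columns_ok_def trans_less_add1)
    then show ?thesis using that by (simp add: min_absorb2)
  qed
  \<comment> \<open>The slot stopped at step \<open>Suc j\<close>, when the rows up to
    \<open>j\<close> were already final by \<open>M_stable\<close>.\<close>
  have X: "\<mu>1 ''X'' i (?q + j) = M n i j" if "j < n" "i \<le> j" "j \<le> i + ?L" for i j
    using near[OF that(1)] that column_state[of "Suc j" j] M_stable[of i "Suc j" n j]
    by (simp add: stored_def le_diff_conv)
  have Xf: "\<mu>1 ''X'' i c = entry (feature_col c) (feature_total c) (Suc i) i" if "i < n" "c < ?q" for i c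
    using feat[OF that(2)] that entry_stable[of i "Suc i" n] by (simp add: stored_def)
  have RS: "\<mu>1 ''R.S'' j c = coord j c" if "j < n" "?L \<le> j" "c < ?q" for j c
    using crd that by (simp add: coords_ok_def trans_less_add1)
  have \<nu>: "\<nu> = upd_region ''R.B'' (\<lambda>i j. i < n \<and> i \<le> j \<and> j \<le> i + ?L)
      (\<lambda>i j. \<mu>1 ''X'' i (?q + j) - (if i < j then \<Sum>c<?q. \<mu>1 ''X'' i c * \<mu>1 ''R.S'' j c else 0))
    (upd_region ''R.W'' (\<lambda>i c. i < n \<and> c < ?q) (\<lambda>i c. \<mu>1 ''X'' i c) \<mu>1)"
    unfolding \<nu>_def run_store_R by (simp add: e cong: if_cong)
  have YV: "\<nu> ''Y.V'' s a = v s a" if "s < n" "a < r" for s a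
    using I that by (simp add: \<nu> upd_region_other factor_inv_def)
  have YB: "\<nu> ''Y.B'' i s = y s i - (if s < i then \<Sum>a<r. U i a * v s a else 0)"
    if "s < n" "s \<le> i" "i \<le> s + l" for s i
  proof -
    have "\<mu>1 ''Y.B'' i s = y s i - (if s < i then \<Sum>a<r. U i a * v s a else 0)"
      using I that unfolding factor_inv_def by blast
    then show ?thesis by (simp add: \<nu> upd_region_other)
  qed
  have "''Y.U'' \<notin> written factor_step" by (simp add: factor_defs)
  then have YU: "\<nu> ''Y.U'' i a = U i a" if "i < n" "a < r" for i a
    using I init(3)[OF that] by (simp add: \<nu> upd_region_other factor_inv_def)
  show "stores_bps (run factor_prog \<eta> \<mu>) ''Y'' n r 0 l 0 (mat n n (\<lambda>(i, k). y k i))"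
    unfolding run stores_bps_iff
    by (rule eq_matI) (auto simp: YV YB YU y_above y_tail not_le)
  have R: "M n i j = (if i \<le> j \<and> j \<le> i + ?L then \<nu> ''R.B'' i j else 0) +
      (if i < j then \<Sum>a<?q. \<nu> ''R.W'' i a * \<nu> ''R.S'' j a else 0)" if ij: "i < n" "j < n" for i j
  proof -
    have RW: "\<nu> ''R.W'' i c = \<mu>1 ''X'' i c" if "c < ?q" for c
      using ij that by (simp add: \<nu> upd_region_apply)
    have RS': "\<nu> ''R.S'' = \<mu>1 ''R.S''" by (simp add: \<nu> upd_region_other)
    consider "j < i" | "i \<le> j" "j \<le> i + ?L" | "i + ?L < j" by linarith
    then show ?thesis
    proof cases
      case 1
      then show ?thesis using M_annihilated[of n j i] ij by simp
    next
      case 2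
      then have "\<nu> ''R.B'' i j = M n i j - (if i < j then \<Sum>c<?q. \<mu>1 ''X'' i c * \<mu>1 ''R.S'' j c else 0)"
        using ij X[of j i] by (simp add: \<nu> upd_region_apply)
      then show ?thesis using 2 by (simp add: RW RS')
    next
      \<comment> \<open>Being outside the band forces \<open>?L \<le> j\<close>, so the coordinates
        of column \<open>j\<close> are valid here.\<close>
      case 3
      then show ?thesis
        using R_far[OF ij(2) 3] ij by (simp add: RW RS' Xf RS)
    qed
  qed
  show "stores_bps (run factor_prog \<eta> \<mu>) ''R'' n 0 (p + r) 0 (l + m) (mat n n (\<lambda>(i, j). M n i j))"
    unfolding run stores_bps_iff
    by (rule eq_matI) (auto simp: R)
qed

lemma dense_factorization:
  shows "k < n \<Longrightarrow> col (mat n n (\<lambda>(i, k). y k i)) k \<noteq> 0\<^sub>v n"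
    and "mat n n (\<lambda>(i, j). A i j) =
      householder_prod (mat n n (\<lambda>(i, k). y k i)) * mat n n (\<lambda>(i, j). M n i j)"
proof -
  let ?Y = "mat n n (\<lambda>(i, k). y k i)" and ?R = "mat n n (\<lambda>(i, j). M n i j)"
  show nz: "col ?Y k \<noteq> 0\<^sub>v n" if "k < n" for k
  proof
    assume "col ?Y k = 0\<^sub>v n"
    then have "col ?Y k $ k = 0" using that by simp
    then show False using that hvec_pivot_nonzero[OF that] by (simp add: y_def)
  qed
  have Y: "?Y \<in> carrier_mat n n" by simp
  have Q: "householder_prod ?Y \<in> carrier_mat n n" by (rule householder_prod_carrier[OF Y])
  show "mat n n (\<lambda>(i, j). A i j) = householder_prod ?Y * ?R"
  proof (rule eq_matI)
    fix i j assume "i < dim_row (householder_prod ?Y * ?R)" "j < dim_col (householder_prod ?Y * ?R)"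
    then have ij: "i < n" "j < n" using Q by auto
    have "householder_prod ?Y *\<^sub>v vec n (\<lambda>i. M n i j) = vec n (\<lambda>i. M 0 i j)"
      by (rule successive_reflections(1)[OF Y nz, where z = "\<lambda>k i. M k i j"])
        (simp_all add: M_Suc)
    then have "(householder_prod ?Y *\<^sub>v vec n (\<lambda>i. M n i j)) $ i = A i j"
      using ij by (simp add: M_0)
    moreover have "col ?R j = vec n (\<lambda>i. M n i j)" using ij by auto
    ultimately show "mat n n (\<lambda>(i, j). A i j) $$ (i, j) = (householder_prod ?Y * ?R) $$ (i, j)"
      using ij Q by simp
  qed (use Q in auto)
qed

end

lemma qr_factorizes_factor_prog: "qr_factorizes factor_prog"
  unfolding qr_factorizes_def Let_def
proof (intro allI impI)
  fix n r p l m :: nat and A :: "real mat" and \<mu> :: memory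
  assume st: "stores_bps \<mu> ''A'' n r p l m A"
  define \<eta> where "\<eta> = size_env n r p l m"
  define a where "a = bps_entry \<mu> n r p l m"
  \<comment> \<open>Cells beyond row \<open>n - 1\<close> of the stored generators may contain
    anything; zeros replace them for \<open>U\<close> and \<open>W\<close>, matching the padded
    copies made by the program.\<close>
  interpret bps_data n r p l m "\<lambda>i a. if i < n then \<mu> ''A.U'' i a else 0" "\<mu> ''A.V''"
    "\<lambda>i a. if i < n then \<mu> ''A.W'' i a else 0" "\<mu> ''A.S''" a
    by unfold_locales (auto simp: a_def bps_entry_def)
  have sz: "sized \<eta>" by (simp add: sized_def \<eta>_def size_env_def)
  have A: "A = mat n n (\<lambda>(i, j). a i j)"
    using st unfolding stores_bps_iff by (auto simp: a_def bps_entry_def intro!: eq_matI)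
  note fac = factor_prog_correct[OF sz refl refl refl refl a_def]
  have "upper_triangular (mat n n (\<lambda>(i, j). M n i j))"
    by (intro upper_triangularI) (simp add: M_annihilated)
  moreover have "''b'' \<notin> written factor_prog" by (simp add: factor_defs)
  then have "vec_at (run factor_prog \<eta> \<mu>) ''b'' n = vec_at \<mu> ''b'' n"
    by (simp add: vec_at_def run_unwritten)
  ultimately show "vec_at (run factor_prog (size_env n r p l m) \<mu>) ''b'' n = vec_at \<mu> ''b'' n \<and>
    (\<exists>Y R. stores_bps (run factor_prog (size_env n r p l m) \<mu>) ''Y'' n r 0 l 0 Y \<and>
      (\<forall>k<n. col Y k \<noteq> 0\<^sub>v n) \<and>
      stores_bps (run factor_prog (size_env n r p l m) \<mu>) ''R'' n 0 (p + r) 0 (l + m) R \<and>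
      upper_triangular R \<and> A = householder_prod Y * R)"
    unfolding \<eta>_def[symmetric] A using fac dense_factorization by blast
qed

theorem corollary1:
  shows "\<exists>P. qr_based_approach P \<and>
    (\<forall>K. \<exists>C. \<forall>n r p l m A b \<mu>.
       0 < n \<and> r \<le> K \<and> p \<le> K \<and> l \<le> K \<and> m \<le> K \<and>
       A \<in> BPS n r p l m \<and> stores_bps \<mu> ''A'' n r p l m A \<and> invertible_mat A \<and>
       b \<in> carrier_vec n \<and> vec_at \<mu> ''b'' n = b \<longrightarrow>
       A *\<^sub>v vec_at (run P (size_env n r p l m) \<mu>) ''x'' n = b \<and>
       cost P (size_env n r p l m) \<mu> \<le> C * n)"
proof -
  define P where "P = factor_prog ;; apply_prog ;; back_substitution"
  have "qr_based_approach P"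
    unfolding qr_based_approach_def P_def
    using qr_factorizes_factor_prog applies_reflections_apply_prog solves_triangular_back_substitution
    by blast
  moreover have solves: "A *\<^sub>v vec_at (run P (size_env n r p l m) \<mu>) ''x'' n = vec_at \<mu> ''b'' n"
    if "stores_bps \<mu> ''A'' n r p l m A" "invertible_mat A" for n r p l m A \<mu>
    unfolding P_def using that
    by (intro qr_based_approach_solves qr_factorizes_factor_prog applies_reflections_apply_prog
        solves_triangular_back_substitution)
  have "\<exists>C. \<forall>n r p l m A b \<mu>.
       0 < n \<and> r \<le> K \<and> p \<le> K \<and> l \<le> K \<and> m \<le> K \<and>
       A \<in> BPS n r p l m \<and> stores_bps \<mu> ''A'' n r p l m A \<and> invertible_mat A \<and>
       b \<in> carrier_vec n \<and> vec_at \<mu> ''b'' n = b \<longrightarrow>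
       A *\<^sub>v vec_at (run P (size_env n r p l m) \<mu>) ''x'' n = b \<and>
       cost P (size_env n r p l m) \<mu> \<le> C * n" for K
  proof -
    \<comment> \<open>Linearity is read off from the program text: along every nest of loops at most
      one bound involves \<open>n\<close>.\<close>
    have "size_bounded P" "loop_degree P = 1"
      unfolding P_def by (simp_all add: factor_defs back_substitution_def back_init_def back_step_def Let_def size_vars_def)
    then obtain C where C: "\<And>\<eta> \<mu>. small_params K \<eta> \<Longrightarrow> cost P \<eta> \<mu> \<le> C * Suc (\<eta> ''n'')"
      using cost_bound[of P K] by auto
    have "cost P (size_env n r p l m) \<mu> \<le> 2 * C * n"
      if "0 < n" "r \<le> K" "p \<le> K" "l \<le> K" "m \<le> K" for n r p l m \<mu>
    proof -
      have "cost P (size_env n r p l m) \<mu> \<le> C * Suc n"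
        using C[of "size_env n r p l m" \<mu>] that by (simp add: small_params_def size_env_def)
      \<comment> \<open>For \<open>n > 0\<close> one has \<open>Suc n \<le> 2 * n\<close>; this
        absorbs the setup cost and gives the constant \<open>2 * C\<close>.\<close>
      also have "\<dots> \<le> C * (2 * n)" using that by (intro mult_le_mono2) simp
      finally show ?thesis by simp
    qed
    then show ?thesis
      using solves by (intro exI[of _ "2 * C"]) simp
  qed
  ultimately show ?thesis by (intro exI[of _ P] conjI allI)
qed

end
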